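(* Consider the planar four-vortex problem with circulations $\Gamma_1=\Gamma_2=1$ and $\Gamma_3=\Gamma_4=m$, where $m\in(0,1)$ is a parameter. The concave relative equilibria (the kite and asymmetric families) are unstable for all values of $m \in (0,1)$. For each such relative equilibrium, with angular velocity $\omega$, the four nontrivial eigenvalues of the stability matrix consist of one pair of real (nonzero) values $\pm\lambda$ and one pair of pure imaginary (nonzero) values $\pm i\beta$, with $|\beta|\leq\omega$.
   Context: Planar $n$-vortex problem (here $n=4$): vortices at positions $z_i=(x_i,y_i)\in\mathbb{R}^2$ with nonzero real circulations $\Gamma_i$; $z=(z_1,\dots,z_n)\in\mathbb{R}^{2n}$, $r_{ij}=\|z_i-z_j\|$, $\Gamma=\sum_i\Gamma_i\neq0$. Hamiltonian $H(z)=-\sum_{i<j}\Gamma_i\Gamma_j\ln r_{ij}$; equations of motion $\Gamma_i\dot z_i=J\,\partial H/\partial z_i$ with $J=\begin{bmatrix}0&1\\-1&0\end{bmatrix}$. Center of vorticity $c=\frac1\Gamma\sum_i\Gamma_iz_i$. A relative equilibrium is a configuration $z$ with pairwise distinct $z_i$ satisfying, for some $\omega\neq0$ (the angular velocity), $\sum_{j\ne i}\frac{\Gamma_i\Gamma_j}{r_{ij}^2}(z_j-z_i)+\omega\Gamma_i(z_i-c)=0$ for all $i$; it generates the periodic solution $z_i(t)=c+e^{-\omega Jt}(z_i-c)$. For positive circulations $\omega>0$. A four-vortex configuration is concave if one vortex lies strictly inside the convex hull (a triangle) of the other three. A kite is a configuration with an axis of symmetry containing exactly two of the vortices; an asymmetric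 configuration is a noncollinear one with no axis of symmetry. Let $M=\mathrm{diag}\{\Gamma_1,\Gamma_1,\dots,\Gamma_n,\Gamma_n\}$, $K=\mathrm{diag}\{J,\dots,J\}$ ($2n\times2n$ block diagonal), $D^2H(z)$ the matrix of second partial derivatives of $H$, and $\mathrm{Id}$ the $2n\times2n$ identity. The stability matrix is $B(z)=K(M^{-1}D^2H(z)+\omega\,\mathrm{Id})$, the linearization about $z$ in rotating coordinates. It always has the four trivial eigenvalues $0,0,\pm i\omega$ coming from symmetries; the remaining $2n-4$ eigenvalues (counted with multiplicity) are called nontrivial. Here "unstable" means linearly unstable: some eigenvalue of $B(z)$ has nonzero real part. *)

theory Defs
  imports
    "HOL-Analysis.Analysis"
    "Jordan_Normal_Form.Char_Poly"
    "Jordan_Normal_Form.Gauss_Jordan_Elimination"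
begin

text \<open>
  An n-vortex system is given by the list \<open>\<Gamma>\<close> of its circulations, a configuration by the list
  \<open>z\<close> of its positions.  Vortex number \<open>i\<close> of the literature is the list entry \<open>i - 1\<close>.
\<close>

type_synonym plane = "real \<times> real"

definition hamiltonian :: "real list \<Rightarrow> plane list \<Rightarrow> real" where
  "hamiltonian \<Gamma> z =
     - (\<Sum>j<length \<Gamma>. \<Sum>i<j. \<Gamma> ! i * \<Gamma> ! j * ln (dist (z ! i) (z ! j)))"

definition center_of_vorticity :: "real list \<Rightarrow> plane list \<Rightarrow> plane" where
  "center_of_vorticity \<Gamma> z = (1 / sum_list \<Gamma>) *\<^sub>R (\<Sum>i<length \<Gamma>. \<Gamma> ! i *\<^sub>R z ! i)"

definition relative_equilibrium :: "real list \<Rightarrow> real \<Rightarrow> plane list \<Rightarrow> bool" where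
  "relative_equilibrium \<Gamma> \<omega> z \<longleftrightarrow>
     length z = length \<Gamma> \<and> distinct z \<and> \<omega> \<noteq> 0 \<and>
     (\<forall>i<length \<Gamma>.
        (\<Sum>j\<in>{..<length \<Gamma>} - {i}.
            (\<Gamma> ! i * \<Gamma> ! j / (dist (z ! i) (z ! j))\<^sup>2) *\<^sub>R (z ! j - z ! i))
        + (\<omega> * \<Gamma> ! i) *\<^sub>R (z ! i - center_of_vorticity \<Gamma> z) = 0)"


definition concave :: "plane list \<Rightarrow> bool" where
  "concave z \<longleftrightarrow> length z = 4 \<and> distinct z \<and>
     (\<exists>p\<in>set z. p \<in> interior (convex hull (set z - {p})))"

text \<open>Reflection in the line through \<open>a\<close> with unit direction vector \<open>u\<close>.\<close>

definition reflection :: "plane \<Rightarrow> plane \<Rightarrow> plane \<Rightarrow> plane" where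
  "reflection a u p = a + (2 * ((p - a) \<bullet> u)) *\<^sub>R u - (p - a)"

definition axis_of_symmetry :: "plane set \<Rightarrow> plane list \<Rightarrow> bool" where
  "axis_of_symmetry L z \<longleftrightarrow>
     (\<exists>a u. norm u = 1 \<and> L = {a + t *\<^sub>R u | t. True} \<and> reflection a u ` set z = set z)"

definition kite :: "plane list \<Rightarrow> bool" where
  "kite z \<longleftrightarrow> (\<exists>L. axis_of_symmetry L z \<and> card (L \<inter> set z) = 2)"

definition asymmetric :: "plane list \<Rightarrow> bool" where
  "asymmetric z \<longleftrightarrow> \<not> collinear (set z) \<and> \<not> (\<exists>L. axis_of_symmetry L z)"


text \<open>
  The coordinates of \<open>z\<close>, regarded as a point of 2n-space, are ordered
  x_1, y_1, ..., x_n, y_n and numbered from 0: coordinate \<open>k\<close> belongs to the list entry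
  \<open>k div 2\<close> and is its x-component if \<open>k\<close> is even, its y-component if \<open>k\<close> is odd.
\<close>

definition shift_coordinate :: "nat \<Rightarrow> real \<Rightarrow> plane list \<Rightarrow> plane list" where
  "shift_coordinate k h z =
     z[k div 2 := z ! (k div 2) + h *\<^sub>R (if even k then (1, 0) else (0, 1))]"

definition partial_deriv :: "nat \<Rightarrow> (plane list \<Rightarrow> real) \<Rightarrow> plane list \<Rightarrow> real" where
  "partial_deriv k f z = deriv (\<lambda>h. f (shift_coordinate k h z)) 0"

definition hessian :: "real list \<Rightarrow> plane list \<Rightarrow> real mat" where
  "hessian \<Gamma> z = Matrix.mat (2 * length \<Gamma>) (2 * length \<Gamma>)
     (\<lambda>(k, l). partial_deriv k (partial_deriv l (hamiltonian \<Gamma>)) z)"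

definition circulation_matrix :: "real list \<Rightarrow> real mat" where
  "circulation_matrix \<Gamma> = mat_diag (2 * length \<Gamma>) (\<lambda>k. \<Gamma> ! (k div 2))"

definition J_matrix :: "real mat" where
  "J_matrix = mat_of_rows_list 2 [[0, 1], [-1, 0]]"

definition K_matrix :: "nat \<Rightarrow> real mat" where
  "K_matrix n = diag_block_mat (replicate n J_matrix)"

text \<open>
  \<open>mat_inverse\<close> returns an option; for nonzero circulations the inverse of the circulation
  matrix exists.
\<close>

definition stability_matrix :: "real list \<Rightarrow> real \<Rightarrow> plane list \<Rightarrow> real mat" where
  "stability_matrix \<Gamma> \<omega> z = K_matrix (length \<Gamma>) *
     (the (mat_inverse (circulation_matrix \<Gamma>)) * hessian \<Gamma> z + \<omega> \<cdot>\<^sub>m 1\<^sub>m (2 * length \<Gamma>))"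

abbreviation complex_stability_matrix :: "real list \<Rightarrow> real \<Rightarrow> plane list \<Rightarrow> complex mat" where
  "complex_stability_matrix \<Gamma> \<omega> z \<equiv> map_mat complex_of_real (stability_matrix \<Gamma> \<omega> z)"

definition linearly_unstable :: "real list \<Rightarrow> real \<Rightarrow> plane list \<Rightarrow> bool" where
  "linearly_unstable \<Gamma> \<omega> z \<longleftrightarrow>
     (\<exists>\<mu>. eigenvalue (complex_stability_matrix \<Gamma> \<omega> z) \<mu> \<and> Re \<mu> \<noteq> 0)"

text \<open>
  \<open>N\<close> is the multiset of nontrivial eigenvalues: what remains of the spectrum, counted with
  algebraic multiplicity, after the four trivial eigenvalues have been split off.
\<close>

definition nontrivial_eigenvalues ::
    "real list \<Rightarrow> real \<Rightarrow> plane list \<Rightarrow> complex multiset \<Rightarrow> bool" where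
  "nontrivial_eigenvalues \<Gamma> \<omega> z N \<longleftrightarrow>
     proots (char_poly (complex_stability_matrix \<Gamma> \<omega> z)) =
       {# 0, 0, \<i> * complex_of_real \<omega>, - (\<i> * complex_of_real \<omega>) #} + N"

end

theory Submission
  imports Defs
begin

text \<open>
  Put \<open>k = \<omega> / \<Gamma>\<close>. Barycentric coordinates give real weights \<open>a\<^sub>i\<close>, negative exactly at the interior vortex,
  with \<open>\<Sum> \<Gamma>\<^sub>i a\<^sub>i = 0\<close>, \<open>\<Sum> \<Gamma>\<^sub>i a\<^sub>i z\<^sub>i = 0\<close> and \<open>k |z\<^sub>i - z\<^sub>j|\<^sup>2 (1 - a\<^sub>i a\<^sub>j) = 1\<close>. The second variation at the
  equilibrium is then the positive form \<open>\<Sum> \<Gamma>\<^sub>i \<Gamma>\<^sub>j (Re ((f\<^sub>i - f\<^sub>j) / (z\<^sub>i - z\<^sub>j)))\<^sup>2\<close> minus the rank two form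
  \<open>k |\<Sum> \<Gamma>\<^sub>i a\<^sub>i f\<^sub>i|\<^sup>2 / 2\<close>, so its index is at most 2.

  Dually, the weights are a critical point of \<open>\<Sum> \<Gamma>\<^sub>i \<Gamma>\<^sub>j ln (1 - a\<^sub>i a\<^sub>j)\<close> on the hyperplane \<open>\<Sum> \<Gamma>\<^sub>i a\<^sub>i = 0\<close>, and
  the index is 1 if minus the Hessian of this function has signature (2, 1). For two pairs of equal
  circulations the function depends only on the sums and products of the pairs. Its critical points are
  explicit: either one pair has equal weights (a kite), or the derivative with respect to the sum forces
  the products; in both cases the signature can be read off.

  Finally the index is translated into the spectrum. The Hessian acts antilinearly, \<open>v \<mapsto> cnj (S v)\<close> in
  complex notation, so the stability matrix has characteristic polynomial \<open>\<chi> (x\<^sup>2 + \<omega>\<^sup>2)\<close>, where \<open>\<chi>\<close>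
  belongs to \<open>cnj S * S\<close> and has the trivial roots 0 and \<open>\<omega>\<^sup>2\<close>. The vectors \<open>1\<close>, \<open>z\<close>, \<open>cnj z\<close>, \<open>a\<close>
  reduce \<open>S\<close> to a symmetric 2 by 2 block, and index 1 says that \<open>\<omega>\<^sup>2\<close> lies strictly between the two
  remaining roots of \<open>\<chi>\<close>.
\<close>

text \<open>The weights are forced by the equations. For fixed i the numbers \<Gamma>_j (1/r_ij^2 -
  k), completed at i, form an affine relation of the four points, hence are proportional to the
  barycentric one, and symmetry in i and j leaves only a product. The interior vortex makes the
  constants positive; in particular \<omega> > 0 is derived, not assumed.

  An index of at most 2 is not enough: index 0 or 2 would not separate the two remaining roots, so
  one stiff and one soft load must be exhibited. A variation v of the weights produces tensions on
  the edges. If \<open>four_form\<close> is negative at v, the load balanced by these tensions is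
  stiff. If it is positive, a soft deformation results only when the tensions are rates of an actual
  deformation, i.e. orthogonal to the self-stress; this is the single linear condition
  \<open>four_trace = 0\<close>. Signature (2, 1) leaves room for it, since a positive plane meets
  every hyperplane. Inequality of the two circulations enters through the kites, where it keeps the
  form nondegenerate.\<close>

section \<open>Critical weights of two pairs\<close>

text \<open>\<open>(u1 / u)\<^sup>2 - u2 / u\<close> is minus the second logarithmic derivative of a function with 2-jet \<open>(u, u1, u2)\<close>.\<close>

lemma log_jet_mult:
  fixes u w :: real
  assumes "u \<noteq> 0" "w \<noteq> 0"
  shows "((u1 * w + u * w1) / (u * w))\<^sup>2 - (u2 * w + 2 * u1 * w1 + u * w2) / (u * w) =
    ((u1 / u)\<^sup>2 - u2 / u) + ((w1 / w)\<^sup>2 - w2 / w)"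
  using assms by (simp add: field_simps power2_eq_square)

text \<open>Minus the second derivative of ln (1 - x y) along (\<xi>, \<eta>).\<close>

definition pair_form :: "real \<Rightarrow> real \<Rightarrow> real \<Rightarrow> real \<Rightarrow> real" where
  "pair_form x y \<xi> \<eta> = ((y * \<xi> + x * \<eta>) / (1 - x * y))\<^sup>2 + 2 * \<xi> * \<eta> / (1 - x * y)"

definition pair_trace :: "real \<Rightarrow> real \<Rightarrow> real \<Rightarrow> real \<Rightarrow> real" where
  "pair_trace x y \<xi> \<eta> = x * y * (y * \<xi> + x * \<eta>) / (1 - x * y)\<^sup>2"

text \<open>\<open>four_form\<close> is minus the Hessian of \<open>\<mu>\<^sup>2 ln (1 - a1 a2) + \<nu>\<^sup>2 ln (1 - b1 b2) + \<mu> \<nu> \<Sum> ln (1 - a\<^sub>i b\<^sub>j)\<close>;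
  \<open>four_trace\<close> is half of its polar form with the vector \<open>(a1, a2, b1, b2)\<close> at a critical point.\<close>

definition four_form where
  "four_form \<mu> \<nu> a1 a2 b1 b2 v1 v2 w1 w2 =
    \<mu>\<^sup>2 * pair_form a1 a2 v1 v2 + \<nu>\<^sup>2 * pair_form b1 b2 w1 w2 + \<mu> * \<nu> *
     (pair_form a1 b1 v1 w1 + pair_form a1 b2 v1 w2 + pair_form a2 b1 v2 w1 + pair_form a2 b2 v2 w2)"

definition four_trace where
  "four_trace \<mu> \<nu> a1 a2 b1 b2 v1 v2 w1 w2 =
    \<mu>\<^sup>2 * pair_trace a1 a2 v1 v2 + \<nu>\<^sup>2 * pair_trace b1 b2 w1 w2 + \<mu> * \<nu> *
     (pair_trace a1 b1 v1 w1 + pair_trace a1 b2 v1 w2 + pair_trace a2 b1 v2 w1 + pair_trace a2 b2 v2 w2)"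

text \<open>The balance constraint ties b1 + b2 to a1 + a2, so the product \<open>F\<close> of the
  four cross factors depends only on the sum s and the products P, Q. \<open>F1\<close> and
  \<open>F2\<close> are its first and second derivatives along the variation, and
  \<open>log_jet_mult\<close> identifies its logarithmic jet with the sum of the four cross
  terms.\<close>

lemma four_form_jets:
  fixes p :: real
  assumes "p \<noteq> 0" and vw: "v1 + v2 = - p * (w1 + w2)" and ab: "a1 + a2 = - p * (b1 + b2)"
    and u: "1 - a1 * b1 \<noteq> 0" "1 - a1 * b2 \<noteq> 0" "1 - a2 * b1 \<noteq> 0" "1 - a2 * b2 \<noteq> 0"
    and P: "P = a1 * a2" "P1 = a1 * v2 + a2 * v1" "P2 = 2 * v1 * v2"
    and Q: "Q = b1 * b2" "Q1 = b1 * w2 + b2 * w1" "Q2 = 2 * w1 * w2"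
    and s: "s = a1 + a2" "s1 = v1 + v2"
    and F: "F = (1 - P * Q)\<^sup>2 + s\<^sup>2 * (p + P) * (1 + p * Q) / p\<^sup>2"
    and F1: "F1 = - 2 * (1 - P * Q) * (P1 * Q + P * Q1)
      + (2 * s * s1 * (p + P) * (1 + p * Q) + s\<^sup>2 * P1 * (1 + p * Q) + s\<^sup>2 * (p + P) * (p * Q1)) / p\<^sup>2"
    and F2: "F2 = 2 * (P1 * Q + P * Q1)\<^sup>2 - 2 * (1 - P * Q) * (P2 * Q + 2 * P1 * Q1 + P * Q2)
      + (2 * s1\<^sup>2 * (p + P) * (1 + p * Q) + s\<^sup>2 * P2 * (1 + p * Q) + s\<^sup>2 * (p + P) * (p * Q2)
         + 4 * s * s1 * P1 * (1 + p * Q) + 4 * s * s1 * (p + P) * (p * Q1) + 2 * s\<^sup>2 * P1 * (p * Q1)) / p\<^sup>2"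
  shows "F = (1 - a1 * b1) * (1 - a1 * b2) * ((1 - a2 * b1) * (1 - a2 * b2))"
    and "four_form 1 p a1 a2 b1 b2 v1 v2 w1 w2 =
     ((P1 / (1 - P))\<^sup>2 + P2 / (1 - P)) + p\<^sup>2 * ((Q1 / (1 - Q))\<^sup>2 + Q2 / (1 - Q)) + p * ((F1 / F)\<^sup>2 - F2 / F)"
proof -
  define u11 u12 u21 u22 where uu: "u11 = 1 - a1 * b1" "u12 = 1 - a1 * b2" "u21 = 1 - a2 * b1" "u22 = 1 - a2 * b2"
  define d11 d12 d21 d22 where dd: "d11 = - (a1 * w1 + b1 * v1)" "d12 = - (a1 * w2 + b2 * v1)"
     "d21 = - (a2 * w1 + b1 * v2)" "d22 = - (a2 * w2 + b2 * v2)"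
  define e11 e12 e21 e22 where ee: "e11 = - 2 * v1 * w1" "e12 = - 2 * v1 * w2" "e21 = - 2 * v2 * w1" "e22 = - 2 * v2 * w2"
  have S: "s = - p * (b1 + b2)" "s1 = - p * (w1 + w2)" using ab vw s by auto
  show Fu: "F = (1 - a1 * b1) * (1 - a1 * b2) * ((1 - a2 * b1) * (1 - a2 * b2))"
  proof -
    have "p\<^sup>2 * F = p\<^sup>2 * ((1 - a1 * b1) * (1 - a1 * b2) * ((1 - a2 * b1) * (1 - a2 * b2)))"
      using S(1) s(1) P(1) Q(1) unfolding F using assms(1) apply (simp add: field_simps) by Groebner_Basis.algebra
    then show ?thesis using assms(1) by simp
  qed
  have F1u: "F1 = (d11 * u12 + u11 * d12) * (u21 * u22) + u11 * u12 * (d21 * u22 + u21 * d22)"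
  proof -
    have "p\<^sup>2 * F1 = p\<^sup>2 * ((d11 * u12 + u11 * d12) * (u21 * u22) + u11 * u12 * (d21 * u22 + u21 * d22))"
      using S s P Q unfolding F1 uu dd using assms(1) apply (simp add: field_simps) by Groebner_Basis.algebra
    then show ?thesis using assms(1) by simp
  qed
  have F2u: "F2 = (e11 * u12 + 2 * d11 * d12 + u11 * e12) * (u21 * u22)
      + 2 * (d11 * u12 + u11 * d12) * (d21 * u22 + u21 * d22)
      + u11 * u12 * (e21 * u22 + 2 * d21 * d22 + u21 * e22)"
  proof -
    have "p\<^sup>2 * F2 = p\<^sup>2 * ((e11 * u12 + 2 * d11 * d12 + u11 * e12) * (u21 * u22)
      + 2 * (d11 * u12 + u11 * d12) * (d21 * u22 + u21 * d22)
      + u11 * u12 * (e21 * u22 + 2 * d21 * d22 + u21 * e22))"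
      using S s P Q unfolding F2 uu dd ee using assms(1) apply (simp add: field_simps) by Groebner_Basis.algebra
    then show ?thesis using assms(1) by simp
  qed
  have nz: "u11 \<noteq> 0" "u12 \<noteq> 0" "u21 \<noteq> 0" "u22 \<noteq> 0" using u uu by auto
  have "(F1 / F)\<^sup>2 - F2 / F = (((d11 / u11)\<^sup>2 - e11 / u11) + ((d12 / u12)\<^sup>2 - e12 / u12))
     + (((d21 / u21)\<^sup>2 - e21 / u21) + ((d22 / u22)\<^sup>2 - e22 / u22))"
    unfolding Fu F1u F2u uu[symmetric] using nz
    by (subst log_jet_mult) (simp_all add: log_jet_mult)
  also have "\<dots> = pair_form a1 b1 v1 w1 + pair_form a1 b2 v1 w2 + pair_form a2 b1 v2 w1 + pair_form a2 b2 v2 w2"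
    unfolding pair_form_def uu dd ee by (simp add: power_divide algebra_simps power2_eq_square add_divide_distrib)
  finally have "(F1 / F)\<^sup>2 - F2 / F = pair_form a1 b1 v1 w1 + pair_form a1 b2 v1 w2 + pair_form a2 b1 v2 w1 + pair_form a2 b2 v2 w2" .
  then show "four_form 1 p a1 a2 b1 b2 v1 v2 w1 w2 =
     ((P1 / (1 - P))\<^sup>2 + P2 / (1 - P)) + p\<^sup>2 * ((Q1 / (1 - Q))\<^sup>2 + Q2 / (1 - Q)) + p * ((F1 / F)\<^sup>2 - F2 / F)"
    unfolding four_form_def pair_form_def[of a1 a2] pair_form_def[of b1 b2] P Q by (simp add: algebra_simps)
qed

text \<open>What remains of the polar form beside \<open>pair_trace\<close> is minus the derivative
  of ln (1 - x y) along (\<xi>, \<eta>); summed over the edges it vanishes at a critical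
  point.\<close>

lemma pair_form_add_scaled:
  shows "pair_form x y (\<xi> + t * x) (\<eta> + t * y) = pair_form x y \<xi> \<eta> + t\<^sup>2 * pair_form x y x y
    + 2 * t * (2 * pair_trace x y \<xi> \<eta> + (x * \<eta> + y * \<xi>) / (1 - x * y))"
  unfolding pair_form_def pair_trace_def divide_inverse power_mult_distrib power_inverse
  by (simp add: algebra_simps power2_eq_square)

text \<open>For distinct weights, the derivatives of their sum and product are coordinates on the
  variations of the pair.\<close>

lemma pair_coordinates:
  fixes x y :: real
  assumes "x \<noteq> y"
  shows "\<exists>\<xi> \<eta>. \<xi> + \<eta> = s1 \<and> x * \<eta> + y * \<xi> = q1"
proof (intro exI conjI)
  show "(x * s1 - q1) / (x - y) + (q1 - y * s1) / (x - y) = s1"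
    using assms by (simp add: divide_simps) (simp add: algebra_simps)
  show "x * ((q1 - y * s1) / (x - y)) + y * ((x * s1 - q1) / (x - y)) = q1"
    using assms by (simp add: divide_simps) (simp add: algebra_simps)
qed

lemma add_divide_triple:
  fixes u :: real
  assumes "u \<noteq> 0" "v \<noteq> 0" "w \<noteq> 0"
  shows "(x / u + y / v + z / w) * (v * w * u) = x * (v * w) + y * (w * u) + z * (v * u)"
  using assms by (simp add: field_simps)

text \<open>Circulations are normalized to 1 and \<open>p\<close>. The interior vortex belongs to
  the pair \<open>b1\<close>, \<open>b2\<close>, and \<kappa> is the Lagrange multiplier of the
  constraint \<open>balance\<close>.\<close>

locale critical_weights =
  fixes p a1 a2 b1 b2 \<kappa> :: real
  assumes p_pos: "0 < p" and a_pos: "0 < a1" "0 < a2" and b_neg: "b1 * b2 < 0"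
    and balance: "a1 + a2 = - p * (b1 + b2)"
    and edge_pos: "1 - a1 * b1 > 0" "1 - a1 * b2 > 0" "1 - a2 * b1 > 0" "1 - a2 * b2 > 0" "1 - a1 * a2 > 0"
    and critical: "a2 / (1 - a1 * a2) + p * b1 / (1 - a1 * b1) + p * b2 / (1 - a1 * b2) = \<kappa>"
      "a1 / (1 - a1 * a2) + p * b1 / (1 - a2 * b1) + p * b2 / (1 - a2 * b2) = \<kappa>"
      "a1 / (1 - a1 * b1) + a2 / (1 - a2 * b1) + p * b2 / (1 - b1 * b2) = \<kappa>"
      "a1 / (1 - a1 * b2) + a2 / (1 - a2 * b2) + p * b1 / (1 - b1 * b2) = \<kappa>"
begin

lemma b_ne: "b1 \<noteq> b2"
  using b_neg by (metis not_square_less_zero)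

lemma edge_ne: "1 - a1 * b1 \<noteq> 0" "1 - a1 * b2 \<noteq> 0" "1 - a2 * b1 \<noteq> 0" "1 - a2 * b2 \<noteq> 0"
  "1 - a1 * a2 \<noteq> 0" "1 - b1 * b2 \<noteq> 0"
  using edge_pos b_neg by linarith+

text \<open>Two combinations of the critical equations of a pair are divisible by the difference of
  its weights: one cancels the term of the pair itself, the other cancels \<kappa>. After the
  division \<open>F\<close> clears the denominators. The b-weights always differ, having opposite
  signs; for the a-weights this has to be assumed.\<close>

lemma critical_relations:
  assumes F: "F = (1 - a1 * b1) * (1 - a1 * b2) * ((1 - a2 * b1) * (1 - a2 * b2))"
    and G: "A1 = (1 - a2 * b1) * (1 - a2 * b2)" "A2 = (1 - a1 * b1) * (1 - a1 * b2)"
      "B1 = (1 - a1 * b2) * (1 - a2 * b2)" "B2 = (1 - a1 * b1) * (1 - a2 * b1)"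
  shows "\<kappa> * F = a1 * A1 + a2 * A2"
    and "p * F = (1 - b1 * b2) * (a1\<^sup>2 * A1 + a2\<^sup>2 * A2)"
    and "a1 \<noteq> a2 \<Longrightarrow> \<kappa> * F = p * (b1 * B1 + b2 * B2)"
    and "a1 \<noteq> a2 \<Longrightarrow> F = p * (1 - a1 * a2) * (b1\<^sup>2 * B1 + b2\<^sup>2 * B2)"
proof -
  define r11 r12 r21 r22 ra rb where r_def: "r11 = inverse (1 - a1 * b1)" "r12 = inverse (1 - a1 * b2)"
    "r21 = inverse (1 - a2 * b1)" "r22 = inverse (1 - a2 * b2)" "ra = inverse (1 - a1 * a2)" "rb = inverse (1 - b1 * b2)"
  have r: "r11 * (1 - a1 * b1) = 1" "r12 * (1 - a1 * b2) = 1" "r21 * (1 - a2 * b1) = 1" "r22 * (1 - a2 * b2) = 1"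
     "ra * (1 - a1 * a2) = 1" "rb * (1 - b1 * b2) = 1"
    using edge_ne by (simp_all add: r_def)
  have g': "a2 * ra + p * b1 * r11 + p * b2 * r12 = \<kappa>" "a1 * ra + p * b1 * r21 + p * b2 * r22 = \<kappa>"
     "a1 * r11 + a2 * r21 + p * b2 * rb = \<kappa>" "a1 * r12 + a2 * r22 + p * b1 * rb = \<kappa>"
    using critical by (simp_all add: r_def divide_inverse)
  have da: "r11 - r21 = r11 * r21 * b1 * (a1 - a2)" "r12 - r22 = r12 * r22 * b2 * (a1 - a2)"
    and db: "r11 - r12 = r11 * r12 * a1 * (b1 - b2)" "r21 - r22 = r21 * r22 * a2 * (b1 - b2)"
    using r by Groebner_Basis.algebra+
  have FA: "F * (r11 * r12) = A1" "F * (r21 * r22) = A2" and FB: "F * (r11 * r21) = B1" "F * (r12 * r22) = B2"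
    unfolding F G using r by Groebner_Basis.algebra+
  have rb: "b1 * a1 * r11 = r11 - 1" "b2 * a1 * r12 = r12 - 1" "b1 * a2 * r21 = r21 - 1" "b2 * a2 * r22 = r22 - 1"
    using r by Groebner_Basis.algebra+
  have "(b1 - b2) * \<kappa> = b1 * (a1 * r11 + a2 * r21 + p * b2 * rb) - b2 * (a1 * r12 + a2 * r22 + p * b1 * rb)"
    unfolding g'(3,4) by (simp add: left_diff_distrib)
  also have "\<dots> = (b1 * a1 * r11 + b1 * a2 * r21) - (b2 * a1 * r12 + b2 * a2 * r22)"
    by (simp add: algebra_simps)
  also have "\<dots> = (r11 - r12) + (r21 - r22)" unfolding rb by simp
  also have "\<dots> = (b1 - b2) * (a1 * (r11 * r12) + a2 * (r21 * r22))" unfolding db by (simp add: algebra_simps)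
  finally have "\<kappa> = a1 * (r11 * r12) + a2 * (r21 * r22)" using b_ne by simp
  then show "\<kappa> * F = a1 * A1 + a2 * A2" unfolding FA[symmetric] by (simp add: algebra_simps)
  have "(b1 - b2) * (p * rb) = a1 * (r11 - r12) + a2 * (r21 - r22)" using g'(3,4) by (simp add: algebra_simps)
  also have "\<dots> = (b1 - b2) * (a1\<^sup>2 * (r11 * r12) + a2\<^sup>2 * (r21 * r22))" unfolding db by (simp add: algebra_simps power2_eq_square)
  finally have "p * rb = a1\<^sup>2 * (r11 * r12) + a2\<^sup>2 * (r21 * r22)" using b_ne by simp
  then have "p * F * (rb * (1 - b1 * b2)) = (1 - b1 * b2) * (a1\<^sup>2 * A1 + a2\<^sup>2 * A2)" unfolding FA[symmetric] by Groebner_Basis.algebra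
  then show "p * F = (1 - b1 * b2) * (a1\<^sup>2 * A1 + a2\<^sup>2 * A2)" using r(6) by simp
  assume a: "a1 \<noteq> a2"
  have "(a1 - a2) * \<kappa> = a1 * (a2 * ra + p * b1 * r11 + p * b2 * r12) - a2 * (a1 * ra + p * b1 * r21 + p * b2 * r22)"
    unfolding g'(1,2) by (simp add: left_diff_distrib)
  also have "\<dots> = p * ((b1 * a1 * r11 - b1 * a2 * r21) + (b2 * a1 * r12 - b2 * a2 * r22))"
    by (simp add: algebra_simps)
  also have "\<dots> = p * ((r11 - r21) + (r12 - r22))" unfolding rb by (simp add: algebra_simps)
  also have "\<dots> = (a1 - a2) * (p * (b1 * (r11 * r21) + b2 * (r12 * r22)))" unfolding da by (simp add: algebra_simps)
  finally have "\<kappa> = p * (b1 * (r11 * r21) + b2 * (r12 * r22))" using a by simp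
  then show "\<kappa> * F = p * (b1 * B1 + b2 * B2)" unfolding FB[symmetric] by (simp add: algebra_simps)
  have "(a1 - a2) * ra = p * (b1 * (r11 - r21) + b2 * (r12 - r22))" using g'(1,2) by (simp add: algebra_simps)
  also have "\<dots> = (a1 - a2) * (p * (b1\<^sup>2 * (r11 * r21) + b2\<^sup>2 * (r12 * r22)))" unfolding da by (simp add: algebra_simps power2_eq_square)
  finally have "ra = p * (b1\<^sup>2 * (r11 * r21) + b2\<^sup>2 * (r12 * r22))" using a by simp
  then have "F * (ra * (1 - a1 * a2)) = p * (1 - a1 * a2) * (b1\<^sup>2 * B1 + b2\<^sup>2 * B2)" unfolding FB[symmetric] by Groebner_Basis.algebra
  then show "F = p * (1 - a1 * a2) * (b1\<^sup>2 * B1 + b2\<^sup>2 * B2)" using r(5) by simp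
qed

text \<open>The first-order terms add up to \<kappa> times the balance of the variation, which is
  zero.\<close>

lemma four_form_add_scaled:
  assumes vw: "v1 + v2 = - p * (w1 + w2)"
  shows "four_form 1 p a1 a2 b1 b2 (v1 + t * a1) (v2 + t * a2) (w1 + t * b1) (w2 + t * b2)
    = four_form 1 p a1 a2 b1 b2 v1 v2 w1 w2 + t\<^sup>2 * four_form 1 p a1 a2 b1 b2 a1 a2 b1 b2
      + 4 * t * four_trace 1 p a1 a2 b1 b2 v1 v2 w1 w2"
proof -
  have "(a1 * v2 + a2 * v1) / (1 - a1 * a2) + p\<^sup>2 * ((b1 * w2 + b2 * w1) / (1 - b1 * b2))
    + p * ((a1 * w1 + b1 * v1) / (1 - a1 * b1) + (a1 * w2 + b2 * v1) / (1 - a1 * b2)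
     + (a2 * w1 + b1 * v2) / (1 - a2 * b1) + (a2 * w2 + b2 * v2) / (1 - a2 * b2))
    = v1 * (a2 / (1 - a1 * a2) + p * b1 / (1 - a1 * b1) + p * b2 / (1 - a1 * b2))
     + v2 * (a1 / (1 - a1 * a2) + p * b1 / (1 - a2 * b1) + p * b2 / (1 - a2 * b2))
     + p * w1 * (a1 / (1 - a1 * b1) + a2 / (1 - a2 * b1) + p * b2 / (1 - b1 * b2))
     + p * w2 * (a1 / (1 - a1 * b2) + a2 / (1 - a2 * b2) + p * b1 / (1 - b1 * b2))"
    by (simp add: algebra_simps add_divide_distrib power2_eq_square)
  also have "\<dots> = \<kappa> * (v1 + v2 + p * (w1 + w2))" unfolding critical by (simp add: algebra_simps)
  also have "\<dots> = 0" using vw by simp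
  finally have lin: "(a1 * v2 + a2 * v1) / (1 - a1 * a2) + p\<^sup>2 * ((b1 * w2 + b2 * w1) / (1 - b1 * b2))
    + p * ((a1 * w1 + b1 * v1) / (1 - a1 * b1) + (a1 * w2 + b2 * v1) / (1 - a1 * b2)
     + (a2 * w1 + b1 * v2) / (1 - a2 * b1) + (a2 * w2 + b2 * v2) / (1 - a2 * b2)) = 0" .
  have "four_form 1 p a1 a2 b1 b2 (v1 + t * a1) (v2 + t * a2) (w1 + t * b1) (w2 + t * b2)
    = four_form 1 p a1 a2 b1 b2 v1 v2 w1 w2 + t\<^sup>2 * four_form 1 p a1 a2 b1 b2 a1 a2 b1 b2
      + 4 * t * four_trace 1 p a1 a2 b1 b2 v1 v2 w1 w2
      + 2 * t * ((a1 * v2 + a2 * v1) / (1 - a1 * a2) + p\<^sup>2 * ((b1 * w2 + b2 * w1) / (1 - b1 * b2))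
    + p * ((a1 * w1 + b1 * v1) / (1 - a1 * b1) + (a1 * w2 + b2 * v1) / (1 - a1 * b2)
     + (a2 * w1 + b1 * v2) / (1 - a2 * b1) + (a2 * w2 + b2 * v2) / (1 - a2 * b2)))"
    unfolding four_form_def four_trace_def pair_form_add_scaled
    by (simp only: algebra_simps power_one)
  then show ?thesis unfolding lin by simp
qed

lemma four_trace_polarization:
  assumes ff: "\<And>v1 v2 w1 w2. v1 + v2 = - p * (w1 + w2) \<Longrightarrow>
    four_form 1 p a1 a2 b1 b2 v1 v2 w1 w2 =
      A * (a1 * v2 + a2 * v1)\<^sup>2 + B * (b1 * w2 + b2 * w1)\<^sup>2
      + C * ((a1 * v2 + a2 * v1) * (b1 * w2 + b2 * w1)) - c * ((v1 + v2) * (b1 * w2 + b2 * w1))"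
   and vw: "v1 + v2 = - p * (w1 + w2)"
  shows "4 * four_trace 1 p a1 a2 b1 b2 v1 v2 w1 w2 =
     4 * A * (a1 * a2) * (a1 * v2 + a2 * v1) + 4 * B * (b1 * b2) * (b1 * w2 + b2 * w1)
      + 2 * C * ((a1 * a2) * (b1 * w2 + b2 * w1) + (b1 * b2) * (a1 * v2 + a2 * v1))
      - c * (2 * (b1 * b2) * (v1 + v2) + (a1 + a2) * (b1 * w2 + b2 * w1))"
proof -
  have vw': "(v1 + a1) + (v2 + a2) = - p * ((w1 + b1) + (w2 + b2))" using balance vw by (simp add: algebra_simps)
  have "4 * four_trace 1 p a1 a2 b1 b2 v1 v2 w1 w2 = four_form 1 p a1 a2 b1 b2 (v1 + 1 * a1) (v2 + 1 * a2) (w1 + 1 * b1) (w2 + 1 * b2)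
    - four_form 1 p a1 a2 b1 b2 v1 v2 w1 w2 - four_form 1 p a1 a2 b1 b2 a1 a2 b1 b2"
    unfolding four_form_add_scaled[OF vw] by simp
  also have "\<dots> = 4 * A * (a1 * a2) * (a1 * v2 + a2 * v1) + 4 * B * (b1 * b2) * (b1 * w2 + b2 * w1)
      + 2 * C * ((a1 * a2) * (b1 * w2 + b2 * w1) + (b1 * b2) * (a1 * v2 + a2 * v1))
      - c * (2 * (b1 * b2) * (v1 + v2) + (a1 + a2) * (b1 * w2 + b2 * w1))"
    unfolding mult_1 ff[OF vw] ff[OF balance] ff[OF vw'] by (simp add: algebra_simps power2_eq_square)
  finally show ?thesis .
qed

section \<open>Critical points whose positive pair has distinct weights\<close>

lemma asymmetric_critical_point:
  assumes "a1 \<noteq> a2" and P: "P = a1 * a2" and Q: "Q = b1 * b2" and s: "s = a1 + a2"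
  shows "p * Q = - 1" "P * (1 + 2 * p) = p" "s\<^sup>2 * (1 + p) = p * (p + P) + 2 * P * (1 + p)"
proof -
  define F where "F = (1 - a1 * b1) * (1 - a1 * b2) * ((1 - a2 * b1) * (1 - a2 * b2))"
  define A1 where "A1 = (1 - a2 * b1) * (1 - a2 * b2)"
  define A2 where "A2 = (1 - a1 * b1) * (1 - a1 * b2)"
  define B1 where "B1 = (1 - a1 * b2) * (1 - a2 * b2)"
  define B2 where "B2 = (1 - a1 * b1) * (1 - a2 * b1)"
  note rel = critical_relations[OF F_def A1_def A2_def B1_def B2_def]
  have R1: "\<kappa> * F = a1 * A1 + a2 * A2" and R2: "p * F = (1 - Q) * (a1\<^sup>2 * A1 + a2\<^sup>2 * A2)"
    and R3: "\<kappa> * F = p * (b1 * B1 + b2 * B2)" and R4: "F = p * (1 - P) * (b1\<^sup>2 * B1 + b2\<^sup>2 * B2)"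
    unfolding P Q using rel assms(1) by auto
  define S where "S = b1 + b2"
  have sS: "s = - p * S" using balance s S_def by simp
  have Ppos: "P > 0" and spos: "s > 0" using a_pos P s by auto
  have Fp: "F = (1 - P * Q)\<^sup>2 - S * s * (1 + P * Q) + Q * s\<^sup>2 + P * S\<^sup>2"
    unfolding F_def P Q S_def s by Groebner_Basis.algebra
  have ea: "a1 * A1 + a2 * A2 = s - 2 * S * P + P * Q * s" unfolding A1_def A2_def P Q S_def s by Groebner_Basis.algebra
  have eb: "b1 * B1 + b2 * B2 = S - 2 * s * Q + P * Q * S" unfolding B1_def B2_def P Q S_def s by Groebner_Basis.algebra
  have ea2: "a1\<^sup>2 * A1 + a2\<^sup>2 * A2 = s\<^sup>2 - 2 * P - S * P * s + 2 * Q * P\<^sup>2" unfolding A1_def A2_def P Q S_def s by Groebner_Basis.algebra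
  have eb2: "b1\<^sup>2 * B1 + b2\<^sup>2 * B2 = S\<^sup>2 - 2 * Q - s * Q * S + 2 * P * Q\<^sup>2" unfolding B1_def B2_def P Q S_def s by Groebner_Basis.algebra
  have "p * (s - 2 * S * P + P * Q * s) = p * (p * (S - 2 * s * Q + P * Q * S))" using R1 R3 unfolding ea eb by simp
  then have "2 * s * ((p + P) * (1 + p * Q)) = 0" using sS by Groebner_Basis.algebra
  moreover have "p + P \<noteq> 0" using Ppos p_pos by simp
  ultimately show pQ: "p * Q = - 1" using spos by auto
  have PQ: "1 - P * Q > 0" using mult_pos_neg[OF Ppos, of Q] Q b_neg by linarith
  have pPQ: "p * (1 - P * Q) = p + P" using pQ by Groebner_Basis.algebra
  \<comment> \<open>The dependence of \<open>F\<close> on \<open>s\<close> carries the factor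
    \<open>1 + p * Q\<close>, which is now zero.\<close>
  have "p\<^sup>2 * F = p\<^sup>2 * (1 - P * Q)\<^sup>2" unfolding Fp using sS pQ by Groebner_Basis.algebra
  then have FF: "F = (1 - P * Q)\<^sup>2" using p_pos by simp
  have "p * (S\<^sup>2 - 2 * Q - s * Q * S + 2 * P * Q\<^sup>2) = 2 * (1 - P * Q)" using sS pQ by Groebner_Basis.algebra
  then have "(1 - P * Q)\<^sup>2 = (1 - P) * (2 * (1 - P * Q))" using R4 unfolding FF eb2 by (simp add: mult.assoc mult.left_commute)
  then have "(1 - P * Q) * (1 - P * Q - 2 * (1 - P)) = 0" by (simp add: power2_eq_square algebra_simps)
  then have "1 - P * Q = 2 * (1 - P)" using PQ by simp
  then show "P * (1 + 2 * p) = p" using pPQ by Groebner_Basis.algebra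
  have "p * (p * F) = p * (1 - Q) * (s\<^sup>2 - 2 * P - S * P * s + 2 * Q * P\<^sup>2)" using R2 unfolding ea2 by simp
  then have "(p + P)\<^sup>2 = (p + 1) * (s\<^sup>2 - 2 * P - S * P * s + 2 * Q * P\<^sup>2)" unfolding FF using pPQ pQ by Groebner_Basis.algebra
  then have "p * (p + P)\<^sup>2 = p * ((p + 1) * (s\<^sup>2 - 2 * P - S * P * s + 2 * Q * P\<^sup>2))" by simp
  then have "p * (p + P)\<^sup>2 = (p + 1) * (p * (s\<^sup>2 - 2 * P) - p * S * P * s + 2 * (p * Q) * P\<^sup>2)"
    by (simp add: algebra_simps)
  then have "(p + P) * (p * (p + P)) = (p + P) * ((p + 1) * (s\<^sup>2 - 2 * P))"
    unfolding pQ using sS by Groebner_Basis.algebra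
  then have "p * (p + P) = (p + 1) * (s\<^sup>2 - 2 * P)" using \<open>p + P \<noteq> 0\<close> by (metis mult_left_cancel)
  then show "s\<^sup>2 * (1 + p) = p * (p + P) + 2 * P * (1 + p)" by (simp add: algebra_simps)
qed

text \<open>The second-order jets of P and Q enter linearly, with the first derivatives in P and Q
  as coefficients; these vanish at the critical point. The square of the derivative of s carries the
  factor 1 + p Q = 0. What survives is positive in P1 and, through the term with c, hyperbolic in s1
  and Q1: signature (2, 1).\<close>

lemma asymmetric_four_form:
  assumes "a1 \<noteq> a2"
  shows "\<exists>A B C c. 0 < A \<and> 0 < c \<and> (\<forall>v1 v2 w1 w2. v1 + v2 = - p * (w1 + w2) \<longrightarrow>
    four_form 1 p a1 a2 b1 b2 v1 v2 w1 w2 =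
      A * (a1 * v2 + a2 * v1)\<^sup>2 + B * (b1 * w2 + b2 * w1)\<^sup>2
      + C * ((a1 * v2 + a2 * v1) * (b1 * w2 + b2 * w1)) - c * ((v1 + v2) * (b1 * w2 + b2 * w1)))"
proof -
  define P Q s k where "P = a1 * a2" "Q = b1 * b2" "s = a1 + a2" "k = 1 - P * Q"
  note PQs = this
  note cr = asymmetric_critical_point[OF assms PQs(1-3)]
  have Ppos: "0 < P" and P1: "0 < 1 - P" and Q1: "0 < 1 - Q" and spos: "0 < s"
    using PQs a_pos b_neg edge_pos by auto
  have kpos: "0 < k" unfolding PQs(4) using mult_pos_neg[OF Ppos, of Q] PQs(2) b_neg by simp
  have pk: "p * k = p + P" unfolding PQs(4) using cr(1) by Groebner_Basis.algebra
  have kP: "k = 2 * (1 - P)"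
  proof -
    have "p * k = p * (2 * (1 - P))" using pk cr(2) by (simp add: algebra_simps)
    then show ?thesis using p_pos by simp
  qed
  have pQ0: "1 + p * Q = 0" using cr(1) by simp
  have cP: "1 / (1 - P) + 2 * p * Q / k = 0" proof -
    have "2 * p * Q = - 2" using cr(1) by linarith
    show ?thesis unfolding \<open>2 * p * Q = - 2\<close> kP using P1 by (simp add: divide_simps)
  qed
  have "p\<^sup>2 / (1 - Q) = p ^ 3 / (p + 1)"
    using Q1 p_pos cr(1) by (simp add: field_simps power2_eq_square power3_eq_cube)
  then have cQ: "p\<^sup>2 / (1 - Q) + 2 * p * P / k - s\<^sup>2 * (p + P) / k\<^sup>2 = 0"
  proof -
    have "s\<^sup>2 = p * (p + P) / (1 + p) + 2 * P" using cr(3) p_pos by (simp add: field_simps)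
    moreover have "(p + P) = p * k" using pk by simp
    ultimately have "s\<^sup>2 * (p + P) / k\<^sup>2 = (p * (p * k) / (1 + p) + 2 * P) * p / k"
      using kpos by (simp add: power2_eq_square)
    also have "\<dots> = p ^ 3 / (p + 1) + 2 * p * P / k"
      using kpos p_pos by (simp add: field_simps power2_eq_square power3_eq_cube)
    finally show ?thesis using \<open>p\<^sup>2 / (1 - Q) = p ^ 3 / (p + 1)\<close> by simp
  qed
  define A B C c where "A = 1 / (1 - P)\<^sup>2 + 2 * p * Q\<^sup>2 / k\<^sup>2"
    "B = p\<^sup>2 / (1 - Q)\<^sup>2 + p * ((s\<^sup>2 * (p + P) / p - 2 * k * P)\<^sup>2 / k ^ 4 - 2 * P\<^sup>2 / k\<^sup>2)"
    "C = p * (- 4 * Q * (s\<^sup>2 * (p + P) / p - 2 * k * P) / k ^ 3 - (4 * P * Q - 4 * k + 2 * s\<^sup>2 / p) / k\<^sup>2)"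
    "c = 4 * s * (p + P) / k\<^sup>2"
  note ABC = this
  have "A > 0" "c > 0" unfolding ABC using P1 p_pos kpos spos Ppos by (auto intro!: add_pos_nonneg)
  moreover have "four_form 1 p a1 a2 b1 b2 v1 v2 w1 w2 =
      A * (a1 * v2 + a2 * v1)\<^sup>2 + B * (b1 * w2 + b2 * w1)\<^sup>2
      + C * ((a1 * v2 + a2 * v1) * (b1 * w2 + b2 * w1)) - c * ((v1 + v2) * (b1 * w2 + b2 * w1))"
    if vw: "v1 + v2 = - p * (w1 + w2)" for v1 v2 w1 w2
  proof -
    define P1 P2 Q1 Q2 s1 where jets: "P1 = a1 * v2 + a2 * v1" "P2 = 2 * v1 * v2" "Q1 = b1 * w2 + b2 * w1" "Q2 = 2 * w1 * w2" "s1 = v1 + v2"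
    have une: "1 - a1 * b1 \<noteq> 0" "1 - a1 * b2 \<noteq> 0" "1 - a2 * b1 \<noteq> 0" "1 - a2 * b2 \<noteq> 0" "p \<noteq> 0"
      using edge_pos p_pos by auto
    have ff: "four_form 1 p a1 a2 b1 b2 v1 v2 w1 w2 =
     ((P1 / (1 - P))\<^sup>2 + P2 / (1 - P)) + p\<^sup>2 * ((Q1 / (1 - Q))\<^sup>2 + Q2 / (1 - Q))
       + p * (((- 2 * k * (P1 * Q + P * Q1) + s\<^sup>2 * (p + P) * (p * Q1) / p\<^sup>2) / k\<^sup>2)\<^sup>2
         - (2 * (P1 * Q + P * Q1)\<^sup>2 - 2 * k * (P2 * Q + 2 * P1 * Q1 + P * Q2)
             + (s\<^sup>2 * (p + P) * (p * Q2) + 4 * s * s1 * (p + P) * (p * Q1) + 2 * s\<^sup>2 * P1 * (p * Q1)) / p\<^sup>2) / k\<^sup>2)"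
      by (subst four_form_jets(2)[OF une(5) vw balance une(1-4) PQs(1) jets(1,2) PQs(2) jets(3,4) PQs(3) jets(5) refl refl refl])
        (simp only: PQs(4)[symmetric] pQ0 mult_zero_right mult_zero_left add_0_left add_0_right div_0)
    have e1: "s\<^sup>2 * (p + P) * (p * Q1) / p\<^sup>2 = s\<^sup>2 * (p + P) / p * Q1"
      "(s\<^sup>2 * (p + P) * (p * Q2) + 4 * s * s1 * (p + P) * (p * Q1) + 2 * s\<^sup>2 * P1 * (p * Q1)) / p\<^sup>2
       = (s\<^sup>2 * (p + P) / p) * Q2 + (4 * s * (p + P) / p) * s1 * Q1 + (2 * s\<^sup>2 / p) * P1 * Q1"
      using p_pos by (simp_all add: field_simps power2_eq_square)
    have "four_form 1 p a1 a2 b1 b2 v1 v2 w1 w2 = A * P1\<^sup>2 + B * Q1\<^sup>2 + C * (P1 * Q1) - c * (s1 * Q1)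
       + P2 * (1 / (1 - P) + 2 * p * Q / k) + Q2 * (p\<^sup>2 / (1 - Q) + 2 * p * P / k - s\<^sup>2 * (p + P) / k\<^sup>2)"
      unfolding ff e1 ABC using p_pos kpos \<open>0 < 1 - P\<close> \<open>0 < 1 - Q\<close>
      by (simp add: divide_simps power2_eq_square power3_eq_cube power4_eq_xxxx) (simp add: algebra_simps)
    then show ?thesis unfolding cP cQ jets by simp
  qed
  ultimately show ?thesis by blast
qed

lemma asymmetric_directions:
  assumes "a1 \<noteq> a2"
  shows "\<exists>v1 v2 w1 w2. v1 + v2 = - p * (w1 + w2) \<and> four_form 1 p a1 a2 b1 b2 v1 v2 w1 w2 < 0"
    and "\<exists>v1 v2 w1 w2. v1 + v2 = - p * (w1 + w2) \<and> four_trace 1 p a1 a2 b1 b2 v1 v2 w1 w2 = 0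
       \<and> four_form 1 p a1 a2 b1 b2 v1 v2 w1 w2 > 0"
proof -
  obtain A B C c where "0 < A" "0 < c" and ff: "\<And>v1 v2 w1 w2. v1 + v2 = - p * (w1 + w2) \<Longrightarrow>
    four_form 1 p a1 a2 b1 b2 v1 v2 w1 w2 =
      A * (a1 * v2 + a2 * v1)\<^sup>2 + B * (b1 * w2 + b2 * w1)\<^sup>2
      + C * ((a1 * v2 + a2 * v1) * (b1 * w2 + b2 * w1)) - c * ((v1 + v2) * (b1 * w2 + b2 * w1))"
    using asymmetric_four_form[OF assms] by metis
  have ex: "\<exists>v1 v2 w1 w2. v1 + v2 = s1 \<and> v1 + v2 = - p * (w1 + w2) \<and> a1 * v2 + a2 * v1 = P1 \<and> b1 * w2 + b2 * w1 = Q1" for s1 P1 Q1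
    using pair_coordinates[OF assms, of s1 P1] pair_coordinates[OF b_ne, of "- s1 / p" Q1] p_pos
    by (metis (no_types, opaque_lifting) minus_divide_left minus_minus mult_minus_left nonzero_mult_div_cancel_left
       less_irrefl times_divide_eq_right)
  \<comment> \<open>With \<open>P1 = 0\<close> and \<open>Q1 = 1\<close> this sum turns the form
    into B - (B + 1).\<close>
  obtain v1 v2 w1 w2 where v: "v1 + v2 = (B + 1) / c" "v1 + v2 = - p * (w1 + w2)"
    "a1 * v2 + a2 * v1 = 0" "b1 * w2 + b2 * w1 = 1" using ex by blast
  have "four_form 1 p a1 a2 b1 b2 v1 v2 w1 w2 = - 1"
    unfolding ff[OF v(2)] v(3,4) unfolding v(1) using \<open>0 < c\<close> by simp
  then show "\<exists>v1 v2 w1 w2. v1 + v2 = - p * (w1 + w2) \<and> four_form 1 p a1 a2 b1 b2 v1 v2 w1 w2 < 0"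
    using v(2) by (metis less_minus_one_simps(1))
  \<comment> \<open>With \<open>Q1 = 0\<close> the form is \<open>A * P1\<^sup>2\<close> for every
    sum \<open>s1\<close>, so \<open>s1\<close> is free to solve \<open>four_trace = 0\<close>; its
    coefficient there is nonzero because \<open>b1 * b2 < 0\<close>.\<close>
  obtain v1 v2 w1 w2 where v: "v1 + v2 = (4 * A * (a1 * a2) + 2 * C * (b1 * b2)) / (2 * c * (b1 * b2))" "v1 + v2 = - p * (w1 + w2)"
    "a1 * v2 + a2 * v1 = 1" "b1 * w2 + b2 * w1 = 0" using ex by blast
  have "4 * four_trace 1 p a1 a2 b1 b2 v1 v2 w1 w2 =
     4 * A * (a1 * a2) * (a1 * v2 + a2 * v1) + 4 * B * (b1 * b2) * (b1 * w2 + b2 * w1)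
      + 2 * C * ((a1 * a2) * (b1 * w2 + b2 * w1) + (b1 * b2) * (a1 * v2 + a2 * v1))
      - c * (2 * (b1 * b2) * (v1 + v2) + (a1 + a2) * (b1 * w2 + b2 * w1))"
    by (rule four_trace_polarization[OF _ v(2)]) (rule ff)
  also have "\<dots> = 0"
    unfolding v(3,4) unfolding v(1) using \<open>0 < c\<close> b_neg by (auto simp: divide_simps)
  finally have "4 * four_trace 1 p a1 a2 b1 b2 v1 v2 w1 w2 = 0" .
  moreover have "four_form 1 p a1 a2 b1 b2 v1 v2 w1 w2 = A"
    unfolding ff[OF v(2)] v(3,4) by simp
  ultimately show "\<exists>v1 v2 w1 w2. v1 + v2 = - p * (w1 + w2) \<and> four_trace 1 p a1 a2 b1 b2 v1 v2 w1 w2 = 0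
       \<and> four_form 1 p a1 a2 b1 b2 v1 v2 w1 w2 > 0"
    using v(2) \<open>0 < A\<close> by (metis mult_eq_0_iff zero_neq_numeral)
qed

end

section \<open>Critical points whose positive pair has equal weights: kites\<close>

locale critical_kite = critical_weights p a a b1 b2 \<kappa> for p a b1 b2 \<kappa> +
  assumes p_ne: "p \<noteq> 1"
begin

text \<open>\<open>L\<close> arises from a (b1 + b2) = - 2 P / p, which makes \<open>D\<close> a
  function of P and Q alone. The second and third conclusions are stationarity in P and in Q; the
  next two eliminate \<open>D\<close> and Q from them.\<close>

lemma kite_critical_point:
  assumes P: "P = a * a" and Q: "Q = b1 * b2" and L: "L = 2 / p + Q" and D: "D = 1 + P * L"
  shows "D = (1 - a * b1) * (1 - a * b2)" "D = 2 * p * L * (1 - P)" "p * D = 2 * P * (1 - Q)"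
    "(2 * p + 1) * (P * L) = 2 * (p * L) - 1" "(2 + p) * (2 - p * L) * P = p\<^sup>2" "p * L \<noteq> 1" "0 < L" "0 < D"
proof -
  define S where "S = b1 + b2"
  have aS: "a + a = - p * S" using balance S_def by simp
  have pL: "p * L = 2 + p * Q" unfolding L using p_pos by (simp add: field_simps)
  have une: "1 - a * b1 \<noteq> 0" "1 - a * b2 \<noteq> 0" "1 - a * a \<noteq> 0" "1 - b1 * b2 \<noteq> 0" using edge_ne by auto
  have "p * D = p * ((1 - a * b1) * (1 - a * b2))" unfolding D P Q using pL aS unfolding Q S_def by Groebner_Basis.algebra
  then show De: "D = (1 - a * b1) * (1 - a * b2)" using p_pos by simp
  then show Dpos: "0 < D" using edge_pos by simp
  note rel = critical_relations[OF refl refl refl refl refl, folded De]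
  have "\<kappa> * D * D = 2 * a * D" using rel(1) by (simp add: algebra_simps)
  then have kD: "\<kappa> * D = 2 * a" using Dpos by simp
  have "p * (D * D) = (1 - Q) * (2 * P * D)" using rel(2) unfolding P Q by (simp add: algebra_simps power2_eq_square)
  then have "D * (p * D) = D * (2 * P * (1 - Q))" by (simp add: algebra_simps)
  then show pD: "p * D = 2 * P * (1 - Q)" using Dpos by (metis less_irrefl mult_left_cancel)
  have "\<kappa> * (D * (1 - P)) = a * D + p * (1 - P) * (b1 * (1 - a * b2) + b2 * (1 - a * b1))"
    unfolding critical(1)[symmetric] De P using add_divide_triple[OF une(3,1,2), of a "p * b1" "p * b2"] by Groebner_Basis.algebra
  also have "\<dots> = a * D - (1 - P) * (2 * a + 2 * a * (p * Q))" using aS unfolding S_def P Q by Groebner_Basis.algebra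
  finally have "a * D = a * ((1 - P) * (2 * (2 + p * Q)))" using kD by Groebner_Basis.algebra
  then have "D = (1 - P) * (2 * (p * L))" unfolding pL using a_pos by (metis less_irrefl mult_left_cancel)
  then show D2: "D = 2 * p * L * (1 - P)" by simp
  have P1: "0 < 1 - P" and Ppos: "0 < P" using edge_pos P a_pos by auto
  show "0 < L" using D2 P1 Dpos p_pos by (simp add: zero_less_mult_iff)
  show e1: "(2 * p + 1) * (P * L) = 2 * (p * L) - 1" using D2 unfolding D by (simp add: algebra_simps)
  have "p * (p * D) = p * (2 * P * (1 - Q))" using pD by simp
  then show e2: "(2 + p) * (2 - p * L) * P = p\<^sup>2" using pL unfolding D by Groebner_Basis.algebra
  show "p * L \<noteq> 1"
  proof
    \<comment> \<open>Here the circulations have to differ: both relations now determine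
      \<open>P\<close>, and they are compatible only for \<open>p = 1\<close>.\<close>
    assume l: "p * L = 1"
    have P1: "(2 * p + 1) * P = p" using e1 l by Groebner_Basis.algebra
    have P2: "(2 + p) * P = p\<^sup>2" using e2 l by simp
    have "(2 + p) * ((2 * p + 1) * P) = (2 * p + 1) * ((2 + p) * P)" by simp
    then have "p * ((2 + p) - p * (2 * p + 1)) = 0" unfolding P1 P2 by (simp add: algebra_simps power2_eq_square)
    then have "(p - 1) * (p + 1) = 0" using p_pos by (simp add: algebra_simps)
    then show False using p_pos p_ne by simp
  qed
qed

text \<open>On variations keeping the two positive weights equal, \<open>x\<close> and
  \<open>y\<close> are the derivatives of P and Q and serve as coordinates. The second-order parts
  cancel by stationarity in P and Q.\<close>

lemma kite_symmetric_form:
  assumes D: "P = a * a" "Q = b1 * b2" "L = 2 / p + Q" "D = 1 + P * L"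
    and vw: "v + v = - p * (w1 + w2)"
    and x: "x = 2 * a * v" and y: "y = b1 * w2 + b2 * w1"
  shows "four_form 1 p a a b1 b2 v v w1 w2 =
    2 * (p * (2 * p + 1) * L\<^sup>2 * x\<^sup>2 + (2 + p) * P\<^sup>2 * y\<^sup>2 - 2 * p * x * y) / D\<^sup>2"
proof -
  note cr = kite_critical_point[OF D]
  define d1 d2 e1 e2 where de: "d1 = - (a * w1 + b1 * v)" "d2 = - (a * w2 + b2 * v)" "e1 = - 2 * v * w1" "e2 = - 2 * v * w2"
  define D1 D2 where D12: "D1 = d1 * (1 - a * b2) + (1 - a * b1) * d2" "D2 = e1 * (1 - a * b2) + 2 * d1 * d2 + (1 - a * b1) * e2"
  have "p * D1 = p * (x * L + P * y)"
  proof -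
    have pL: "p * L = 2 + p * Q" unfolding D using p_pos by (simp add: field_simps)
    show ?thesis unfolding D12 de x y using pL balance vw unfolding D(1,2) by Groebner_Basis.algebra
  qed
  then have D1: "D1 = x * L + P * y" using p_pos by simp
  have "p * D2 = p * (2 * v\<^sup>2 * L + 2 * x * y + P * (2 * w1 * w2))"
  proof -
    have pL: "p * L = 2 + p * Q" unfolding D using p_pos by (simp add: field_simps)
    show ?thesis unfolding D12 de x y using pL balance vw unfolding D(1,2) by Groebner_Basis.algebra
  qed
  then have D2: "D2 = 2 * v\<^sup>2 * L + 2 * x * y + P * (2 * w1 * w2)" using p_pos by simp
  have cross: "pair_form a b1 v w1 + pair_form a b2 v w2 = (D1 / D)\<^sup>2 - D2 / D"
  proof -
    have "(D1 / D)\<^sup>2 - D2 / D = ((d1 / (1 - a * b1))\<^sup>2 - e1 / (1 - a * b1)) + ((d2 / (1 - a * b2))\<^sup>2 - e2 / (1 - a * b2))"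
      unfolding cr(1) D12 using edge_pos by (intro log_jet_mult) auto
    also have "\<dots> = pair_form a b1 v w1 + pair_form a b2 v w2"
      unfolding pair_form_def de by (simp add: power_divide algebra_simps power2_eq_square add_divide_distrib)
    finally show ?thesis by simp
  qed
  have P: "1 / (1 - P) = 2 * p * L / D" using cr(2,8) edge_pos(5) D(1) by (simp add: field_simps)
  have Q: "p / (1 - Q) = 2 * P / D" using cr(3,8) b_neg D(2) by (simp add: field_simps)
  have "four_form 1 p a a b1 b2 v v w1 w2 = (x * (1 / (1 - P)))\<^sup>2 + 2 * v\<^sup>2 * (1 / (1 - P))
     + (y * (p / (1 - Q)))\<^sup>2 + p * (2 * w1 * w2) * (p / (1 - Q)) + 2 * p * ((D1 / D)\<^sup>2 - D2 / D)"
    unfolding four_form_def cross[symmetric] unfolding pair_form_def[of a a] pair_form_def[of b1 b2] x y D(1,2)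
    by (simp add: power_divide algebra_simps power2_eq_square add_divide_distrib)
  also have "\<dots> = 2 * (p * (2 * p + 1) * L\<^sup>2 * x\<^sup>2 + (2 + p) * P\<^sup>2 * y\<^sup>2 + 2 * p * (L * P - D) * x * y) / D\<^sup>2"
    unfolding P Q D1 D2 using cr(8) by (simp add: divide_simps power2_eq_square) (simp add: algebra_simps)
  also have "L * P - D = - 1" unfolding D(4) by simp
  finally show ?thesis by simp
qed

text \<open>Exchanging the equal weights preserves the form and negates this vector, which is
  therefore orthogonal to all symmetric variations. The factor 1 - p L decides its sign.\<close>

lemma kite_antisymmetric_form:
  assumes D: "P = a * a" "Q = b1 * b2" "L = 2 / p + Q" "D = 1 + P * L"
  shows "four_form 1 p a a b1 b2 1 (-1) 0 0 = 8 * (1 + P / p) * (1 - p * L) / D\<^sup>2"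
    and "four_trace 1 p a a b1 b2 1 (-1) 0 0 = 0"
proof -
  note cr = kite_critical_point[OF D]
  have P: "1 / (1 - P) = 2 * p * L / D" using cr(2,8) edge_pos(5) D(1) by (simp add: field_simps)
  have pL: "p * L = 2 + p * Q" unfolding D using p_pos by (simp add: field_simps)
  define S where "S = b1 + b2"
  have aS: "p * S = - 2 * a" using balance S_def by simp
  have sq: "(b1 / (1 - a * b1))\<^sup>2 + (b2 / (1 - a * b2))\<^sup>2 = ((S - 2 * a * Q)\<^sup>2 - 2 * Q * D) / D\<^sup>2"
    unfolding cr(1) S_def D(2) using edge_pos by (simp add: divide_simps power2_eq_square) (simp add: algebra_simps)
  have "four_form 1 p a a b1 b2 1 (-1) 0 0 = 2 * (p * ((b1 / (1 - a * b1))\<^sup>2 + (b2 / (1 - a * b2))\<^sup>2) - 1 / (1 - P))"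
    unfolding four_form_def pair_form_def D(1) by (simp add: algebra_simps power_divide)
  also have "\<dots> = 2 * (p * ((S - 2 * a * Q)\<^sup>2 - 2 * Q * D) - 2 * (p * L) * D) / D\<^sup>2"
    unfolding sq P using cr(8) by (simp add: divide_simps power2_eq_square)
  also have "p * ((S - 2 * a * Q)\<^sup>2 - 2 * Q * D) - 2 * (p * L) * D = 4 * (1 + P / p) * (1 - p * L)"
  proof -
    have "p * D = p + P * (p * L)" unfolding D(4) by (simp add: algebra_simps)
    then have "p * (p * ((S - 2 * a * Q)\<^sup>2 - 2 * Q * D) - 2 * (p * L) * D) = 4 * (p + P) * (1 - p * L)"
      using pL aS D(1) by Groebner_Basis.algebra
    also have "\<dots> = p * (4 * (1 + P / p) * (1 - p * L))" using p_pos by (simp add: field_simps)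
    finally show ?thesis using p_pos by simp
  qed
  finally show "four_form 1 p a a b1 b2 1 (-1) 0 0 = 8 * (1 + P / p) * (1 - p * L) / D\<^sup>2" by simp
  show "four_trace 1 p a a b1 b2 1 (-1) 0 0 = 0"
    unfolding four_trace_def pair_trace_def by simp
qed

text \<open>The form splits into a symmetric plane and an antisymmetric line. Since 0 < p L < 2, the
  determinant on the plane has the sign of p L - 1, and the line has the opposite sign. So either
  the plane is indefinite and the line positive, or the plane is positive and the line negative:
  signature (2, 1) both times.\<close>

lemma kite_directions:
  shows "\<exists>v1 v2 w1 w2. v1 + v2 = - p * (w1 + w2) \<and> four_form 1 p a a b1 b2 v1 v2 w1 w2 < 0"
    and "\<exists>v1 v2 w1 w2. v1 + v2 = - p * (w1 + w2) \<and> four_trace 1 p a a b1 b2 v1 v2 w1 w2 = 0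
       \<and> four_form 1 p a a b1 b2 v1 v2 w1 w2 > 0"
proof -
  define P Q L D where PQ: "P = a * a" "Q = b1 * b2" "L = 2 / p + Q" "D = 1 + P * L"
  note cr = kite_critical_point[OF PQ]
  have Ppos: "0 < P" using PQ a_pos by simp
  note sym = kite_symmetric_form[OF PQ _ refl refl]
  note anti = kite_antisymmetric_form[OF PQ]
  have ex: "\<exists>v w1 w2. v + v = - p * (w1 + w2) \<and> 2 * a * v = x \<and> b1 * w2 + b2 * w1 = y" for x y
  proof -
    obtain w1 w2 where "w1 + w2 = - (x / (a * p))" "b1 * w2 + b2 * w1 = y"
      using pair_coordinates[OF b_ne] by blast
    then show ?thesis using p_pos a_pos by (intro exI[of _ "x / (2 * a)"] exI[of _ w1] exI[of _ w2]) simp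
  qed
  define G where "G x y = p * (2 * p + 1) * L\<^sup>2 * x\<^sup>2 + (2 + p) * P\<^sup>2 * y\<^sup>2 - 2 * p * x * y" for x y
  have PL: "(2 * p + 1) * (2 + p) * (P * L)\<^sup>2 * (2 - p * L) = p * (2 * (p * L) - 1) * (p * L)"
  proof -
    have "(2 * p + 1) * (2 + p) * (P * L)\<^sup>2 * (2 - p * L) = ((2 * p + 1) * (P * L)) * ((2 + p) * (2 - p * L) * P) * L"
      by (simp add: algebra_simps power2_eq_square)
    also have "\<dots> = (2 * (p * L) - 1) * p\<^sup>2 * L" unfolding cr(4,5) ..
    finally show ?thesis by (simp add: algebra_simps power2_eq_square)
  qed
  have l2: "0 < 2 - p * L"
  proof -
    have "0 < (2 + p) * (2 - p * L) * P" unfolding cr(5) using p_pos by simp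
    then show ?thesis using Ppos p_pos by (simp add: zero_less_mult_iff)
  qed
  have det: "((2 * p + 1) * (2 + p) * (P * L)\<^sup>2 - p) * (2 - p * L) = 2 * p * ((p * L)\<^sup>2 - 1)"
    using PL by (simp add: algebra_simps power2_eq_square)
  have neg: "\<exists>v1 v2 w1 w2. v1 + v2 = - p * (w1 + w2) \<and> four_form 1 p a a b1 b2 v1 v2 w1 w2 < 0"
    if GG: "G x y < 0" for x y
  proof -
    obtain v w1 w2 where v: "v + v = - p * (w1 + w2)" "2 * a * v = x" "b1 * w2 + b2 * w1 = y" using ex by blast
    have "four_form 1 p a a b1 b2 v v w1 w2 = 2 * G x y / D\<^sup>2" unfolding sym[OF v(1)] G_def v(2,3) ..
    also have "\<dots> < 0" using GG cr(8) by (simp add: divide_neg_pos)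
    finally show ?thesis using v(1) by blast
  qed
  have lpos: "0 < p * L" using p_pos cr(7) by simp
  consider "p * L < 1" | "p * L > 1" using cr(6) by linarith
  then have "(\<exists>v1 v2 w1 w2. v1 + v2 = - p * (w1 + w2) \<and> four_form 1 p a a b1 b2 v1 v2 w1 w2 < 0) \<and>
    (\<exists>v1 v2 w1 w2. v1 + v2 = - p * (w1 + w2) \<and> four_trace 1 p a a b1 b2 v1 v2 w1 w2 = 0
       \<and> four_form 1 p a a b1 b2 v1 v2 w1 w2 > 0)"
  proof cases
    case 1
    have "(p * L)\<^sup>2 < 1" using 1 lpos by (simp add: power_less_one_iff)
    then have "((2 * p + 1) * (2 + p) * (P * L)\<^sup>2 - p) * (2 - p * L) < 0" unfolding det using p_pos by (simp add: mult_pos_neg)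
    then have d: "(2 * p + 1) * (2 + p) * (P * L)\<^sup>2 - p < 0" using l2 by (simp add: mult_less_0_iff)
    \<comment> \<open>For this first argument, the second argument \<open>p\<close> is the minimizer
      of \<open>G\<close>, so the determinant appears.\<close>
    have "G ((2 + p) * P\<^sup>2) p = p * (2 + p) * P\<^sup>2 * ((2 * p + 1) * (2 + p) * (P * L)\<^sup>2 - p)"
      unfolding G_def by (simp add: algebra_simps power2_eq_square)
    also have "\<dots> < 0" using d p_pos Ppos by (intro mult_pos_neg mult_pos_pos) auto
    finally have Gneg: "G ((2 + p) * P\<^sup>2) p < 0" .
    have "four_form 1 p a a b1 b2 1 (-1) 0 0 > 0"
      unfolding anti(1) using 1 p_pos cr(8) Ppos by (intro divide_pos_pos mult_pos_pos add_pos_pos) auto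
    then have "\<exists>v1 v2 w1 w2. v1 + v2 = - p * (w1 + w2) \<and> four_trace 1 p a a b1 b2 v1 v2 w1 w2 = 0
       \<and> four_form 1 p a a b1 b2 v1 v2 w1 w2 > 0"
      using anti(2) by - (rule exI[of _ 1], rule exI[of _ "-1"], rule exI[of _ 0], rule exI[of _ 0], simp)
    then show ?thesis using neg[OF Gneg] by (intro conjI)
  next
    case 2
    have "four_form 1 p a a b1 b2 1 (-1) 0 0 < 0"
      unfolding anti(1) using 2 p_pos cr(8) Ppos
      by (intro divide_neg_pos mult_pos_neg mult_pos_pos add_pos_pos) auto
    then have n: "\<exists>v1 v2 w1 w2. v1 + v2 = - p * (w1 + w2) \<and> four_form 1 p a a b1 b2 v1 v2 w1 w2 < 0"
      by - (rule exI[of _ 1], rule exI[of _ "-1"], rule exI[of _ 0], rule exI[of _ 0], simp)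
    have "(p * L)\<^sup>2 > 1" using 2 by (simp add: one_less_power)
    then have "((2 * p + 1) * (2 + p) * (P * L)\<^sup>2 - p) * (2 - p * L) > 0" unfolding det using p_pos by simp
    then have d: "(2 * p + 1) * (2 + p) * (P * L)\<^sup>2 - p > 0" using l2 by (simp add: zero_less_mult_iff)
    \<comment> \<open>The vector (x, y) is \<open>G\<close>-orthogonal to (P, Q), hence annihilates
      \<open>four_trace\<close>. It is nonzero because \<open>Q < 0\<close>.\<close>
    define x where "x = (2 + p) * P\<^sup>2 * Q - p * P"
    define y where "y = - (p * (2 * p + 1) * L\<^sup>2 * P - p * Q)"
    have Gpos: "G x' y' > 0" if "x' \<noteq> 0 \<or> y' \<noteq> 0" for x' y'
    proof -
      have e: "(2 + p) * P\<^sup>2 * G x' y' = p * x'\<^sup>2 * ((2 * p + 1) * (2 + p) * (P * L)\<^sup>2 - p) + ((2 + p) * P\<^sup>2 * y' - p * x')\<^sup>2"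
        unfolding G_def by (simp add: algebra_simps power2_eq_square)
      have "(2 + p) * P\<^sup>2 * G x' y' > 0"
      proof (cases "x' = 0")
        case True then show ?thesis unfolding e using that p_pos Ppos by simp
      next
        case False
        then show ?thesis unfolding e using d p_pos by (intro add_pos_nonneg mult_pos_pos) auto
      qed
      moreover have "0 < (2 + p) * P\<^sup>2" using p_pos Ppos by simp
      ultimately show ?thesis by (rule zero_less_mult_pos)
    qed
    obtain v w1 w2 where v: "v + v = - p * (w1 + w2)" "2 * a * v = x" "b1 * w2 + b2 * w1 = y" using ex by blast
    have ab': "2 * a * a = 2 * P" "b1 * b2 + b2 * b1 = 2 * Q" unfolding PQ by auto
    have vv: "(v + 1 * a) + (v + 1 * a) = - p * ((w1 + 1 * b1) + (w2 + 1 * b2))" using v(1) balance by (simp add: algebra_simps)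
    have xy': "2 * a * (v + 1 * a) = x + 2 * P" "b1 * (w2 + 1 * b2) + b2 * (w1 + 1 * b1) = y + 2 * Q"
      using v(2,3) unfolding PQ by (auto simp: algebra_simps)
    have xy: "p * (2 * p + 1) * L\<^sup>2 * P * x + (2 + p) * P\<^sup>2 * Q * y - p * (x * Q + P * y) = 0"
      unfolding x_def y_def by (simp add: algebra_simps power2_eq_square)
    have xy0: "x \<noteq> 0 \<or> y \<noteq> 0"
    proof -
      have "0 < p * P" "Q < 0" "0 < (2 + p) * P\<^sup>2" using p_pos b_neg Ppos PQ(2) by auto
      then have "x < 0" unfolding x_def using mult_pos_neg[of "(2 + p) * P\<^sup>2" Q] by linarith
      then show ?thesis by simp
    qed
    have f0: "four_form 1 p a a b1 b2 v v w1 w2 = 2 * G x y / D\<^sup>2" unfolding sym[OF v(1)] G_def v(2,3) ..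
    have f1: "four_form 1 p a a b1 b2 (v + 1 * a) (v + 1 * a) (w1 + 1 * b1) (w2 + 1 * b2) = 2 * G (x + 2 * P) (y + 2 * Q) / D\<^sup>2"
      unfolding sym[OF vv] G_def xy' ..
    have f2: "four_form 1 p a a b1 b2 a a b1 b2 = 2 * G (2 * P) (2 * Q) / D\<^sup>2"
      unfolding sym[OF balance] G_def ab' ..
    have "4 * four_trace 1 p a a b1 b2 v v w1 w2 = 2 * (G (x + 2 * P) (y + 2 * Q) - G x y - G (2 * P) (2 * Q)) / D\<^sup>2"
      using four_form_add_scaled[OF v(1), of 1] unfolding f0 f1 f2 by (simp add: diff_divide_distrib)
    also have "G (x + 2 * P) (y + 2 * Q) - G x y - G (2 * P) (2 * Q) =
       4 * (p * (2 * p + 1) * L\<^sup>2 * P * x + (2 + p) * P\<^sup>2 * Q * y - p * (x * Q + P * y))"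
      unfolding G_def by (simp add: algebra_simps power2_eq_square)
    finally have "four_trace 1 p a a b1 b2 v v w1 w2 = 0" unfolding xy by simp
    moreover have "four_form 1 p a a b1 b2 v v w1 w2 > 0" unfolding f0 using Gpos[OF xy0] cr(8) by simp
    ultimately show ?thesis using n v(1) by blast
  qed
  then show "\<exists>v1 v2 w1 w2. v1 + v2 = - p * (w1 + w2) \<and> four_form 1 p a a b1 b2 v1 v2 w1 w2 < 0"
    and "\<exists>v1 v2 w1 w2. v1 + v2 = - p * (w1 + w2) \<and> four_trace 1 p a a b1 b2 v1 v2 w1 w2 = 0
       \<and> four_form 1 p a a b1 b2 v1 v2 w1 w2 > 0" by auto
qed

end

text \<open>Homogeneity reduces the claim to circulations 1 and p = \<nu> / \<mu> with multiplier
  \<kappa> / \<mu>; then the two kinds of critical points are treated separately.\<close>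

lemma saddle_directions:
  fixes \<mu> \<nu> :: real
  assumes "0 < \<mu>" "0 < \<nu>" "\<mu> \<noteq> \<nu>" "0 < a1" "0 < a2" "b1 * b2 < 0" and ab: "\<mu> * (a1 + a2) + \<nu> * (b1 + b2) = 0"
    and u: "1 - a1 * b1 > 0" "1 - a1 * b2 > 0" "1 - a2 * b1 > 0" "1 - a2 * b2 > 0"
      "1 - a1 * a2 > 0"
    and g: "\<mu> * a2 / (1 - a1 * a2) + \<nu> * b1 / (1 - a1 * b1) + \<nu> * b2 / (1 - a1 * b2) = \<kappa>"
      "\<mu> * a1 / (1 - a1 * a2) + \<nu> * b1 / (1 - a2 * b1) + \<nu> * b2 / (1 - a2 * b2) = \<kappa>"
      "\<mu> * a1 / (1 - a1 * b1) + \<mu> * a2 / (1 - a2 * b1) + \<nu> * b2 / (1 - b1 * b2) = \<kappa>"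
      "\<mu> * a1 / (1 - a1 * b2) + \<mu> * a2 / (1 - a2 * b2) + \<nu> * b1 / (1 - b1 * b2) = \<kappa>"
  shows "\<exists>v1 v2 w1 w2. \<mu> * (v1 + v2) + \<nu> * (w1 + w2) = 0 \<and> four_form \<mu> \<nu> a1 a2 b1 b2 v1 v2 w1 w2 < 0"
    and "\<exists>v1 v2 w1 w2. \<mu> * (v1 + v2) + \<nu> * (w1 + w2) = 0 \<and> four_trace \<mu> \<nu> a1 a2 b1 b2 v1 v2 w1 w2 = 0
       \<and> four_form \<mu> \<nu> a1 a2 b1 b2 v1 v2 w1 w2 > 0"
proof -
  define p where "p = \<nu> / \<mu>"
  have p: "0 < p" "p \<noteq> 1" and nu: "\<nu> = \<mu> * p" using assms(1-3) by (auto simp: p_def)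
  have scale: "\<mu> * x / d + \<mu> * p * y / e + \<mu> * p * z / f = \<kappa> \<longleftrightarrow> x / d + p * y / e + p * z / f = \<kappa> / \<mu>"
    "\<mu> * x / d + \<mu> * y / e + \<mu> * p * z / f = \<kappa> \<longleftrightarrow> x / d + y / e + p * z / f = \<kappa> / \<mu>" for x y z d e f
  proof -
    have "\<mu> * x / d + \<mu> * p * y / e + \<mu> * p * z / f = \<mu> * (x / d + p * y / e + p * z / f)"
      "\<mu> * x / d + \<mu> * y / e + \<mu> * p * z / f = \<mu> * (x / d + y / e + p * z / f)" by (simp_all add: algebra_simps)
    then show "\<mu> * x / d + \<mu> * p * y / e + \<mu> * p * z / f = \<kappa> \<longleftrightarrow> x / d + p * y / e + p * z / f = \<kappa> / \<mu>"
      "\<mu> * x / d + \<mu> * y / e + \<mu> * p * z / f = \<kappa> \<longleftrightarrow> x / d + y / e + p * z / f = \<kappa> / \<mu>"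
      using assms(1) by (auto simp: nonzero_eq_divide_eq mult.commute)
  qed
  have hyp: "\<mu> * (v1 + v2) + \<nu> * (w1 + w2) = 0 \<longleftrightarrow> v1 + v2 = - p * (w1 + w2)" for v1 v2 w1 w2
  proof -
    have "\<mu> * (v1 + v2) + \<nu> * (w1 + w2) = \<mu> * ((v1 + v2) + p * (w1 + w2))" unfolding nu by (simp add: algebra_simps)
    then show ?thesis using assms(1) by (auto simp: add_eq_0_iff)
  qed
  have ff: "four_form \<mu> \<nu> a1 a2 b1 b2 v1 v2 w1 w2 = \<mu>\<^sup>2 * four_form 1 p a1 a2 b1 b2 v1 v2 w1 w2"
    "four_trace \<mu> \<nu> a1 a2 b1 b2 v1 v2 w1 w2 = \<mu>\<^sup>2 * four_trace 1 p a1 a2 b1 b2 v1 v2 w1 w2" for v1 v2 w1 w2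
    unfolding four_form_def four_trace_def nu by (simp_all add: algebra_simps power2_eq_square)
  have signs: "\<mu>\<^sup>2 * x < 0 \<longleftrightarrow> x < 0" "0 < \<mu>\<^sup>2 * x \<longleftrightarrow> 0 < x" "\<mu>\<^sup>2 * x = 0 \<longleftrightarrow> x = 0" for x
    using assms(1) by (auto simp: mult_less_0_iff zero_less_mult_iff)
  note g' = g[unfolded nu scale] and ab' = ab[unfolded hyp]
  have "(\<exists>v1 v2 w1 w2. v1 + v2 = - p * (w1 + w2) \<and> four_form 1 p a1 a2 b1 b2 v1 v2 w1 w2 < 0) \<and>
    (\<exists>v1 v2 w1 w2. v1 + v2 = - p * (w1 + w2) \<and> four_trace 1 p a1 a2 b1 b2 v1 v2 w1 w2 = 0
       \<and> four_form 1 p a1 a2 b1 b2 v1 v2 w1 w2 > 0)"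
  proof -
    interpret critical_weights p a1 a2 b1 b2 "\<kappa> / \<mu>"
      using p(1) assms(4-6) ab' u g' by unfold_locales
    show ?thesis
    proof (cases "a1 = a2")
      case True
      then interpret critical_kite p a1 b1 b2 "\<kappa> / \<mu>"
        using p(2) critical_weights_axioms by (intro critical_kite.intro critical_kite_axioms.intro) simp_all
      show ?thesis using kite_directions unfolding True[symmetric] by blast
    next
      case False
      then show ?thesis using asymmetric_directions by blast
    qed
  qed
  then show "\<exists>v1 v2 w1 w2. \<mu> * (v1 + v2) + \<nu> * (w1 + w2) = 0 \<and> four_form \<mu> \<nu> a1 a2 b1 b2 v1 v2 w1 w2 < 0"
    and "\<exists>v1 v2 w1 w2. \<mu> * (v1 + v2) + \<nu> * (w1 + w2) = 0 \<and> four_trace \<mu> \<nu> a1 a2 b1 b2 v1 v2 w1 w2 = 0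
       \<and> four_form \<mu> \<nu> a1 a2 b1 b2 v1 v2 w1 w2 > 0"
    unfolding hyp ff signs by auto
qed

section \<open>The index of the second variation\<close>

lemma sum_lessThan_4: "(\<Sum>i<4. f i) = f 0 + f 1 + f 2 + f (3::nat)" for f :: "nat \<Rightarrow> 'a::comm_monoid_add"
  by (simp add: numeral_eq_Suc)

lemma double_sum_diff:
  fixes c d :: "'i \<Rightarrow> complex"
  shows "(\<Sum>i\<in>I. \<Sum>j\<in>I. c i * d j * ((f i - f j) * cnj (g i - g j))) =
    sum d I * (\<Sum>i\<in>I. c i * f i * cnj (g i)) + sum c I * (\<Sum>i\<in>I. d i * f i * cnj (g i))
    - (\<Sum>i\<in>I. c i * f i) * (\<Sum>i\<in>I. d i * cnj (g i)) - (\<Sum>i\<in>I. d i * f i) * (\<Sum>i\<in>I. c i * cnj (g i))"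
proof -
  have "(\<Sum>i\<in>I. \<Sum>j\<in>I. c i * d j * ((f i - f j) * cnj (g i - g j))) =
    (\<Sum>i\<in>I. \<Sum>j\<in>I. (c i * f i * cnj (g i)) * d j + c i * (d j * f j * cnj (g j))
      - (c i * f i) * (d j * cnj (g j)) - (c i * cnj (g i)) * (d j * f j))"
    by (intro sum.cong refl) (simp add: algebra_simps)
  then show ?thesis
    by (simp add: sum.distrib sum_subtractf flip: sum_distrib_left sum_distrib_right)
qed

lemma exists_dot_products:
  fixes u0 u1 :: complex
  assumes "Im (u0 * cnj u1) \<noteq> 0"
  shows "\<exists>f. Re (f * cnj u0) = s \<and> Re (f * cnj u1) = t"
proof -
  define \<delta> where "\<delta> = Re u0 * Im u1 - Im u0 * Re u1"
  have d: "\<delta> \<noteq> 0" using assms by (simp add: \<delta>_def)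
  have "Re (Complex ((s * Im u1 - t * Im u0) / \<delta>) ((Re u0 * t - Re u1 * s) / \<delta>) * cnj u0) = s"
    "Re (Complex ((s * Im u1 - t * Im u0) / \<delta>) ((Re u0 * t - Re u1 * s) / \<delta>) * cnj u1) = t"
    using d by (simp_all add: divide_simps) (simp_all add: \<delta>_def algebra_simps)
  then show ?thesis by blast
qed

text \<open>A framework on four points in the plane has a single self-stress, given by the products of the
  barycentric weights; it is the only obstruction to prescribing the rates of change of the distances.\<close>

lemma realize_edge_rates:
  fixes z :: "nat \<Rightarrow> complex" and A :: "nat \<Rightarrow> real" and g :: "nat \<Rightarrow> nat \<Rightarrow> real"
  assumes A: "A 0 + A 1 + A 2 + A 3 = 0" "A 0 * z 0 + A 1 * z 1 + A 2 * z 2 + A 3 * z 3 = 0"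
    and "A 2 \<noteq> 0" and indep: "Im ((z 0 - z 3) * cnj (z 1 - z 3)) \<noteq> 0"
    and sym: "\<And>i j. g i j = g j i"
    and stress: "A 0 * A 1 * g 0 1 + A 0 * A 2 * g 0 2 + A 0 * A 3 * g 0 3
      + A 1 * A 2 * g 1 2 + A 1 * A 3 * g 1 3 + A 2 * A 3 * g 2 3 = 0"
  shows "\<exists>f :: nat \<Rightarrow> complex. \<forall>i<4. \<forall>j<4. i \<noteq> j \<longrightarrow> Re ((f i - f j) * cnj (z i - z j)) = g i j"
proof -
  define u0 u1 u2 where u: "u0 = z 0 - z 3" "u1 = z 1 - z 3" "u2 = z 2 - z 3"
  have Au: "A 0 * u0 + A 1 * u1 + A 2 * u2 = 0"
  proof -
    have "A 0 * u0 + A 1 * u1 + A 2 * u2 = (A 0 * z 0 + A 1 * z 1 + A 2 * z 2 + A 3 * z 3)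
       - of_real (A 0 + A 1 + A 2 + A 3) * z 3" unfolding u by (simp add: algebra_simps)
    then show ?thesis unfolding A by simp
  qed
  have "u0 \<noteq> 0" using indep u by auto
  \<comment> \<open>Point 3 is held fixed and point 0 moves along \<open>u0\<close>, which uses up
    the rigid motions. Then \<open>f1\<close> and \<open>f2\<close> are fixed by two dot products
    each, and only the edge from 2 to 3 is left.\<close>
  define f0 where "f0 = of_real (g 0 3) / cnj u0"
  have f0: "Re (f0 * cnj u0) = g 0 3" using \<open>u0 \<noteq> 0\<close> by (simp add: f0_def)
  obtain f1 where f1: "Re (f1 * cnj u0) = g 0 3 + g 1 3 - g 0 1 - Re (f0 * cnj u1)" "Re (f1 * cnj u1) = g 1 3"
    using exists_dot_products[of u0 u1] indep u by metis
  obtain f2 where f2: "Re (f2 * cnj u0) = g 0 3 + g 2 3 - g 0 2 - Re (f0 * cnj u2)"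
     "Re (f2 * cnj u1) = g 1 3 + g 2 3 - g 1 2 - Re (f1 * cnj u2)"
    using exists_dot_products[of u0 u1] indep u by metis
  have z: "Re (f0 * (A 0 * cnj u0 + A 1 * cnj u1 + A 2 * cnj u2)) = 0"
    "Re (f1 * (A 0 * cnj u0 + A 1 * cnj u1 + A 2 * cnj u2)) = 0"
    "Re (f2 * (A 0 * cnj u0 + A 1 * cnj u1 + A 2 * cnj u2)) = 0"
    using arg_cong[OF Au, of cnj] by simp_all
  have z': "A 0 * Re (f0 * cnj u0) + A 1 * Re (f0 * cnj u1) + A 2 * Re (f0 * cnj u2) = 0"
    "A 0 * Re (f1 * cnj u0) + A 1 * Re (f1 * cnj u1) + A 2 * Re (f1 * cnj u2) = 0"
    "A 0 * Re (f2 * cnj u0) + A 1 * Re (f2 * cnj u1) + A 2 * Re (f2 * cnj u2) = 0"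
    using z by (simp_all add: algebra_simps)
  define X where "X = Re (f2 * cnj u2)"
  define x01 x02 x12 where "x01 = Re (f0 * cnj u1)" "x02 = Re (f0 * cnj u2)" "x12 = Re (f1 * cnj u2)"
  note xs = this
  \<comment> \<open>The last edge rate is not free any more; the stress condition says exactly that
    it has the prescribed value.\<close>
  have "A 2 * (A 2 * (X - g 2 3)) = 0"
  proof -
    have e0: "A 1 * x01 = - (A 0 * g 0 3) - A 2 * x02" using z'(1) unfolding f0 xs by simp
    have e1: "A 2 * x12 = - A 0 * (g 0 3 + g 1 3 - g 0 1 - x01) - A 1 * g 1 3" using z'(2) unfolding f1 xs by simp
    have e2: "A 2 * X = - A 0 * (g 0 3 + g 2 3 - g 0 2 - x02) - A 1 * (g 1 3 + g 2 3 - g 1 2 - x12)"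
      using z'(3) unfolding f2 xs X_def by simp
    have A3: "A 3 = - A 0 - A 1 - A 2" using A(1) by simp
    show ?thesis using e0 e1 e2 stress unfolding A3 by Groebner_Basis.algebra
  qed
  then have f22: "Re (f2 * cnj u2) = g 2 3" using assms(3) X_def by simp
  define f where "f i = (if i = 0 then f0 else if i = 1 then f1 else if i = 2 then f2 else 0)" for i :: nat
  have fs: "f 0 = f0" "f 1 = f1" "f 2 = f2" "f 3 = 0" by (simp_all add: f_def)
  have split: "Re ((a - b) * cnj (c - d)) = Re (a * cnj c) + Re (b * cnj d) - Re (b * cnj c) - Re (a * cnj d)"
    for a b c d by (simp add: algebra_simps)
  have uz: "z 0 - z 1 = u0 - u1" "z 0 - z 2 = u0 - u2" "z 0 - z 3 = u0 - 0" "z 1 - z 2 = u1 - u2" "z 1 - z 3 = u1 - 0" "z 2 - z 3 = u2 - 0"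
    unfolding u by simp_all
  have zero: "Re (0 * x) = 0" "Re (x * cnj 0) = 0" for x by simp_all
  have pairs: "Re ((f 0 - f 1) * cnj (z 0 - z 1)) = g 0 1" "Re ((f 0 - f 2) * cnj (z 0 - z 2)) = g 0 2"
    "Re ((f 0 - f 3) * cnj (z 0 - z 3)) = g 0 3" "Re ((f 1 - f 2) * cnj (z 1 - z 2)) = g 1 2"
    "Re ((f 1 - f 3) * cnj (z 1 - z 3)) = g 1 3" "Re ((f 2 - f 3) * cnj (z 2 - z 3)) = g 2 3"
    unfolding fs uz split zero using f0 f1 f2 f22 by linarith+
  have pair: "Re ((f i - f j) * cnj (z i - z j)) = g i j" if "i < j" "j < 4" for i j
  proof -
    have "i = 0 \<or> i = 1 \<or> i = 2" "j = 1 \<or> j = 2 \<or> j = 3" using that by arith+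
    then show ?thesis using pairs that by (elim disjE) (simp_all only: less_irrefl numeral_less_iff)
  qed
  have "Re ((f i - f j) * cnj (z i - z j)) = g i j" if "i < 4" "j < 4" "i \<noteq> j" for i j
  proof (cases "i < j")
    case True then show ?thesis using pair that by simp
  next
    case False
    then have "Re ((f j - f i) * cnj (z j - z i)) = g j i" using pair that by simp
    then show ?thesis unfolding sym[of i j] by (simp add: algebra_simps)
  qed
  then show ?thesis by blast
qed

text \<open>\<open>k\<close> stands for the angular velocity divided by the total circulation.
  \<open>distance\<close> is the equilibrium condition in product form, and
  \<open>affine_relation\<close> says that the points affinely span the plane, so the relation given
  by the weights is unique up to scale.\<close>

locale balanced_configuration =
  fixes \<Gamma> a :: "nat \<Rightarrow> real" and z :: "nat \<Rightarrow> complex" and k :: real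
  assumes \<Gamma>_pos: "\<And>i. i < 4 \<Longrightarrow> 0 < \<Gamma> i" and k_pos: "0 < k"
    and sum_a: "(\<Sum>i<4. \<Gamma> i * a i) = 0" and sum_az: "(\<Sum>i<4. of_real (\<Gamma> i * a i) * z i) = 0"
    and a_nz: "\<And>i. i < 4 \<Longrightarrow> a i \<noteq> 0"
    and affine_relation: "\<And>c :: nat \<Rightarrow> real. (\<Sum>i<4. c i) = 0 \<Longrightarrow> (\<Sum>i<4. of_real (c i) * z i) = 0 \<Longrightarrow>
      \<exists>t. \<forall>i<4. c i = t * (\<Gamma> i * a i)"
    and distance: "\<And>i j. i < 4 \<Longrightarrow> j < 4 \<Longrightarrow> i \<noteq> j \<Longrightarrow> k * (cmod (z i - z j))\<^sup>2 * (1 - a i * a j) = 1"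
begin

text \<open>Collinear points 0, 1, 3 would carry an affine relation vanishing at point 2, whereas
  the relation of the weights has no zero entry.\<close>

lemma noncollinear: "Im ((z 0 - z 3) * cnj (z 1 - z 3)) \<noteq> 0"
proof
  assume im: "Im ((z 0 - z 3) * cnj (z 1 - z 3)) = 0"
  define u0 u1 where u: "u0 = z 0 - z 3" "u1 = z 1 - z 3"
  have "u0 \<noteq> 0" using distance[of 0 3] u by auto
  obtain r where r: "u1 = of_real r * u0"
  proof
    have h: "of_real (Re (u1 * cnj u0)) = u1 * cnj u0" using im unfolding u by (simp add: complex_eq_iff algebra_simps)
    show "u1 = of_real (Re (u1 * cnj u0) / (cmod u0)\<^sup>2) * u0"
      unfolding of_real_divide complex_norm_square h using \<open>u0 \<noteq> 0\<close> by simp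
  qed
  define c where "c i = (if i = 0 then r else if i = 1 then - 1 else if i = 3 then 1 - r else 0)" for i :: nat
  have "(\<Sum>i<4. c i) = 0" "(\<Sum>i<4. of_real (c i) * z i) = 0"
    using r unfolding sum_lessThan_4 u by (simp_all add: c_def algebra_simps)
  then obtain t where t: "\<forall>i<4. c i = t * (\<Gamma> i * a i)" using affine_relation by blast
  have "t = 0" using t[rule_format, of 2] a_nz[of 2] \<Gamma>_pos[of 2] by (simp add: c_def)
  then show False using t[rule_format, of 1] by (simp add: c_def)
qed

lemma distinct_points: "i < 4 \<Longrightarrow> j < 4 \<Longrightarrow> z i = z j \<longleftrightarrow> i = j"
  using distance[of i j] by (cases "i = j") auto

text \<open>Diagonal terms of the sums below vanish: \<open>(f i - f i) / (z i - z i) = 0 / 0 = 0\<close>.\<close>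

definition rate :: "(nat \<Rightarrow> complex) \<Rightarrow> nat \<Rightarrow> nat \<Rightarrow> real" where
  "rate f i j = Re ((f i - f j) / (z i - z j))"

definition rate_form :: "(nat \<Rightarrow> complex) \<Rightarrow> real" where
  "rate_form f = (\<Sum>i<4. \<Sum>j<4. \<Gamma> i * \<Gamma> j * (rate f i j)\<^sup>2)"

definition load :: "(nat \<Rightarrow> complex) \<Rightarrow> complex" where
  "load f = (\<Sum>i<4. of_real (\<Gamma> i * a i) * f i)"

definition moment :: "(nat \<Rightarrow> real) \<Rightarrow> complex" where
  "moment v = (\<Sum>i<4. of_real (\<Gamma> i * v i) * z i)"

text \<open>The derivative of ln (r_ij^2) along the variation \<open>v\<close> of the weights when
  the distances are governed by \<open>distance\<close>.\<close>

definition tension :: "(nat \<Rightarrow> real) \<Rightarrow> nat \<Rightarrow> nat \<Rightarrow> real" where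
  "tension v i j = k * (cmod (z i - z j))\<^sup>2 * (a j * v i + a i * v j)"

definition tension_form :: "(nat \<Rightarrow> real) \<Rightarrow> real" where
  "tension_form v = (\<Sum>i<4. \<Sum>j<4. \<Gamma> i * \<Gamma> j * (tension v i j)\<^sup>2)"

text \<open>For w = (f_i - f_j) / (z_i - z_j), use Re (w^2) = 2 (Re w)^2 - |w|^2. By
  \<open>distance\<close>, |w|^2 is k (1 - a_i a_j) |f_i - f_j|^2, so the plain k-terms cancel, and
  the rest collapses to the load because the weights have total zero.\<close>

lemma second_variation:
  "(\<Sum>i<4. \<Sum>j<4. \<Gamma> i * \<Gamma> j * (Re (((f i - f j) / (z i - z j))\<^sup>2) + k * (cmod (f i - f j))\<^sup>2))
    = 2 * rate_form f - 2 * k * (cmod (load f))\<^sup>2"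
proof -
  have pt: "\<Gamma> i * \<Gamma> j * (Re (((f i - f j) / (z i - z j))\<^sup>2) + k * (cmod (f i - f j))\<^sup>2)
    = 2 * (\<Gamma> i * \<Gamma> j * (rate f i j)\<^sup>2) + k * ((\<Gamma> i * a i) * (\<Gamma> j * a j) * (cmod (f i - f j))\<^sup>2)"
    if "i < 4" "j < 4" for i j
  proof (cases "i = j")
    case True then show ?thesis by (simp add: rate_def)
  next
    case False
    have ne: "(cmod (z i - z j))\<^sup>2 \<noteq> 0" using distinct_points that False by simp
    have "inverse ((cmod (z i - z j))\<^sup>2) = k * (1 - a i * a j)"
      using distance[OF that False] ne by (simp add: field_simps)
    moreover have "(cmod (x / y))\<^sup>2 = inverse ((cmod y)\<^sup>2) * (cmod x)\<^sup>2" for x y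
      by (simp add: norm_divide power_divide field_simps)
    ultimately have "(cmod ((f i - f j) / (z i - z j)))\<^sup>2 = k * (1 - a i * a j) * (cmod (f i - f j))\<^sup>2"
      by metis
    moreover have "Re (w\<^sup>2) = 2 * (Re w)\<^sup>2 - (cmod w)\<^sup>2" for w
      by (simp add: cmod_def power2_eq_square)
    ultimately have R: "Re (((f i - f j) / (z i - z j))\<^sup>2) = 2 * (rate f i j)\<^sup>2 - k * (1 - a i * a j) * (cmod (f i - f j))\<^sup>2"
      unfolding rate_def by metis
    show ?thesis unfolding R by (simp add: algebra_simps)
  qed
  have "(\<Sum>i<4. \<Sum>j<4. of_real (\<Gamma> i * a i) * of_real (\<Gamma> j * a j) * ((f i - f j) * cnj (f i - f j)))
     = - 2 * (load f * cnj (load f))"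
    unfolding double_sum_diff using sum_a unfolding load_def by (simp flip: of_real_mult of_real_sum)
  then have "complex_of_real (\<Sum>i<4. \<Sum>j<4. (\<Gamma> i * a i) * (\<Gamma> j * a j) * (cmod (f i - f j))\<^sup>2) = of_real (- 2 * (cmod (load f))\<^sup>2)"
    unfolding complex_norm_square[symmetric] by simp
  then have "(\<Sum>i<4. \<Sum>j<4. (\<Gamma> i * a i) * (\<Gamma> j * a j) * (cmod (f i - f j))\<^sup>2) = - 2 * (cmod (load f))\<^sup>2"
    unfolding of_real_eq_iff .
  moreover have "(\<Sum>i<4. \<Sum>j<4. \<Gamma> i * \<Gamma> j * (Re (((f i - f j) / (z i - z j))\<^sup>2) + k * (cmod (f i - f j))\<^sup>2))
     = (\<Sum>i<4. \<Sum>j<4. 2 * (\<Gamma> i * \<Gamma> j * (rate f i j)\<^sup>2) + k * ((\<Gamma> i * a i) * (\<Gamma> j * a j) * (cmod (f i - f j))\<^sup>2))"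
    by (intro sum.cong refl pt) auto
  ultimately show ?thesis
    unfolding rate_form_def by (simp add: sum.distrib flip: sum_distrib_left)
qed

text \<open>The factor r_ij^2 of the tension clears the denominator of the rate. The remaining
  double sums factor, and the vanishing totals and the vanishing moment of the weights leave one
  product.\<close>

lemma virtual_work:
  assumes "(\<Sum>i<4. \<Gamma> i * v i) = 0"
  shows "(\<Sum>i<4. \<Sum>j<4. \<Gamma> i * \<Gamma> j * (tension v i j * rate f i j)) = - 2 * k * Re (load f * cnj (moment v))"
proof -
  have pt: "\<Gamma> i * \<Gamma> j * (tension v i j * rate f i j) = k * Re (of_real (\<Gamma> i * v i) * of_real (\<Gamma> j * a j) * ((f i - f j) * cnj (z i - z j)))
     + k * Re (of_real (\<Gamma> i * a i) * of_real (\<Gamma> j * v j) * ((f i - f j) * cnj (z i - z j)))"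
    if "i < 4" "j < 4" for i j
  proof (cases "i = j")
    case True then show ?thesis by (simp add: rate_def)
  next
    case False
    have ne: "z i - z j \<noteq> 0" using distinct_points that False by simp
    have "(f i - f j) * cnj (z i - z j) = of_real ((cmod (z i - z j))\<^sup>2) * ((f i - f j) / (z i - z j))"
      unfolding complex_norm_square using ne by (simp del: complex_cnj_diff)
    then have "Re ((f i - f j) * cnj (z i - z j)) = (cmod (z i - z j))\<^sup>2 * rate f i j"
      unfolding rate_def Re_complex_of_real[symmetric] by (metis Re_complex_of_real scaleR_conv_of_real scaleR_complex.simps(1))
    moreover have "Re (of_real c * of_real d * x) = c * d * Re x" for c d x by simp
    ultimately show ?thesis unfolding tension_def by (simp only:) (simp add: algebra_simps)
  qed
  have s0: "(\<Sum>i<4. complex_of_real (\<Gamma> i * v i)) = 0" "(\<Sum>i<4. complex_of_real (\<Gamma> i * a i)) = 0"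
    using assms sum_a by (simp_all flip: of_real_mult of_real_sum)
  have s1: "(\<Sum>i<4. complex_of_real (\<Gamma> i * a i) * cnj (z i)) = 0"
    using arg_cong[OF sum_az, of cnj] by simp
  have m: "cnj (moment v) = (\<Sum>i<4. complex_of_real (\<Gamma> i * v i) * cnj (z i))" by (simp add: moment_def)
  have l: "load f = (\<Sum>i<4. complex_of_real (\<Gamma> i * a i) * f i)" by (simp add: load_def)
  have "(\<Sum>i<4. \<Sum>j<4. \<Gamma> i * \<Gamma> j * (tension v i j * rate f i j)) =
    k * Re (\<Sum>i<4. \<Sum>j<4. of_real (\<Gamma> i * v i) * of_real (\<Gamma> j * a j) * ((f i - f j) * cnj (z i - z j)))
    + k * Re (\<Sum>i<4. \<Sum>j<4. of_real (\<Gamma> i * a i) * of_real (\<Gamma> j * v j) * ((f i - f j) * cnj (z i - z j)))"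
    unfolding Re_sum sum_distrib_left sum.distrib[symmetric] by (intro sum.cong refl pt) auto
  also have "\<dots> = - 2 * k * Re (load f * cnj (moment v))"
    unfolding double_sum_diff s0 s1 m[symmetric] l[symmetric] by (simp add: algebra_simps)
  finally show ?thesis .
qed

lemma moment_norm:
  assumes "(\<Sum>i<4. \<Gamma> i * v i) = 0"
  shows "(\<Sum>i<4. \<Sum>j<4. \<Gamma> i * \<Gamma> j * ((cmod (z i - z j))\<^sup>2 * v i * v j)) = - 2 * (cmod (moment v))\<^sup>2"
proof -
  have s0: "(\<Sum>i<4. complex_of_real (\<Gamma> i * v i)) = 0" using assms by (simp flip: of_real_mult of_real_sum)
  have m: "moment v = (\<Sum>i<4. of_real (\<Gamma> i * v i) * z i)" "cnj (moment v) = (\<Sum>i<4. complex_of_real (\<Gamma> i * v i) * cnj (z i))"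
    by (simp_all add: moment_def)
  have "(\<Sum>i<4. \<Sum>j<4. of_real (\<Gamma> i * v i) * of_real (\<Gamma> j * v j) * ((z i - z j) * cnj (z i - z j)))
     = - 2 * (moment v * cnj (moment v))"
    unfolding double_sum_diff s0 m[symmetric] by simp
  then have "complex_of_real (\<Sum>i<4. \<Sum>j<4. (\<Gamma> i * v i) * (\<Gamma> j * v j) * (cmod (z i - z j))\<^sup>2) = of_real (- 2 * (cmod (moment v))\<^sup>2)"
    unfolding complex_norm_square[symmetric] by simp
  then show ?thesis unfolding of_real_eq_iff by (simp add: algebra_simps)
qed

lemma tension_sym: "tension v i j = tension v j i"
  by (simp add: tension_def norm_minus_commute add.commute)

text \<open>Tensions resolve the load \<open>\<Gamma>\<^sub>i a\<^sub>i moment v\<close>, so by virtual work they bound the energy of every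
  deformation from below; tensions which are realized by a deformation bound it from above.\<close>

lemma stiff_direction:
  assumes v: "(\<Sum>i<4. \<Gamma> i * v i) = 0" and less: "tension_form v < 4 * k * (cmod (moment v))\<^sup>2"
    and f: "load f = moment v"
  shows "k * (cmod (load f))\<^sup>2 < rate_form f"
proof -
  \<comment> \<open>The coefficient 2 is optimal: using tension + c rate bounds the energy by 4 k
    |moment|^2 (c - 1) / c^2, which is largest at c = 2.\<close>
  have "0 \<le> (\<Sum>i<4. \<Sum>j<4. \<Gamma> i * \<Gamma> j * (tension v i j + 2 * rate f i j)\<^sup>2)"
    using \<Gamma>_pos by (intro sum_nonneg mult_nonneg_nonneg) (auto simp: less_imp_le)
  also have "\<dots> = (\<Sum>i<4. \<Sum>j<4. \<Gamma> i * \<Gamma> j * (tension v i j)\<^sup>2 + 4 * (\<Gamma> i * \<Gamma> j * (tension v i j * rate f i j))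
       + 4 * (\<Gamma> i * \<Gamma> j * (rate f i j)\<^sup>2))"
    by (intro sum.cong refl) (simp add: power2_eq_square algebra_simps)
  also have "\<dots> = tension_form v + 4 * (\<Sum>i<4. \<Sum>j<4. \<Gamma> i * \<Gamma> j * (tension v i j * rate f i j)) + 4 * rate_form f"
    unfolding tension_form_def rate_form_def by (simp add: sum.distrib sum_distrib_left)
  also have "\<dots> = tension_form v - 8 * k * (cmod (load f))\<^sup>2 + 4 * rate_form f"
    unfolding virtual_work[OF v] f cmod_power2 by (simp add: power2_eq_square algebra_simps)
  finally show ?thesis using less unfolding f by simp
qed

lemma soft_direction:
  assumes v: "(\<Sum>i<4. \<Gamma> i * v i) = 0" and less: "4 * k * (cmod (moment v))\<^sup>2 < tension_form v"
    and orth: "(\<Sum>i<4. \<Sum>j<4. (\<Gamma> i * a i) * (\<Gamma> j * a j) * ((cmod (z i - z j))\<^sup>2 * tension v i j)) = 0"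
  shows "\<exists>f. rate_form f < k * (cmod (load f))\<^sup>2"
proof -
  define g where "g i j = (cmod (z i - z j))\<^sup>2 * tension v i j" for i j
  have gs: "g i j = g j i" for i j unfolding g_def by (subst tension_sym) (simp add: norm_minus_commute)
  have "2 * (\<Gamma> 0 * a 0 * (\<Gamma> 1 * a 1) * g 0 1 + \<Gamma> 0 * a 0 * (\<Gamma> 2 * a 2) * g 0 2 + \<Gamma> 0 * a 0 * (\<Gamma> 3 * a 3) * g 0 3
    + \<Gamma> 1 * a 1 * (\<Gamma> 2 * a 2) * g 1 2 + \<Gamma> 1 * a 1 * (\<Gamma> 3 * a 3) * g 1 3 + \<Gamma> 2 * a 2 * (\<Gamma> 3 * a 3) * g 2 3) = 0"
  proof -
    have "g 1 0 = g 0 1" "g 2 0 = g 0 2" "g 3 0 = g 0 3" "g 2 1 = g 1 2" "g 3 1 = g 1 3" "g 3 2 = g 2 3" using gs by auto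
    moreover have "g i i = 0" for i by (simp add: g_def)
    ultimately show ?thesis using orth unfolding g_def[symmetric] sum_lessThan_4 by (simp add: algebra_simps)
  qed
  then have stress: "\<Gamma> 0 * a 0 * (\<Gamma> 1 * a 1) * g 0 1 + \<Gamma> 0 * a 0 * (\<Gamma> 2 * a 2) * g 0 2 + \<Gamma> 0 * a 0 * (\<Gamma> 3 * a 3) * g 0 3
    + \<Gamma> 1 * a 1 * (\<Gamma> 2 * a 2) * g 1 2 + \<Gamma> 1 * a 1 * (\<Gamma> 3 * a 3) * g 1 3 + \<Gamma> 2 * a 2 * (\<Gamma> 3 * a 3) * g 2 3 = 0" by simp
  have "\<Gamma> 2 * a 2 \<noteq> 0" using a_nz[of 2] \<Gamma>_pos[of 2] by simp
  then obtain f where f: "\<And>i j. i < 4 \<Longrightarrow> j < 4 \<Longrightarrow> i \<noteq> j \<Longrightarrow> Re ((f i - f j) * cnj (z i - z j)) = g i j"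
    using realize_edge_rates[OF sum_a[unfolded sum_lessThan_4] sum_az[unfolded sum_lessThan_4] _ noncollinear gs stress] by blast
  have rt: "rate f i j = tension v i j" if "i < 4" "j < 4" for i j
  proof (cases "i = j")
    case True then show ?thesis by (simp add: rate_def tension_def)
  next
    case False
    define x y where "x = f i - f j" "y = z i - z j"
    have y: "y \<noteq> 0" using distinct_points that False x_y_def(2) by simp
    have "x / y = x * cnj y / of_real ((cmod y)\<^sup>2)" unfolding complex_norm_square using y by simp
    then have "Re (x / y) = Re (x * cnj y) / (cmod y)\<^sup>2" by (simp only: Re_divide_of_real)
    also have "Re (x * cnj y) = (cmod y)\<^sup>2 * tension v i j" using f[OF that False] unfolding x_y_def g_def .
    finally show ?thesis using y unfolding rate_def x_y_def by simp
  qed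
  define y where "y = moment v"
  define w where "w = load f"
  have RT: "rate_form f = tension_form v" unfolding rate_form_def tension_form_def using rt by simp
  have "rate_form f = - 2 * k * Re (w * cnj y)"
    using virtual_work[OF v, of f] rt unfolding rate_form_def w_def y_def by (simp add: power2_eq_square)
  also have "\<dots> \<le> 2 * k * (cmod w * cmod y)"
  proof -
    define r where "r = Re (w * cnj y)"
    have "- r \<le> cmod w * cmod y"
      using abs_Re_le_cmod[of "w * cnj y"] unfolding r_def by (simp only: norm_mult complex_mod_cnj abs_le_iff)
    from mult_left_mono[OF this, of "2 * k"] k_pos show ?thesis unfolding r_def[symmetric] by simp
  qed
  finally have le: "rate_form f \<le> 2 * k * (cmod w * cmod y)" .
  \<comment> \<open>An energy above 4 k |y|^2 and at most 2 k |w| |y| forces |w| > 2 |y|; hence the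
    energy lies below k |w|^2.\<close>
  then have "4 * k * (cmod y)\<^sup>2 < 2 * k * (cmod w * cmod y)" using less RT unfolding y_def by simp
  then have "k * (cmod y * (2 * cmod y)) < k * (cmod y * cmod w)" by (simp add: power2_eq_square algebra_simps)
  then have "0 < cmod y" "2 * cmod y < cmod w" using k_pos
    by (auto simp: mult_less_cancel_left_disj)
  then have "2 * k * (cmod w * cmod y) < k * (cmod w)\<^sup>2"
  proof -
    have "cmod w * (2 * cmod y) < cmod w * cmod w" using \<open>0 < cmod y\<close> \<open>2 * cmod y < cmod w\<close>
      by (intro mult_strict_left_mono) linarith+
    then show ?thesis using k_pos by (simp add: power2_eq_square)
  qed
  then show ?thesis using le unfolding w_def by (intro exI[of _ f]) linarith
qed

lemma pair_form_edge:
  assumes "i < 4" "j < 4" "i \<noteq> j"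
  shows "pair_form (a i) (a j) (v i) (v j) = (tension v i j)\<^sup>2 + 2 * k * ((cmod (z i - z j))\<^sup>2 * v i * v j)"
    and "k * pair_trace (a i) (a j) (v i) (v j) = k * k * (a i * a j * ((cmod (z i - z j))\<^sup>2 * tension v i j))"
proof -
  have "1 - a i * a j \<noteq> 0" using distance[OF assms] by auto
  have e: "1 / (1 - a i * a j) = k * (cmod (z i - z j))\<^sup>2"
    unfolding nonzero_divide_eq_eq[OF \<open>1 - a i * a j \<noteq> 0\<close>] using distance[OF assms] by (rule sym)
  have "pair_form (a i) (a j) (v i) (v j) = ((a j * v i + a i * v j) * (1 / (1 - a i * a j)))\<^sup>2 + 2 * v i * v j * (1 / (1 - a i * a j))"
    by (simp add: pair_form_def)
  then show "pair_form (a i) (a j) (v i) (v j) = (tension v i j)\<^sup>2 + 2 * k * ((cmod (z i - z j))\<^sup>2 * v i * v j)"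
    unfolding e tension_def by (simp add: algebra_simps)
  have "pair_trace (a i) (a j) (v i) (v j) = a i * a j * (a j * v i + a i * v j) * (1 / (1 - a i * a j)) * (1 / (1 - a i * a j))"
    by (simp add: pair_trace_def power2_eq_square)
  then show "k * pair_trace (a i) (a j) (v i) (v j) = k * k * (a i * a j * ((cmod (z i - z j))\<^sup>2 * tension v i j))"
    unfolding e tension_def by (simp add: algebra_simps)
qed

text \<open>The dictionary between the two problems: the sign of \<open>four_form\<close> compares
  the energy of the tensions with the threshold 4 k |moment|^2, and \<open>four_trace\<close> is the
  pairing of the tensions with the self-stress. The factor 2 counts ordered pairs.\<close>

lemma four_form_tension:
  assumes \<mu>: "\<Gamma> 0 = \<mu>" "\<Gamma> 1 = \<mu>" and \<nu>: "\<Gamma> 2 = \<nu>" "\<Gamma> 3 = \<nu>" and v: "(\<Sum>i<4. \<Gamma> i * v i) = 0"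
  shows "2 * four_form \<mu> \<nu> (a 0) (a 1) (a 2) (a 3) (v 0) (v 1) (v 2) (v 3) = tension_form v - 4 * k * (cmod (moment v))\<^sup>2"
    and "2 * four_trace \<mu> \<nu> (a 0) (a 1) (a 2) (a 3) (v 0) (v 1) (v 2) (v 3) =
      k * (\<Sum>i<4. \<Sum>j<4. (\<Gamma> i * a i) * (\<Gamma> j * a j) * ((cmod (z i - z j))\<^sup>2 * tension v i j))"
proof -
  define r where "r i j = (cmod (z i - z j))\<^sup>2" for i j
  have rs: "r 1 0 = r 0 1" "r 2 0 = r 0 2" "r 3 0 = r 0 3" "r 2 1 = r 1 2" "r 3 1 = r 1 3" "r 3 2 = r 2 3"
    by (simp_all add: r_def norm_minus_commute)
  have r0: "r i i = 0" for i by (simp add: r_def)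
  have ts: "tension v 1 0 = tension v 0 1" "tension v 2 0 = tension v 0 2" "tension v 3 0 = tension v 0 3"
    "tension v 2 1 = tension v 1 2" "tension v 3 1 = tension v 1 3" "tension v 3 2 = tension v 2 3"
    by (rule tension_sym)+
  have t0: "tension v i i = 0" for i by (simp add: tension_def)
  have lt: "(0::nat) < 4" "(1::nat) < 4" "(2::nat) < 4" "(3::nat) < 4" "(0::nat) \<noteq> 1" "(0::nat) \<noteq> 2" "(0::nat) \<noteq> 3"
    "(1::nat) \<noteq> 2" "(1::nat) \<noteq> 3" "(2::nat) \<noteq> 3" by simp_all
  have "2 * four_form \<mu> \<nu> (a 0) (a 1) (a 2) (a 3) (v 0) (v 1) (v 2) (v 3) = tension_form v
     + 2 * k * (\<Sum>i<4. \<Sum>j<4. \<Gamma> i * \<Gamma> j * (r i j * v i * v j))"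
    unfolding four_form_def pair_form_edge(1)[OF lt(1,2,5)] pair_form_edge(1)[OF lt(1,3,6)] pair_form_edge(1)[OF lt(1,4,7)]
      pair_form_edge(1)[OF lt(2,3,8)] pair_form_edge(1)[OF lt(2,4,9)] pair_form_edge(1)[OF lt(3,4,10)]
      tension_form_def sum_lessThan_4 r_def[symmetric] rs r0 ts t0 \<mu> \<nu>
    by (simp add: algebra_simps power2_eq_square)
  then show "2 * four_form \<mu> \<nu> (a 0) (a 1) (a 2) (a 3) (v 0) (v 1) (v 2) (v 3) = tension_form v - 4 * k * (cmod (moment v))\<^sup>2"
    unfolding r_def moment_norm[OF v] by simp
  have "k * (2 * four_trace \<mu> \<nu> (a 0) (a 1) (a 2) (a 3) (v 0) (v 1) (v 2) (v 3)) =
    2 * (\<mu>\<^sup>2 * (k * pair_trace (a 0) (a 1) (v 0) (v 1)) + \<nu>\<^sup>2 * (k * pair_trace (a 2) (a 3) (v 2) (v 3)) + \<mu> * \<nu> *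
     (k * pair_trace (a 0) (a 2) (v 0) (v 2) + k * pair_trace (a 0) (a 3) (v 0) (v 3)
      + k * pair_trace (a 1) (a 2) (v 1) (v 2) + k * pair_trace (a 1) (a 3) (v 1) (v 3)))"
    unfolding four_trace_def by (simp add: algebra_simps)
  also have "\<dots> = k * (k * (\<Sum>i<4. \<Sum>j<4. (\<Gamma> i * a i) * (\<Gamma> j * a j) * (r i j * tension v i j)))"
    unfolding pair_form_edge(2)[OF lt(1,2,5)] pair_form_edge(2)[OF lt(1,3,6)] pair_form_edge(2)[OF lt(1,4,7)]
      pair_form_edge(2)[OF lt(2,3,8)] pair_form_edge(2)[OF lt(2,4,9)] pair_form_edge(2)[OF lt(3,4,10)]
      sum_lessThan_4 r_def[symmetric] rs r0 ts t0 \<mu> \<nu>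
    by (simp add: algebra_simps power2_eq_square)
  finally show "2 * four_trace \<mu> \<nu> (a 0) (a 1) (a 2) (a 3) (v 0) (v 1) (v 2) (v 3) =
      k * (\<Sum>i<4. \<Sum>j<4. (\<Gamma> i * a i) * (\<Gamma> j * a j) * ((cmod (z i - z j))\<^sup>2 * tension v i j))"
    unfolding r_def using k_pos by simp
qed

text \<open>After expanding the square, the barycentric weights kill everything that depends on i.
  The common value is the Lagrange multiplier, and so the weights are critical.\<close>

lemma weighted_square_distances:
  "(\<Sum>j<4. \<Gamma> j * a j * (k * (cmod (z i - z j))\<^sup>2)) = k * (\<Sum>j<4. \<Gamma> j * a j * (cmod (z j))\<^sup>2)"
proof -
  have e: "(cmod (z i - z j))\<^sup>2 = (cmod (z i))\<^sup>2 + (cmod (z j))\<^sup>2 - 2 * Re (cnj (z i) * z j)" for j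
    unfolding cmod_power2 by (simp add: power2_eq_square algebra_simps)
  have "(\<Sum>j<4. \<Gamma> j * a j * (k * (cmod (z i - z j))\<^sup>2)) =
    k * (cmod (z i))\<^sup>2 * (\<Sum>j<4. \<Gamma> j * a j) + k * (\<Sum>j<4. \<Gamma> j * a j * (cmod (z j))\<^sup>2)
      - 2 * k * Re (cnj (z i) * (\<Sum>j<4. of_real (\<Gamma> j * a j) * z j))"
    unfolding sum_distrib_left Re_sum sum.distrib[symmetric] sum_subtractf[symmetric]
    unfolding e by (intro sum.cong refl) (simp add: algebra_simps)
  then show ?thesis unfolding sum_a sum_az by simp
qed

lemma critical_equation:
  assumes "i < 4"
  shows "(\<Sum>j\<in>{..<4} - {i}. \<Gamma> j * a j / (1 - a i * a j)) = k * (\<Sum>j<4. \<Gamma> j * a j * (cmod (z j))\<^sup>2)"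
proof -
  have "(\<Sum>j\<in>{..<4} - {i}. \<Gamma> j * a j / (1 - a i * a j)) = (\<Sum>j\<in>{..<4} - {i}. \<Gamma> j * a j * (k * (cmod (z i - z j))\<^sup>2))"
  proof (intro sum.cong refl)
    fix j assume j: "j \<in> {..<4} - {i}"
    then have d: "k * (cmod (z i - z j))\<^sup>2 * (1 - a i * a j) = 1" using distance[of i j] assms by auto
    then have "1 - a i * a j \<noteq> 0" by auto
    from nonzero_divide_eq_eq[OF this] have "1 / (1 - a i * a j) = k * (cmod (z i - z j))\<^sup>2" using d by metis
    then show "\<Gamma> j * a j / (1 - a i * a j) = \<Gamma> j * a j * (k * (cmod (z i - z j))\<^sup>2)"
      by (metis times_divide_eq_right mult.right_neutral)
  qed
  also have "\<dots> = (\<Sum>j<4. \<Gamma> j * a j * (k * (cmod (z i - z j))\<^sup>2))"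
    using assms by (intro sum.mono_neutral_left) auto
  finally show ?thesis unfolding weighted_square_distances .
qed

end

lemma four_form_swap: "four_form \<nu> \<mu> b1 b2 a1 a2 w1 w2 v1 v2 = four_form \<mu> \<nu> a1 a2 b1 b2 v1 v2 w1 w2"
  and four_trace_swap: "four_trace \<nu> \<mu> b1 b2 a1 a2 w1 w2 v1 v2 = four_trace \<mu> \<nu> a1 a2 b1 b2 v1 v2 w1 w2"
proof -
  have "pair_form x y \<xi> \<eta> = pair_form y x \<eta> \<xi>" "pair_trace x y \<xi> \<eta> = pair_trace y x \<eta> \<xi>" for x y \<xi> \<eta>
    unfolding pair_form_def pair_trace_def by (simp_all add: mult.commute add.commute mult.left_commute)
  then show "four_form \<nu> \<mu> b1 b2 a1 a2 w1 w2 v1 v2 = four_form \<mu> \<nu> a1 a2 b1 b2 v1 v2 w1 w2"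
    "four_trace \<nu> \<mu> b1 b2 a1 a2 w1 w2 v1 v2 = four_trace \<mu> \<nu> a1 a2 b1 b2 v1 v2 w1 w2"
    unfolding four_form_def four_trace_def by (simp_all add: algebra_simps)
qed

text \<open>The pair without the interior vortex has positive weights, the other pair has weights of
  opposite sign; \<open>signs\<close> leaves open which pair is which.\<close>

locale two_pair_configuration = balanced_configuration +
  assumes pairs: "\<Gamma> 1 = \<Gamma> 0" "\<Gamma> 3 = \<Gamma> 2" "\<Gamma> 0 \<noteq> \<Gamma> 2"
    and signs: "0 < a 0 \<and> 0 < a 1 \<and> a 2 * a 3 < 0 \<or> 0 < a 2 \<and> 0 < a 3 \<and> a 0 * a 1 < 0"
begin

lemma saddle_weights:
  shows "\<exists>v. (\<Sum>i<4. \<Gamma> i * v i) = 0 \<and> tension_form v < 4 * k * (cmod (moment v))\<^sup>2"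
    and "\<exists>v. (\<Sum>i<4. \<Gamma> i * v i) = 0 \<and> 4 * k * (cmod (moment v))\<^sup>2 < tension_form v \<and>
      (\<Sum>i<4. \<Sum>j<4. (\<Gamma> i * a i) * (\<Gamma> j * a j) * ((cmod (z i - z j))\<^sup>2 * tension v i j)) = 0"
proof -
  define \<kappa> where "\<kappa> = k * (\<Sum>j<4. \<Gamma> j * a j * (cmod (z j))\<^sup>2)"
  have u: "0 < 1 - a i * a j" if "i < 4" "j < 4" "i \<noteq> j" for i j
  proof -
    have "0 \<le> k * (cmod (z i - z j))\<^sup>2" using k_pos by simp
    then show ?thesis
      using distance[OF that] mult_nonneg_nonpos[of "k * (cmod (z i - z j))\<^sup>2" "1 - a i * a j"] by linarith
  qed
  have sets: "{..<4::nat} - {0} = {1, 2, 3}" "{..<4::nat} - {1} = {0, 2, 3}" "{..<4::nat} - {2} = {0, 1, 3}" "{..<4::nat} - {3} = {0, 1, 2}"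
    by auto
  have g: "\<Gamma> 1 * a 1 / (1 - a 0 * a 1) + \<Gamma> 2 * a 2 / (1 - a 0 * a 2) + \<Gamma> 3 * a 3 / (1 - a 0 * a 3) = \<kappa>"
    "\<Gamma> 0 * a 0 / (1 - a 1 * a 0) + \<Gamma> 2 * a 2 / (1 - a 1 * a 2) + \<Gamma> 3 * a 3 / (1 - a 1 * a 3) = \<kappa>"
    "\<Gamma> 0 * a 0 / (1 - a 2 * a 0) + \<Gamma> 1 * a 1 / (1 - a 2 * a 1) + \<Gamma> 3 * a 3 / (1 - a 2 * a 3) = \<kappa>"
    "\<Gamma> 0 * a 0 / (1 - a 3 * a 0) + \<Gamma> 1 * a 1 / (1 - a 3 * a 1) + \<Gamma> 2 * a 2 / (1 - a 3 * a 2) = \<kappa>"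
    using critical_equation[of 0] critical_equation[of 1] critical_equation[of 2] critical_equation[of 3]
    unfolding \<kappa>_def[symmetric] sets by (simp_all add: add.assoc)
  have G: "0 < \<Gamma> 0" "0 < \<Gamma> 2" using \<Gamma>_pos by auto
  have sm: "\<Gamma> 0 * (a 0 + a 1) + \<Gamma> 2 * (a 2 + a 3) = 0"
    using sum_a unfolding sum_lessThan_4 pairs by (simp add: algebra_simps)
  have four: "(\<exists>v1 v2 w1 w2. \<Gamma> 0 * (v1 + v2) + \<Gamma> 2 * (w1 + w2) = 0 \<and> four_form (\<Gamma> 0) (\<Gamma> 2) (a 0) (a 1) (a 2) (a 3) v1 v2 w1 w2 < 0) \<and>
    (\<exists>v1 v2 w1 w2. \<Gamma> 0 * (v1 + v2) + \<Gamma> 2 * (w1 + w2) = 0 \<and> four_trace (\<Gamma> 0) (\<Gamma> 2) (a 0) (a 1) (a 2) (a 3) v1 v2 w1 w2 = 0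
       \<and> four_form (\<Gamma> 0) (\<Gamma> 2) (a 0) (a 1) (a 2) (a 3) v1 v2 w1 w2 > 0)"
    using signs
  proof (elim disjE conjE)
    assume s: "0 < a 0" "0 < a 1" "a 2 * a 3 < 0"
    have "1 - a 0 * a 2 > 0" "1 - a 0 * a 3 > 0" "1 - a 1 * a 2 > 0" "1 - a 1 * a 3 > 0" "1 - a 0 * a 1 > 0"
      using u by auto
    moreover have "\<Gamma> 0 * a 1 / (1 - a 0 * a 1) + \<Gamma> 2 * a 2 / (1 - a 0 * a 2) + \<Gamma> 2 * a 3 / (1 - a 0 * a 3) = \<kappa>"
    "\<Gamma> 0 * a 0 / (1 - a 0 * a 1) + \<Gamma> 2 * a 2 / (1 - a 1 * a 2) + \<Gamma> 2 * a 3 / (1 - a 1 * a 3) = \<kappa>"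
    "\<Gamma> 0 * a 0 / (1 - a 0 * a 2) + \<Gamma> 0 * a 1 / (1 - a 1 * a 2) + \<Gamma> 2 * a 3 / (1 - a 2 * a 3) = \<kappa>"
    "\<Gamma> 0 * a 0 / (1 - a 0 * a 3) + \<Gamma> 0 * a 1 / (1 - a 1 * a 3) + \<Gamma> 2 * a 2 / (1 - a 2 * a 3) = \<kappa>"
      using g unfolding pairs by (simp_all add: mult.commute)
    ultimately show ?thesis using saddle_directions[OF G pairs(3) s sm] by blast
  next
    assume s: "0 < a 2" "0 < a 3" "a 0 * a 1 < 0"
    have "1 - a 2 * a 0 > 0" "1 - a 2 * a 1 > 0" "1 - a 3 * a 0 > 0" "1 - a 3 * a 1 > 0" "1 - a 2 * a 3 > 0"
      using u by auto
    moreover have "\<Gamma> 2 * a 3 / (1 - a 2 * a 3) + \<Gamma> 0 * a 0 / (1 - a 2 * a 0) + \<Gamma> 0 * a 1 / (1 - a 2 * a 1) = \<kappa>"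
    "\<Gamma> 2 * a 2 / (1 - a 2 * a 3) + \<Gamma> 0 * a 0 / (1 - a 3 * a 0) + \<Gamma> 0 * a 1 / (1 - a 3 * a 1) = \<kappa>"
    "\<Gamma> 2 * a 2 / (1 - a 2 * a 0) + \<Gamma> 2 * a 3 / (1 - a 3 * a 0) + \<Gamma> 0 * a 1 / (1 - a 0 * a 1) = \<kappa>"
    "\<Gamma> 2 * a 2 / (1 - a 2 * a 1) + \<Gamma> 2 * a 3 / (1 - a 3 * a 1) + \<Gamma> 0 * a 0 / (1 - a 0 * a 1) = \<kappa>"
      using g unfolding pairs by (simp_all add: mult.commute add.commute add.left_commute)
    moreover have sm': "\<Gamma> 2 * (a 2 + a 3) + \<Gamma> 0 * (a 0 + a 1) = 0" using sm by simp
    ultimately have "(\<exists>v1 v2 w1 w2. \<Gamma> 2 * (v1 + v2) + \<Gamma> 0 * (w1 + w2) = 0 \<and> four_form (\<Gamma> 2) (\<Gamma> 0) (a 2) (a 3) (a 0) (a 1) v1 v2 w1 w2 < 0) \<and>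
    (\<exists>v1 v2 w1 w2. \<Gamma> 2 * (v1 + v2) + \<Gamma> 0 * (w1 + w2) = 0 \<and> four_trace (\<Gamma> 2) (\<Gamma> 0) (a 2) (a 3) (a 0) (a 1) v1 v2 w1 w2 = 0
       \<and> four_form (\<Gamma> 2) (\<Gamma> 0) (a 2) (a 3) (a 0) (a 1) v1 v2 w1 w2 > 0)"
      using saddle_directions[OF G(2,1) pairs(3)[symmetric] s sm'] by blast
    then show ?thesis unfolding four_form_swap[of "\<Gamma> 2"] four_trace_swap[of "\<Gamma> 2"] by (metis add.commute)
  qed
  have vec: "(\<Sum>i<4. \<Gamma> i * v i) = \<Gamma> 0 * (v 0 + v 1) + \<Gamma> 2 * (v 2 + v 3)" for v
    unfolding sum_lessThan_4 pairs by (simp add: algebra_simps)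
  define mk where "mk v1 v2 w1 w2 i = (if i = 0 then v1 else if i = 1 then v2 else if i = 2 then w1 else w2)" for v1 v2 w1 w2 :: real and i :: nat
  have mk: "mk v1 v2 w1 w2 0 = v1" "mk v1 v2 w1 w2 1 = v2" "mk v1 v2 w1 w2 2 = w1" "mk v1 v2 w1 w2 3 = w2" for v1 v2 w1 w2
    by (simp_all add: mk_def)
  note ft = four_form_tension[OF refl pairs(1) refl pairs(2), of "mk _ _ _ _", unfolded vec mk]
  from four obtain v1 v2 w1 w2 where h: "\<Gamma> 0 * (v1 + v2) + \<Gamma> 2 * (w1 + w2) = 0"
    "four_form (\<Gamma> 0) (\<Gamma> 2) (a 0) (a 1) (a 2) (a 3) v1 v2 w1 w2 < 0" by blast
  then show "\<exists>v. (\<Sum>i<4. \<Gamma> i * v i) = 0 \<and> tension_form v < 4 * k * (cmod (moment v))\<^sup>2"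
    using ft(1)[OF h(1)] by (intro exI[of _ "mk v1 v2 w1 w2"]) (simp only: vec mk, linarith)
  from four obtain v1 v2 w1 w2 where h: "\<Gamma> 0 * (v1 + v2) + \<Gamma> 2 * (w1 + w2) = 0"
    "four_trace (\<Gamma> 0) (\<Gamma> 2) (a 0) (a 1) (a 2) (a 3) v1 v2 w1 w2 = 0"
    "0 < four_form (\<Gamma> 0) (\<Gamma> 2) (a 0) (a 1) (a 2) (a 3) v1 v2 w1 w2" by blast
  then show "\<exists>v. (\<Sum>i<4. \<Gamma> i * v i) = 0 \<and> 4 * k * (cmod (moment v))\<^sup>2 < tension_form v \<and>
      (\<Sum>i<4. \<Sum>j<4. (\<Gamma> i * a i) * (\<Gamma> j * a j) * ((cmod (z i - z j))\<^sup>2 * tension v i j)) = 0"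
    using ft[OF h(1)] k_pos by (intro exI[of _ "mk v1 v2 w1 w2"]) (simp only: vec mk, simp)
qed

end

section \<open>The spectrum in an adapted basis\<close>

text \<open>Completing the square in \<open>x\<close> leaves a real form in \<open>y\<close>; its determinant is the left-hand side below,
  up to the positive factor \<open>\<omega>\<^sup>2 - |\<alpha>|\<^sup>2\<close>.\<close>

lemma resolvent_negative:
  fixes \<alpha> \<gamma> \<delta> :: complex and \<omega> :: real
  defines "\<phi> \<equiv> \<lambda>x y. Re (\<alpha> * x\<^sup>2 + 2 * \<gamma> * x * y + \<delta> * y\<^sup>2) + \<omega> * ((cmod x)\<^sup>2 + (cmod y)\<^sup>2)"
  assumes \<omega>: "0 < \<omega>" and pos: "\<And>x. x \<noteq> 0 \<Longrightarrow> 0 < \<phi> x 0" and neg: "\<phi> x1 y1 < 0" and pos': "\<And>x. 0 < \<phi> x y0"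
  shows "\<omega>^4 - \<omega>\<^sup>2 * ((cmod \<alpha>)\<^sup>2 + 2 * (cmod \<gamma>)\<^sup>2 + (cmod \<delta>)\<^sup>2) + (cmod (\<alpha> * \<delta> - \<gamma>\<^sup>2))\<^sup>2 < 0"
proof -
  have "cmod \<alpha> < \<omega>"
  proof (cases "\<alpha> = 0")
    case False
    \<comment> \<open>The direction in which \<open>\<alpha> * x\<^sup>2\<close> is most negative,
      namely - |\<alpha>|^2.\<close>
    define x where "x = csqrt (- cnj \<alpha>)"
    have x2: "x\<^sup>2 = - cnj \<alpha>" by (simp add: x_def)
    have "x \<noteq> 0" using False x2 by auto
    have "(cmod x)\<^sup>2 = cmod (x\<^sup>2)" by (simp add: norm_power)
    then have nx: "(cmod x)\<^sup>2 = cmod \<alpha>" unfolding x2 by simp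
    have "\<alpha> * x\<^sup>2 = - of_real ((cmod \<alpha>)\<^sup>2)" unfolding x2 by (simp add: complex_norm_square del: of_real_power)
    then have "\<phi> x 0 = - (cmod \<alpha>)\<^sup>2 + \<omega> * cmod \<alpha>" unfolding \<phi>_def nx by simp
    then have "0 < cmod \<alpha> * (\<omega> - cmod \<alpha>)" using pos[OF \<open>x \<noteq> 0\<close>] by (simp add: power2_eq_square algebra_simps)
    then show ?thesis using False by (simp add: zero_less_mult_iff)
  qed (use \<omega> in simp)
  then have X: "0 < \<omega>\<^sup>2 - (cmod \<alpha>)\<^sup>2" by (simp add: power_strict_mono)
  define X where "X = \<omega>\<^sup>2 - (cmod \<alpha>)\<^sup>2"
  define c where "c = \<omega> * (X - (cmod \<gamma>)\<^sup>2)"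
  define \<kappa> where "\<kappa> = X * \<delta> + cnj \<alpha> * \<gamma>\<^sup>2"
  \<comment> \<open>The critical point of \<phi> in \<open>x\<close> for fixed \<open>y\<close>,
    i.e. the solution of \<open>\<alpha> * s + \<omega> * cnj s = - (\<gamma> * y)\<close>.\<close>
  define xs where "xs y = (cnj \<alpha> * (\<gamma> * y) - \<omega> * cnj (\<gamma> * y)) / X" for y
  have comp: "X * \<phi> x y = X * (Re (\<alpha> * (x - xs y)\<^sup>2) + \<omega> * (cmod (x - xs y))\<^sup>2) + c * (cmod y)\<^sup>2 + Re (\<kappa> * y\<^sup>2)" for x y
  proof -
    define b where "b = \<gamma> * y"
    define s where "s = xs y"
    have Xc: "complex_of_real X \<noteq> 0" using X unfolding X_def[symmetric] by simp
    have Xs: "X * s = cnj \<alpha> * b - \<omega> * cnj b" using Xc unfolding s_def xs_def b_def by simp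
    have XX: "complex_of_real X = of_real \<omega> * of_real \<omega> - \<alpha> * cnj \<alpha>"
      unfolding X_def of_real_diff by (simp add: complex_norm_square power2_eq_square flip: of_real_mult complex_norm_square)
    have st: "\<alpha> * s + \<omega> * cnj s = - b"
    proof -
      have "cnj (X * s) = \<alpha> * cnj b - \<omega> * b" unfolding Xs by simp
      then have Xs': "X * cnj s = \<alpha> * cnj b - \<omega> * b" by simp
      have "X * (\<alpha> * s + \<omega> * cnj s) = \<alpha> * (X * s) + \<omega> * (X * cnj s)" by (simp add: algebra_simps)
      also have "\<dots> = X * (- b)" unfolding Xs Xs' unfolding XX by (simp add: algebra_simps)
      finally show ?thesis unfolding mult_left_cancel[OF Xc] .
    qed
    have Xb: "X * Re (b * s) = Re (cnj \<alpha> * b\<^sup>2) - \<omega> * (cmod b)\<^sup>2"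
    proof -
      have "X * Re (b * s) = Re (b * (X * s))" by (simp add: algebra_simps)
      also have "\<dots> = Re (cnj \<alpha> * b\<^sup>2) - \<omega> * Re (b * cnj b)" unfolding Xs by (simp add: algebra_simps power2_eq_square)
      finally show ?thesis by (simp add: complex_norm_square[symmetric] del: of_real_power)
    qed
    have norm_sq: "(cmod (u - w))\<^sup>2 = (cmod u)\<^sup>2 - 2 * Re (u * cnj w) + (cmod w)\<^sup>2" for u w
      unfolding cmod_power2 by (simp add: algebra_simps power2_eq_square)
    have "Re (\<alpha> * (x - s)\<^sup>2) + \<omega> * (cmod (x - s))\<^sup>2 = Re (\<alpha> * x\<^sup>2) + \<omega> * (cmod x)\<^sup>2
       - 2 * Re (x * (\<alpha> * s + \<omega> * cnj s)) + Re (\<alpha> * s\<^sup>2) + \<omega> * (cmod s)\<^sup>2"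
      unfolding norm_sq by (simp add: algebra_simps power2_eq_square)
    also have "Re (\<alpha> * s\<^sup>2) + \<omega> * (cmod s)\<^sup>2 = Re (s * (\<alpha> * s + \<omega> * cnj s))"
      unfolding cmod_power2 by (simp add: algebra_simps power2_eq_square)
    then have "Re (\<alpha> * x\<^sup>2) + \<omega> * (cmod x)\<^sup>2 - 2 * Re (x * (\<alpha> * s + \<omega> * cnj s)) + Re (\<alpha> * s\<^sup>2) + \<omega> * (cmod s)\<^sup>2
      = Re (\<alpha> * x\<^sup>2) + \<omega> * (cmod x)\<^sup>2 + 2 * Re (x * b) - Re (b * s)"
      unfolding st by (simp add: algebra_simps)
    finally have sq: "Re (\<alpha> * x\<^sup>2) + \<omega> * (cmod x)\<^sup>2 + 2 * Re (x * b) = Re (\<alpha> * (x - s)\<^sup>2) + \<omega> * (cmod (x - s))\<^sup>2 + Re (b * s)"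
      by simp
    have phi: "\<phi> x y = (Re (\<alpha> * x\<^sup>2) + \<omega> * (cmod x)\<^sup>2 + 2 * Re (x * b)) + Re (\<delta> * y\<^sup>2) + \<omega> * (cmod y)\<^sup>2"
      unfolding \<phi>_def b_def by (simp add: algebra_simps)
    have "X * \<phi> x y = X * (Re (\<alpha> * (x - s)\<^sup>2) + \<omega> * (cmod (x - s))\<^sup>2) + X * Re (b * s) + X * Re (\<delta> * y\<^sup>2) + X * \<omega> * (cmod y)\<^sup>2"
      unfolding phi sq by (simp only: distrib_left mult.assoc)
    also have "\<dots> = X * (Re (\<alpha> * (x - s)\<^sup>2) + \<omega> * (cmod (x - s))\<^sup>2) + c * (cmod y)\<^sup>2 + Re (\<kappa> * y\<^sup>2)"
    proof -
      have "\<kappa> * y\<^sup>2 = of_real X * (\<delta> * y\<^sup>2) + cnj \<alpha> * b\<^sup>2" unfolding \<kappa>_def b_def by (simp add: power2_eq_square algebra_simps)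
      moreover have "Re (of_real X * w + v) = X * Re w + Re v" for w v by simp
      ultimately have r: "Re (\<kappa> * y\<^sup>2) = X * Re (\<delta> * y\<^sup>2) + Re (cnj \<alpha> * b\<^sup>2)" by metis
      have "(cmod b)\<^sup>2 = (cmod \<gamma>)\<^sup>2 * (cmod y)\<^sup>2" unfolding b_def by (simp add: norm_mult power_mult_distrib)
      then show ?thesis unfolding Xb r c_def by (simp only: algebra_simps)
    qed
    finally show ?thesis unfolding s_def .
  qed
  have nonneg: "0 \<le> Re (\<alpha> * x\<^sup>2) + \<omega> * (cmod x)\<^sup>2" for x
    using pos[of x] unfolding \<phi>_def by (cases "x = 0") auto
  \<comment> \<open>The remaining form in \<open>y\<close> has eigenvalues c - |\<kappa>| and c +
    |\<kappa>|. Its negative value at \<open>y1\<close> and positive value at \<open>y0\<close> make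
    the first negative and the second positive.\<close>
  have "c * (cmod y1)\<^sup>2 + Re (\<kappa> * y1\<^sup>2) < 0"
  proof -
    have "X * \<phi> x1 y1 < 0" using neg X X_def by (simp add: mult_pos_neg)
    moreover have "0 \<le> X * (Re (\<alpha> * (x1 - xs y1)\<^sup>2) + \<omega> * (cmod (x1 - xs y1))\<^sup>2)"
      using nonneg X X_def by (intro mult_nonneg_nonneg) auto
    ultimately show ?thesis using comp[of x1 y1] by linarith
  qed
  then have *: "c * (cmod y1)\<^sup>2 < - Re (\<kappa> * y1\<^sup>2)" by linarith
  have bound: "\<bar>Re (\<kappa> * y\<^sup>2)\<bar> \<le> cmod \<kappa> * (cmod y)\<^sup>2" for y
    using abs_Re_le_cmod[of "\<kappa> * y\<^sup>2"] by (simp only: norm_mult norm_power)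
  have "(c - cmod \<kappa>) * (cmod y1)\<^sup>2 < 0" using bound[of y1] * unfolding left_diff_distrib abs_le_iff by linarith
  then have c1: "c < cmod \<kappa>" by (simp add: mult_less_0_iff)
  have "0 < c * (cmod y0)\<^sup>2 + Re (\<kappa> * y0\<^sup>2)"
  proof -
    have "0 < X * \<phi> (xs y0) y0" using pos'[of "xs y0"] X X_def by simp
    then show ?thesis using comp[of "xs y0" y0] by simp
  qed
  then have "0 < (c + cmod \<kappa>) * (cmod y0)\<^sup>2" using bound[of y0] unfolding distrib_right abs_le_iff by linarith
  then have c2: "- c < cmod \<kappa>" by (simp add: zero_less_mult_iff)
  have "c\<^sup>2 < (cmod \<kappa>)\<^sup>2" using c1 c2 by (metis abs_less_iff abs_le_square_iff abs_norm_cancel not_less)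
  moreover have "X * (\<omega>^4 - \<omega>\<^sup>2 * ((cmod \<alpha>)\<^sup>2 + 2 * (cmod \<gamma>)\<^sup>2 + (cmod \<delta>)\<^sup>2) + (cmod (\<alpha> * \<delta> - \<gamma>\<^sup>2))\<^sup>2)
     = c\<^sup>2 - (cmod \<kappa>)\<^sup>2"
  proof -
    define p where "p = Re (cnj \<delta> * cnj \<alpha> * \<gamma>\<^sup>2)"
    have nadd: "(cmod (u + w))\<^sup>2 = (cmod u)\<^sup>2 + 2 * Re (cnj u * w) + (cmod w)\<^sup>2" for u w
      unfolding cmod_power2 by (simp add: algebra_simps power2_eq_square)
    have k: "(cmod \<kappa>)\<^sup>2 = X\<^sup>2 * (cmod \<delta>)\<^sup>2 + 2 * X * p + (cmod \<alpha>)\<^sup>2 * (cmod \<gamma>)^4"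
      unfolding \<kappa>_def nadd p_def by (simp add: norm_mult norm_power power_mult_distrib power2_eq_square[of "_ ^ _"] power4_eq_xxxx algebra_simps)
    have q: "(cmod (\<alpha> * \<delta> - \<gamma>\<^sup>2))\<^sup>2 = (cmod \<alpha>)\<^sup>2 * (cmod \<delta>)\<^sup>2 - 2 * p + (cmod \<gamma>)^4"
      unfolding diff_conv_add_uminus nadd p_def
      by (simp add: norm_mult norm_power power_mult_distrib algebra_simps flip: power_mult)
    have a2: "(cmod \<alpha>)\<^sup>2 = \<omega>\<^sup>2 - X" by (simp add: X_def)
    show ?thesis unfolding k q c_def a2 by (simp add: power2_eq_square power4_eq_xxxx algebra_simps)
  qed
  ultimately show ?thesis using X unfolding X_def[symmetric] by (metis less_iff_diff_less_0 mult_less_0_iff not_less_iff_gr_or_eq)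
qed

lemma scaled_sum_product:
  fixes x y :: "_ \<Rightarrow> complex"
  shows "c * ((\<Sum>p\<in>A. x p) * (\<Sum>q\<in>B. y q)) = (\<Sum>p\<in>A. \<Sum>q\<in>B. c * (x p * y q))"
  by (subst sum_product) (simp only: sum_distrib_left)

section \<open>An orthonormal basis adapted to the equilibrium\<close>

context balanced_configuration
begin

definition total :: real where "total = (\<Sum>i<4. \<Gamma> i)"
definition center :: complex where "center = (\<Sum>i<4. of_real (\<Gamma> i) * z i) / of_real total"
definition frequency :: real where "frequency = k * total"

definition inner_prod :: "(nat \<Rightarrow> complex) \<Rightarrow> (nat \<Rightarrow> complex) \<Rightarrow> complex" where
  "inner_prod f g = (\<Sum>i<4. of_real (\<Gamma> i) * (cnj (f i) * g i))"

text \<open>The Hessian of the energy is the real part of this form. It is bilinear rather than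
  sesquilinear because ln |u| is the real part of a holomorphic function.\<close>

definition bilin :: "(nat \<Rightarrow> complex) \<Rightarrow> (nat \<Rightarrow> complex) \<Rightarrow> complex" where
  "bilin f g = (\<Sum>i<4. \<Sum>j<4. of_real (\<Gamma> i * \<Gamma> j) * ((f i - f j) / (z i - z j) * ((g i - g j) / (z i - z j)))) / 2"

lemma total_pos: "0 < total"
  unfolding total_def sum_lessThan_4 using \<Gamma>_pos by (simp add: add_pos_pos)

lemma frequency_pos: "0 < frequency"
  unfolding frequency_def using k_pos total_pos by simp

lemma sum_centered: "(\<Sum>i<4. of_real (\<Gamma> i) * (z i - center)) = 0"
proof -
  have "(\<Sum>i<4. of_real (\<Gamma> i) * (z i - center)) = (\<Sum>i<4. of_real (\<Gamma> i) * z i) - of_real total * center"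
    unfolding total_def of_real_sum sum_distrib_right by (simp add: algebra_simps sum_subtractf)
  then show ?thesis unfolding center_def using total_pos by simp
qed

lemma bilin_sum:
  "bilin (\<lambda>i. \<Sum>p\<in>A. c p * f p i) (\<lambda>i. \<Sum>q\<in>B. d q * g q i) = (\<Sum>p\<in>A. \<Sum>q\<in>B. c p * d q * bilin (f p) (g q))"
proof -
  have "(\<Sum>i<4. \<Sum>j<4. of_real (\<Gamma> i * \<Gamma> j) * (((\<Sum>p\<in>A. c p * f p i) - (\<Sum>p\<in>A. c p * f p j)) / (z i - z j)
      * (((\<Sum>q\<in>B. d q * g q i) - (\<Sum>q\<in>B. d q * g q j)) / (z i - z j))))
    = (\<Sum>i<4. \<Sum>j<4. \<Sum>p\<in>A. \<Sum>q\<in>B. c p * d q * (of_real (\<Gamma> i * \<Gamma> j) * ((f p i - f p j) / (z i - z j) * ((g q i - g q j) / (z i - z j)))))"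
  proof (intro sum.cong refl)
    fix i j
    have "((\<Sum>p\<in>A. c p * f p i) - (\<Sum>p\<in>A. c p * f p j)) / (z i - z j) = (\<Sum>p\<in>A. c p * ((f p i - f p j) / (z i - z j)))"
      "((\<Sum>q\<in>B. d q * g q i) - (\<Sum>q\<in>B. d q * g q j)) / (z i - z j) = (\<Sum>q\<in>B. d q * ((g q i - g q j) / (z i - z j)))"
      by (simp_all add: sum_subtractf[symmetric] right_diff_distrib sum_divide_distrib diff_divide_distrib)
    note eqs = this
    show "of_real (\<Gamma> i * \<Gamma> j) * (((\<Sum>p\<in>A. c p * f p i) - (\<Sum>p\<in>A. c p * f p j)) / (z i - z j)
      * (((\<Sum>q\<in>B. d q * g q i) - (\<Sum>q\<in>B. d q * g q j)) / (z i - z j)))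
      = (\<Sum>p\<in>A. \<Sum>q\<in>B. c p * d q * (of_real (\<Gamma> i * \<Gamma> j) * ((f p i - f p j) / (z i - z j) * ((g q i - g q j) / (z i - z j)))))"
      unfolding eqs scaled_sum_product by (intro sum.cong refl) (simp only: mult_ac)
  qed
  also have "\<dots> = (\<Sum>p\<in>A. \<Sum>q\<in>B. \<Sum>i<4. \<Sum>j<4. c p * d q * (of_real (\<Gamma> i * \<Gamma> j) * ((f p i - f p j) / (z i - z j) * ((g q i - g q j) / (z i - z j)))))"
    by (simp only: sum.swap[of _ A "{..<4}"] sum.swap[of _ B "{..<4}"])
  finally show ?thesis
    unfolding bilin_def by (simp add: sum_distrib_left sum_divide_distrib)
qed

lemma bilin_sym: "bilin f g = bilin g f"
  unfolding bilin_def by (simp add: mult.commute)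

lemma bilin_const: "bilin (\<lambda>i. c) g = 0"
  unfolding bilin_def by simp

text \<open>\<open>distance\<close> replaces 1 / (z_i - z_j) by k (1 - a_i a_j) times the conjugate,
  and the part with the weights sums to zero. So the centered position is an eigenvector of the
  antilinear Hessian, which produces the root \<omega>^2 of \<chi>.\<close>

lemma bilin_position:
  "bilin (\<lambda>i. z i - center) g = of_real frequency * inner_prod (\<lambda>i. z i - center) g"
proof -
  define zc where "zc i = z i - center" for i
  have pt: "of_real (\<Gamma> i * \<Gamma> j) * ((zc i - zc j) / (z i - z j) * ((g i - g j) / (z i - z j)))
    = of_real k * (of_real (\<Gamma> i) * of_real (\<Gamma> j) * ((g i - g j) * cnj (zc i - zc j)))
     - of_real k * (of_real (\<Gamma> i * a i) * of_real (\<Gamma> j * a j) * ((g i - g j) * cnj (z i - z j)))" if "i < 4" "j < 4" for i j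
  proof (cases "i = j")
    case True then show ?thesis by simp
  next
    case False
    define y where "y = z i - z j"
    have y: "y \<noteq> 0" using distinct_points that False y_def by simp
    have zy: "zc i - zc j = y" by (simp add: zc_def y_def)
    have "of_real (k * (cmod y)\<^sup>2 * (1 - a i * a j)) = (1::complex)" using distance[OF that False] y_def by simp
    then have "y * (cnj y * of_real (k * (1 - a i * a j))) = 1"
      unfolding of_real_mult[of "k * (cmod y)\<^sup>2"] of_real_mult[of k "(cmod y)\<^sup>2"] complex_norm_square by (simp add: algebra_simps)
    then have inv: "1 / y = cnj y * of_real (k * (1 - a i * a j))" using y by (simp add: field_simps)
    have "of_real (\<Gamma> i * \<Gamma> j) * ((zc i - zc j) / y * ((g i - g j) / y)) = of_real (\<Gamma> i * \<Gamma> j) * ((g i - g j) * (1 / y))"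
      unfolding zy using y by simp
    then show ?thesis unfolding inv zy y_def[symmetric] by (simp add: algebra_simps)
  qed
  have s0: "(\<Sum>i<4. complex_of_real (\<Gamma> i * a i)) = 0" using sum_a by (simp flip: of_real_mult of_real_sum)
  have s1: "(\<Sum>i<4. complex_of_real (\<Gamma> i * a i) * cnj (z i)) = 0"
    using arg_cong[OF sum_az, of cnj] by simp
  have s2: "(\<Sum>i<4. complex_of_real (\<Gamma> i) * cnj (zc i)) = 0"
    using arg_cong[OF sum_centered, of cnj] unfolding zc_def by simp
  have tot: "(\<Sum>i<4. complex_of_real (\<Gamma> i)) = of_real total" by (simp add: total_def)
  have ip: "(\<Sum>i<4. complex_of_real (\<Gamma> i) * g i * cnj (zc i)) = inner_prod zc g"
    unfolding inner_prod_def by (simp add: algebra_simps)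
  have "(\<Sum>i<4. \<Sum>j<4. of_real (\<Gamma> i * \<Gamma> j) * ((zc i - zc j) / (z i - z j) * ((g i - g j) / (z i - z j))))
    = of_real k * (\<Sum>i<4. \<Sum>j<4. of_real (\<Gamma> i) * of_real (\<Gamma> j) * ((g i - g j) * cnj (zc i - zc j)))
     - of_real k * (\<Sum>i<4. \<Sum>j<4. of_real (\<Gamma> i * a i) * of_real (\<Gamma> j * a j) * ((g i - g j) * cnj (z i - z j)))"
    unfolding sum_distrib_left sum_subtractf[symmetric] by (intro sum.cong refl pt) auto
  also have "\<dots> = 2 * (of_real frequency * inner_prod zc g)"
    unfolding double_sum_diff s0 s1 s2 tot ip frequency_def by (simp add: algebra_simps)
  finally show ?thesis unfolding bilin_def zc_def by simp
qed

text \<open>The weights are orthogonal to \<open>1\<close>, \<open>z\<close> and \<open>cnj z\<close> because they are real and barycentric.\<close>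

definition raw_basis :: "nat \<Rightarrow> nat \<Rightarrow> complex" where
  "raw_basis p i = (if p = 0 then 1 else if p = 1 then z i - center
     else if p = 2 then cnj (z i - center) - inner_prod (\<lambda>i. z i - center) (\<lambda>i. cnj (z i - center))
         / inner_prod (\<lambda>i. z i - center) (\<lambda>i. z i - center) * (z i - center)
     else of_real (a i))"

definition square_norm :: "nat \<Rightarrow> real" where
  "square_norm p = (\<Sum>i<4. \<Gamma> i * (cmod (raw_basis p i))\<^sup>2)"

definition basis :: "nat \<Rightarrow> nat \<Rightarrow> complex" where
  "basis p i = raw_basis p i / of_real (sqrt (square_norm p))"

lemma inner_prod_self: "inner_prod f f = of_real (\<Sum>i<4. \<Gamma> i * (cmod (f i))\<^sup>2)"
  unfolding inner_prod_def of_real_sum of_real_mult complex_norm_square by (simp add: mult.commute)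

lemma inner_prod_cnj: "inner_prod g f = cnj (inner_prod f g)"
  unfolding inner_prod_def by (simp add: mult.commute)

lemma inner_prod_diff_right: "inner_prod f (\<lambda>i. g i - c * h i) = inner_prod f g - c * inner_prod f h"
  unfolding inner_prod_def by (simp add: sum_subtractf sum_distrib_left algebra_simps)

lemma weighted_norm_pos:
  assumes "i < 4" "f i \<noteq> 0"
  shows "0 < (\<Sum>i<4. \<Gamma> i * (cmod (f i))\<^sup>2)"
  using assms \<Gamma>_pos by (intro sum_pos2[of _ i]) (auto simp: less_imp_le)

lemma square_norm_pos: "0 < square_norm p"
proof -
  consider "p = 0" | "p = 1" | "p = 2" | "2 < p" by linarith
  then show ?thesis
  proof cases
    case 1 then show ?thesis unfolding square_norm_def by (intro weighted_norm_pos[of 0]) (auto simp: raw_basis_def)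
  next
    case 2
    have "z 0 \<noteq> center \<or> z 1 \<noteq> center" using distinct_points[of 0 1] by auto
    then show ?thesis unfolding square_norm_def using 2
      by (elim disjE; intro weighted_norm_pos[of 0] weighted_norm_pos[of 1]) (auto simp: raw_basis_def)
  next
    case 3
    define \<kappa> where "\<kappa> = inner_prod (\<lambda>i. z i - center) (\<lambda>i. cnj (z i - center)) / inner_prod (\<lambda>i. z i - center) (\<lambda>i. z i - center)"
    have rb: "raw_basis p i = cnj (z i - center) - \<kappa> * (z i - center)" for i
      using 3 by (simp add: raw_basis_def \<kappa>_def)
    have "\<exists>i<4. raw_basis p i \<noteq> 0"
    proof (rule ccontr)
      assume "\<not> ?thesis"
      then have e: "cnj (z i - center) = \<kappa> * (z i - center)" if "i < 4" for i using that unfolding rb by auto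
      \<comment> \<open>If conjugation acted on all differences as one complex factor, the points
        would be collinear.\<close>
      have d: "cnj (z i - z j) = \<kappa> * (z i - z j)" if "i < 4" "j < 4" for i j
      proof -
        have "cnj (z i - z j) = cnj (z i - center) - cnj (z j - center)" by simp
        also have "\<dots> = \<kappa> * (z i - z j)" unfolding e[OF that(1)] e[OF that(2)] by (simp add: algebra_simps)
        finally show ?thesis .
      qed
      have "(z 0 - z 3) * cnj (z 1 - z 3) = cnj (z 0 - z 3) * (z 1 - z 3)"
        using d[of 0 3] d[of 1 3] by (simp only: mult_ac)
      then have "(z 0 - z 3) * cnj (z 1 - z 3) = cnj ((z 0 - z 3) * cnj (z 1 - z 3))"
        by (simp only: complex_cnj_mult complex_cnj_cnj)
      then have "Im ((z 0 - z 3) * cnj (z 1 - z 3)) = 0" by (metis Reals_cnj_iff complex_is_Real_iff)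
      then show False using noncollinear by simp
    qed
    then show ?thesis unfolding square_norm_def using weighted_norm_pos by metis
  next
    case 4
    then show ?thesis unfolding square_norm_def by (intro weighted_norm_pos[of 0]) (auto simp: raw_basis_def a_nz)
  qed
qed

lemma raw_basis_orthogonal:
  assumes "p < 4" "q < 4" "p \<noteq> q"
  shows "inner_prod (raw_basis p) (raw_basis q) = 0"
proof -
  define zc where "zc = (\<lambda>i. z i - center)"
  define \<kappa> where "\<kappa> = inner_prod zc (\<lambda>i. cnj (zc i)) / inner_prod zc zc"
  have rb: "raw_basis 0 = (\<lambda>i. 1)" "raw_basis 1 = zc" "raw_basis 2 = (\<lambda>i. cnj (zc i) - \<kappa> * zc i)" "raw_basis 3 = (\<lambda>i. of_real (a i))"
    by (auto simp: raw_basis_def zc_def \<kappa>_def fun_eq_iff)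
  have s0: "(\<Sum>i<4. of_real (\<Gamma> i) * zc i) = 0" using sum_centered zc_def by simp
  have s0': "(\<Sum>i<4. of_real (\<Gamma> i) * cnj (zc i)) = 0" using arg_cong[OF s0, of cnj] by simp
  have sa: "(\<Sum>i<4. complex_of_real (\<Gamma> i) * of_real (a i)) = 0" using sum_a by (simp flip: of_real_mult of_real_sum)
  have "(\<Sum>i<4. of_real (\<Gamma> i * a i) * zc i) = (\<Sum>i<4. of_real (\<Gamma> i * a i) * z i) - of_real (\<Sum>i<4. \<Gamma> i * a i) * center"
    unfolding zc_def by (simp add: algebra_simps sum_subtractf sum_distrib_left)
  then have saz: "(\<Sum>i<4. of_real (\<Gamma> i * a i) * zc i) = 0" unfolding sum_az sum_a by simp
  then have saz': "(\<Sum>i<4. of_real (\<Gamma> i * a i) * cnj (zc i)) = 0"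
  proof -
    have "(\<Sum>i<4. of_real (\<Gamma> i * a i) * cnj (zc i)) = cnj (\<Sum>i<4. of_real (\<Gamma> i * a i) * zc i)" by simp
    then show ?thesis unfolding saz by simp
  qed
  have zz: "inner_prod zc zc \<noteq> 0"
    using square_norm_pos[of 1] unfolding square_norm_def rb inner_prod_self of_real_eq_0_iff by simp
  have i01: "inner_prod (\<lambda>i. 1) zc = 0" "inner_prod (\<lambda>i. 1) (\<lambda>i. cnj (zc i)) = 0" using s0 s0' by (simp_all add: inner_prod_def)
  have 01: "inner_prod (raw_basis 0) (raw_basis 1) = 0" unfolding rb i01 ..
  have 02: "inner_prod (raw_basis 0) (raw_basis 2) = 0" unfolding rb inner_prod_diff_right i01 by simp
  have 03: "inner_prod (raw_basis 0) (raw_basis 3) = 0" unfolding rb inner_prod_def using sa by simp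
  have 12: "inner_prod (raw_basis 1) (raw_basis 2) = 0" unfolding rb inner_prod_diff_right \<kappa>_def using zz by simp
  have i3: "inner_prod (\<lambda>i. of_real (a i)) zc = 0" "inner_prod (\<lambda>i. of_real (a i)) (\<lambda>i. cnj (zc i)) = 0"
    using saz saz' by (simp_all add: inner_prod_def mult.assoc)
  have 31: "inner_prod (raw_basis 3) (raw_basis 1) = 0" unfolding rb i3 ..
  have 32: "inner_prod (raw_basis 3) (raw_basis 2) = 0" unfolding rb inner_prod_diff_right i3 by simp
  have "p = 0 \<or> p = 1 \<or> p = 2 \<or> p = 3" "q = 0 \<or> q = 1 \<or> q = 2 \<or> q = 3" using assms by arith+
  moreover have "inner_prod f g = 0" if "inner_prod g f = 0" for f g
    using inner_prod_cnj[of f g] that by simp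
  note flip = this
  ultimately show ?thesis
    using assms(3)
    by (elim disjE) (simp_all only: 01 02 03 12 31 32 flip[OF 01] flip[OF 02] flip[OF 03] flip[OF 12] flip[OF 31] flip[OF 32] simp_thms)
qed

lemma inner_prod_scale: "inner_prod (\<lambda>i. f i / of_real c) (\<lambda>i. g i / of_real d) = inner_prod f g / of_real (c * d)"
  unfolding inner_prod_def sum_divide_distrib by (intro sum.cong refl) simp

lemma basis_orthonormal:
  assumes "p < 4" "q < 4"
  shows "inner_prod (basis p) (basis q) = (if p = q then 1 else 0)"
proof -
  have e: "inner_prod (basis p) (basis q) = inner_prod (raw_basis p) (raw_basis q) / of_real (sqrt (square_norm p) * sqrt (square_norm q))"
    unfolding basis_def[abs_def] inner_prod_scale ..
  have s: "sqrt (square_norm p) * sqrt (square_norm p) = square_norm p"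
    using square_norm_pos[of p] by simp
  have n: "inner_prod (raw_basis p) (raw_basis p) / of_real (square_norm p) = 1"
    unfolding inner_prod_self square_norm_def[symmetric] using square_norm_pos[of p] by simp
  show ?thesis
  proof (cases "p = q")
    case True
    show ?thesis using e s n unfolding True by (simp only: if_True simp_thms)
  next
    case False
    then show ?thesis unfolding e raw_basis_orthogonal[OF assms False] by simp
  qed
qed

end

text \<open>Three pairwise independent directions determine a real quadratic form on the plane. The
  form \<open>Re (x * (cnj w)\<^sup>2)\<close> is trace-free, so it is a multiple of |w|^2 only for
  x = 0.\<close>

lemma quadratic_form_determined:
  fixes u0 u1 x :: complex and c :: real
  assumes indep: "Im (u0 * cnj u1) \<noteq> 0"
    and 0: "Re (x * (cnj u0)\<^sup>2) = c * (cmod u0)\<^sup>2" and 1: "Re (x * (cnj u1)\<^sup>2) = c * (cmod u1)\<^sup>2"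
    and 01: "Re (x * (cnj (u0 - u1))\<^sup>2) = c * (cmod (u0 - u1))\<^sup>2"
  shows "x = 0"
proof -
  have nadd: "(cmod (u + w))\<^sup>2 = (cmod u)\<^sup>2 + 2 * Re (u * cnj w) + (cmod w)\<^sup>2"
    "(cmod (u - w))\<^sup>2 = (cmod u)\<^sup>2 - 2 * Re (u * cnj w) + (cmod w)\<^sup>2" for u w
    unfolding cmod_power2 by (simp_all add: algebra_simps power2_eq_square)
  have "x * (cnj (u0 - u1))\<^sup>2 = x * (cnj u0)\<^sup>2 - of_real 2 * (x * (cnj u0 * cnj u1)) + x * (cnj u1)\<^sup>2"
    by (simp add: power2_eq_square algebra_simps)
  moreover have "Re (of_real 2 * w) = 2 * Re w" for w by simp
  ultimately have "Re (x * (cnj (u0 - u1))\<^sup>2) = Re (x * (cnj u0)\<^sup>2) - 2 * Re (x * (cnj u0 * cnj u1)) + Re (x * (cnj u1)\<^sup>2)"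
    by (simp only: minus_complex.sel plus_complex.sel)
  then have cross: "Re (x * (cnj u0 * cnj u1)) = c * Re (u0 * cnj u1)"
    using 01 unfolding nadd 0 1 by (simp only: distrib_left right_diff_distrib)
  have all: "Re (x * (cnj w)\<^sup>2) = c * (cmod w)\<^sup>2" for w
  proof -
    define \<delta> where "\<delta> = Im (u0 * cnj u1)"
    define s where "s = - Im (w * cnj u1)"
    define t where "t = Im (w * cnj u0)"
    have w: "of_real \<delta> * w = of_real (- s) * u0 + of_real (- t) * u1"
      unfolding \<delta>_def s_def t_def by (simp add: complex_eq_iff algebra_simps)
    have "\<delta>\<^sup>2 * Re (x * (cnj w)\<^sup>2) = Re (x * (cnj (of_real \<delta> * w))\<^sup>2)" by (simp add: power_mult_distrib flip: of_real_power)
      (simp add: algebra_simps)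
    also have "x * (cnj (of_real \<delta> * w))\<^sup>2 = of_real (s\<^sup>2) * (x * (cnj u0)\<^sup>2) + of_real (2 * s * t) * (x * (cnj u0 * cnj u1))
       + of_real (t\<^sup>2) * (x * (cnj u1)\<^sup>2)" unfolding w by (simp add: power2_eq_square algebra_simps)
    also have "Re \<dots> = s\<^sup>2 * Re (x * (cnj u0)\<^sup>2) + (2 * s * t) * Re (x * (cnj u0 * cnj u1)) + t\<^sup>2 * Re (x * (cnj u1)\<^sup>2)"
    proof -
      have "Re (of_real p * a + of_real q * b + of_real r * d) = p * Re a + q * Re b + r * Re d" for p q r a b d by simp
      then show ?thesis .
    qed
    also have "\<dots> = c * (s\<^sup>2 * (cmod u0)\<^sup>2 + 2 * s * t * Re (u0 * cnj u1) + t\<^sup>2 * (cmod u1)\<^sup>2)"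
      unfolding 0 1 cross by (simp only: algebra_simps)
    also have "s\<^sup>2 * (cmod u0)\<^sup>2 + 2 * s * t * Re (u0 * cnj u1) + t\<^sup>2 * (cmod u1)\<^sup>2 = (cmod (of_real \<delta> * w))\<^sup>2"
      unfolding w nadd by (simp add: norm_mult power_mult_distrib algebra_simps)
    also have "\<dots> = \<delta>\<^sup>2 * (cmod w)\<^sup>2" by (simp add: norm_mult power_mult_distrib)
    finally show ?thesis using indep unfolding \<delta>_def[symmetric] by simp
  qed
  have "Re x = c" using all[of 1] by simp
  moreover have "- Re x = c" using all[of \<i>] by simp
  moreover have "Re (x * (cnj (1 + \<i>))\<^sup>2) = 2 * Im x" by (simp add: power2_eq_square algebra_simps)
  moreover have "(cmod (1 + \<i>))\<^sup>2 = 2" unfolding cmod_power2 by simp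
  ultimately show ?thesis using all[of "1 + \<i>"] by (simp add: complex_eq_iff)
qed

section \<open>The Hessian in the adapted basis\<close>

context balanced_configuration
begin

definition hess :: "nat \<Rightarrow> nat \<Rightarrow> complex" where "hess p q = bilin (basis p) (basis q)"

lemma bilin_scale: "bilin (\<lambda>i. f i / c) g = bilin f g / c"
  unfolding bilin_def sum_divide_distrib diff_divide_distrib[symmetric] by (intro sum.cong refl) (simp add: field_simps)

lemma hess_0: "hess 0 q = 0" "hess q 0 = 0"
proof -
  have "basis 0 = (\<lambda>i. 1 / of_real (sqrt (square_norm 0)))" by (simp add: basis_def raw_basis_def fun_eq_iff)
  then show "hess 0 q = 0" unfolding hess_def by (simp only: bilin_const)
  then show "hess q 0 = 0" unfolding hess_def by (simp only: bilin_sym)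
qed

lemma hess_1:
  assumes "q < 4" shows "hess 1 q = (if q = 1 then of_real frequency else 0)" "hess q 1 = (if q = 1 then of_real frequency else 0)"
proof -
  define s where "s = complex_of_real (sqrt (square_norm 1))"
  have b: "basis 1 = (\<lambda>i. (z i - center) / s)" by (simp add: basis_def raw_basis_def s_def fun_eq_iff)
  have cs: "cnj s = s" by (simp add: s_def)
  have "inner_prod (basis 1) (basis q) = inner_prod (\<lambda>i. z i - center) (basis q) / s"
    unfolding b inner_prod_def sum_divide_distrib by (intro sum.cong refl) (simp add: cs)
  moreover have "hess 1 q = of_real frequency * inner_prod (\<lambda>i. z i - center) (basis q) / s"
    unfolding hess_def by (subst b) (simp only: bilin_scale bilin_position)
  ultimately show "hess 1 q = (if q = 1 then of_real frequency else 0)" using basis_orthonormal[of 1 q] assms by auto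
  then show "hess q 1 = (if q = 1 then of_real frequency else 0)" unfolding hess_def by (subst bilin_sym)
qed

lemma basis_complete:
  assumes "i < 4" "j < 4"
  shows "(\<Sum>p<4. basis p i * (of_real (\<Gamma> j) * cnj (basis p j))) = (if i = j then 1 else 0)"
proof -
  define Z where "Z = Matrix.mat 4 4 (\<lambda>(i, p). basis p i)"
  define W where "W = Matrix.mat 4 4 (\<lambda>(p, i). of_real (\<Gamma> i) * cnj (basis p i))"
  have c: "Z \<in> carrier_mat 4 4" "W \<in> carrier_mat 4 4" by (simp_all add: Z_def W_def)
  have "W * Z = 1\<^sub>m 4"
  proof (rule eq_matI)
    fix p q assume "p < dim_row (1\<^sub>m 4 :: complex mat)" "q < dim_col (1\<^sub>m 4 :: complex mat)"
    then have pq: "p < 4" "q < 4" by auto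
    then have "(W * Z) $$ (p, q) = inner_prod (basis p) (basis q)"
      unfolding inner_prod_def by (simp add: W_def Z_def scalar_prod_def lessThan_atLeast0 mult.assoc)
    then show "(W * Z) $$ (p, q) = 1\<^sub>m 4 $$ (p, q)" using basis_orthonormal pq by simp
  qed (simp_all add: Z_def W_def)
  then have ZW: "Z * W = 1\<^sub>m 4" using mat_mult_left_right_inverse[OF c(2,1)] by simp
  have "(Z * W) $$ (i, j) = (\<Sum>p<4. basis p i * (of_real (\<Gamma> j) * cnj (basis p j)))"
    using assms by (simp add: W_def Z_def scalar_prod_def lessThan_atLeast0)
  then show ?thesis unfolding ZW using assms by simp
qed

lemma basis_expansion:
  assumes "i < 4"
  shows "f i = (\<Sum>p<4. inner_prod (basis p) f * basis p i)"
proof -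
  have "(\<Sum>p<4. inner_prod (basis p) f * basis p i) = (\<Sum>p<4. \<Sum>j<4. f j * (basis p i * (of_real (\<Gamma> j) * cnj (basis p j))))"
    unfolding inner_prod_def sum_distrib_right by (intro sum.cong refl) (simp only: mult_ac)
  also have "\<dots> = (\<Sum>j<4. f j * (\<Sum>p<4. basis p i * (of_real (\<Gamma> j) * cnj (basis p j))))"
    by (subst sum.swap) (simp only: sum_distrib_left)
  also have "\<dots> = (\<Sum>j<4. f j * (if i = j then 1 else 0))" using assms by (intro sum.cong refl) (simp add: basis_complete)
  also have "\<dots> = f i" using assms by (simp add: if_distrib cong: if_cong)
  finally show ?thesis ..
qed

lemma bilin_cong:
  assumes "\<And>i. i < 4 \<Longrightarrow> f i = f' i" "\<And>i. i < 4 \<Longrightarrow> g i = g' i"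
  shows "bilin f g = bilin f' g'"
  unfolding bilin_def using assms by simp

lemma inner_prod_cong: "(\<And>i. i < 4 \<Longrightarrow> g i = g' i) \<Longrightarrow> inner_prod f g = inner_prod f g'"
  unfolding inner_prod_def by simp

text \<open>Translations contribute nothing; along the position vector dilation is stiff and
  rotation neutral. All negativity therefore sits in the block of basis vectors 2 and 3.\<close>

lemma energy_expansion:
  fixes f
  defines "c \<equiv> \<lambda>p. inner_prod (basis p) f"
  shows "rate_form f - k * (cmod (load f))\<^sup>2 = 2 * frequency * (Re (c 1))\<^sup>2
    + (Re (hess 2 2 * (c 2)\<^sup>2 + 2 * hess 2 3 * c 2 * c 3 + hess 3 3 * (c 3)\<^sup>2) + frequency * ((cmod (c 2))\<^sup>2 + (cmod (c 3))\<^sup>2))"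
proof -
  have "bilin f f = bilin (\<lambda>i. \<Sum>p<4. c p * basis p i) (\<lambda>i. \<Sum>p<4. c p * basis p i)"
    unfolding c_def by (rule bilin_cong) (rule basis_expansion, assumption)+
  also have "\<dots> = (\<Sum>p<4. \<Sum>q<4. c p * c q * hess p q)" unfolding bilin_sum hess_def ..
  also have "\<dots> = of_real frequency * (c 1)\<^sup>2 + (hess 2 2 * (c 2)\<^sup>2 + 2 * hess 2 3 * c 2 * c 3 + hess 3 3 * (c 3)\<^sup>2)"
  proof -
    have "hess 3 2 = hess 2 3" unfolding hess_def by (rule bilin_sym)
    then show ?thesis unfolding sum_lessThan_4
      by (simp add: hess_0 hess_1[of 1, simplified] hess_1[of 2, simplified] hess_1[of 3, simplified] power2_eq_square algebra_simps)
  qed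
  finally have b: "Re (bilin f f) = Re (of_real frequency * (c 1)\<^sup>2) + Re (hess 2 2 * (c 2)\<^sup>2 + 2 * hess 2 3 * c 2 * c 3 + hess 3 3 * (c 3)\<^sup>2)"
    by (simp only: plus_complex.sel)
  have "inner_prod f f = inner_prod f (\<lambda>i. \<Sum>p<4. c p * basis p i)"
    unfolding c_def by (rule inner_prod_cong) (rule basis_expansion)
  also have "\<dots> = (\<Sum>p<4. c p * inner_prod f (basis p))"
    unfolding inner_prod_def sum_distrib_left by (subst sum.swap) (intro sum.cong refl, simp only: mult_ac)
  also have "\<dots> = (\<Sum>p<4. c p * cnj (c p))" unfolding c_def inner_prod_cnj[of f] ..
  also have "\<dots> = of_real (\<Sum>p<4. (cmod (c p))\<^sup>2)" unfolding of_real_sum complex_norm_square ..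
  finally have ff: "inner_prod f f = of_real (\<Sum>p<4. (cmod (c p))\<^sup>2)" .
  have sn0: "square_norm 0 = total" by (simp add: square_norm_def raw_basis_def total_def)
  have "c 0 = (\<Sum>i<4. of_real (\<Gamma> i) * f i) / of_real (sqrt total)"
    unfolding c_def inner_prod_def sum_divide_distrib by (simp add: basis_def raw_basis_def sn0)
  then have c0: "(\<Sum>i<4. of_real (\<Gamma> i) * f i) = of_real (sqrt total) * c 0" using total_pos by simp
  have "(\<Sum>i<4. \<Sum>j<4. complex_of_real (\<Gamma> i) * of_real (\<Gamma> j) * ((f i - f j) * cnj (f i - f j)))
    = 2 * of_real total * inner_prod f f - 2 * ((\<Sum>i<4. of_real (\<Gamma> i) * f i) * cnj (\<Sum>i<4. of_real (\<Gamma> i) * f i))"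
    unfolding double_sum_diff total_def inner_prod_def by (simp add: algebra_simps)
  also have "\<dots> = of_real (2 * total * ((\<Sum>p<4. (cmod (c p))\<^sup>2) - (cmod (c 0))\<^sup>2))"
    unfolding ff complex_norm_square[symmetric] c0 using total_pos
    by (simp add: norm_mult power_mult_distrib algebra_simps flip: of_real_power)
  finally have "complex_of_real (\<Sum>i<4. \<Sum>j<4. \<Gamma> i * \<Gamma> j * (cmod (f i - f j))\<^sup>2) = of_real (2 * total * ((\<Sum>p<4. (cmod (c p))\<^sup>2) - (cmod (c 0))\<^sup>2))"
    unfolding complex_norm_square[symmetric] of_real_sum of_real_mult .
  then have n: "(\<Sum>i<4. \<Sum>j<4. \<Gamma> i * \<Gamma> j * (cmod (f i - f j))\<^sup>2) = 2 * total * ((cmod (c 1))\<^sup>2 + (cmod (c 2))\<^sup>2 + (cmod (c 3))\<^sup>2)"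
    unfolding of_real_eq_iff sum_lessThan_4[of "\<lambda>p. (cmod (c p))\<^sup>2"] by simp
  have r: "(\<Sum>i<4. \<Sum>j<4. \<Gamma> i * \<Gamma> j * Re (((f i - f j) / (z i - z j))\<^sup>2)) = 2 * Re (bilin f f)"
  proof -
    have "2 * bilin f f = (\<Sum>i<4. \<Sum>j<4. of_real (\<Gamma> i * \<Gamma> j) * ((f i - f j) / (z i - z j))\<^sup>2)"
      unfolding bilin_def by (simp add: power2_eq_square)
    moreover have "Re (of_real p * w) = p * Re w" for p w by simp
    ultimately have "Re (2 * bilin f f) = (\<Sum>i<4. \<Sum>j<4. \<Gamma> i * \<Gamma> j * Re (((f i - f j) / (z i - z j))\<^sup>2))"
      by (simp only: Re_sum)
    then show ?thesis by simp
  qed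
  have "2 * rate_form f - 2 * k * (cmod (load f))\<^sup>2 =
    (\<Sum>i<4. \<Sum>j<4. \<Gamma> i * \<Gamma> j * Re (((f i - f j) / (z i - z j))\<^sup>2)) + k * (\<Sum>i<4. \<Sum>j<4. \<Gamma> i * \<Gamma> j * (cmod (f i - f j))\<^sup>2)"
    unfolding second_variation[symmetric] sum_distrib_left sum.distrib[symmetric]
    by (intro sum.cong refl) (simp only: distrib_left mult_ac)
  also have "\<dots> = 2 * Re (bilin f f) + 2 * frequency * ((cmod (c 1))\<^sup>2 + (cmod (c 2))\<^sup>2 + (cmod (c 3))\<^sup>2)"
    unfolding r n frequency_def by (simp only: mult_ac)
  finally have "rate_form f - k * (cmod (load f))\<^sup>2 = Re (bilin f f) + frequency * ((cmod (c 1))\<^sup>2 + (cmod (c 2))\<^sup>2 + (cmod (c 3))\<^sup>2)"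
    by simp
  moreover have "Re (of_real frequency * (c 1)\<^sup>2) + frequency * (cmod (c 1))\<^sup>2 = 2 * frequency * (Re (c 1))\<^sup>2"
    unfolding cmod_power2 by (simp add: power2_eq_square algebra_simps)
  ultimately show ?thesis unfolding b by (simp only: distrib_left)
qed

lemma load_coefficient: "load f = of_real (sqrt (square_norm 3)) * inner_prod (basis 3) f"
proof -
  have "inner_prod (basis 3) f = load f / of_real (sqrt (square_norm 3))"
    unfolding inner_prod_def load_def sum_divide_distrib by (simp add: basis_def raw_basis_def mult.assoc)
  then show ?thesis using square_norm_pos[of 3] by simp
qed

lemma inner_prod_combination:
  assumes "p < 4"
  shows "inner_prod (basis p) (\<lambda>i. x * basis 2 i + y * basis 3 i) = (if p = 2 then x else if p = 3 then y else 0)"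
proof -
  have "inner_prod (basis p) (\<lambda>i. x * basis 2 i + y * basis 3 i) = x * inner_prod (basis p) (basis 2) + y * inner_prod (basis p) (basis 3)"
    unfolding inner_prod_def sum_distrib_left sum.distrib[symmetric] by (intro sum.cong refl) (simp add: algebra_simps)
  then show ?thesis using assms by (simp add: basis_orthonormal)
qed

text \<open>If all rates vanished, \<open>Re (x * (cnj u)\<^sup>2)\<close> would be a fixed multiple
  of |u|^2 on the sides of a nondegenerate triangle, forcing x = 0. Basis vector 2 carries no load,
  so this settles positivity along it.\<close>

lemma shear_stiff:
  assumes "x \<noteq> 0"
  shows "0 < rate_form (\<lambda>i. x * basis 2 i)"
proof -
  define \<kappa> where "\<kappa> = inner_prod (\<lambda>i. z i - center) (\<lambda>i. cnj (z i - center)) / inner_prod (\<lambda>i. z i - center) (\<lambda>i. z i - center)"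
  define s where "s = sqrt (square_norm 2)"
  have s: "s \<noteq> 0" using square_norm_pos[of 2] by (simp add: s_def)
  have b: "basis 2 i = (cnj (z i - center) - \<kappa> * (z i - center)) / of_real s" for i
    by (simp add: basis_def raw_basis_def \<kappa>_def s_def)
  have "\<exists>i<4. \<exists>j<4. rate (\<lambda>i. x * basis 2 i) i j \<noteq> 0"
  proof (rule ccontr)
    assume no: "\<not> ?thesis"
    have q: "Re (x * (cnj (z i - z j))\<^sup>2) = Re (x * \<kappa>) * (cmod (z i - z j))\<^sup>2" if "i < 4" "j < 4" for i j
    proof (cases "i = j")
      case False
      define u where "u = z i - z j"
      have u: "u \<noteq> 0" using distinct_points that False u_def by simp
      have "(x * basis 2 i - x * basis 2 j) / u = (x * cnj u / u - x * \<kappa>) / of_real s"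
        unfolding b using u s unfolding u_def by (simp add: field_simps)
      then have "rate (\<lambda>i. x * basis 2 i) i j = Re (x * cnj u / u - x * \<kappa>) / s"
        unfolding rate_def u_def[symmetric] by (simp only: Re_divide_of_real)
      then have "Re (x * cnj u / u) = Re (x * \<kappa>)" using no that s by simp
      moreover have "x * (cnj u)\<^sup>2 = of_real ((cmod u)\<^sup>2) * (x * cnj u / u)"
        unfolding complex_norm_square using u by (simp add: power2_eq_square)
      moreover have "Re (of_real p * w) = p * Re w" for p w by simp
      ultimately show ?thesis unfolding u_def[symmetric] by (metis mult.commute)
    qed simp
    have "(z 0 - z 3) - (z 1 - z 3) = z 0 - z 1" by simp
    then have "x = 0"
      using quadratic_form_determined[OF noncollinear q[of 0 3] q[of 1 3]] q[of 0 1] by simp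
    then show False using assms by simp
  qed
  then obtain i j where ij: "i < 4" "j < 4" "rate (\<lambda>i. x * basis 2 i) i j \<noteq> 0" by blast
  have nn: "0 \<le> \<Gamma> i * \<Gamma> j * (rate (\<lambda>i. x * basis 2 i) i j)\<^sup>2" if "i < 4" "j < 4" for i j
    using \<Gamma>_pos that by (simp add: less_imp_le)
  have "0 < (\<Sum>j<4. \<Gamma> i * \<Gamma> j * (rate (\<lambda>i. x * basis 2 i) i j)\<^sup>2)"
    using ij nn \<Gamma>_pos by (intro sum_pos2[of _ j]) auto
  then show ?thesis unfolding rate_form_def
    by (rule sum_pos2[rotated 2]) (use ij nn in \<open>auto intro!: sum_nonneg\<close>)
qed

end

lemma (in two_pair_configuration) resolvent_inequality:
  "frequency^4 - frequency\<^sup>2 * ((cmod (hess 2 2))\<^sup>2 + 2 * (cmod (hess 2 3))\<^sup>2 + (cmod (hess 3 3))\<^sup>2)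
    + (cmod (hess 2 2 * hess 3 3 - (hess 2 3)\<^sup>2))\<^sup>2 < 0"
proof -
  define \<phi> where "\<phi> x y = Re (hess 2 2 * x\<^sup>2 + 2 * hess 2 3 * x * y + hess 3 3 * y\<^sup>2) + frequency * ((cmod x)\<^sup>2 + (cmod y)\<^sup>2)" for x y
  have e: "rate_form (\<lambda>i. x * basis 2 i + y * basis 3 i) - k * (cmod (load (\<lambda>i. x * basis 2 i + y * basis 3 i)))\<^sup>2 = \<phi> x y" for x y
    unfolding energy_expansion \<phi>_def by (simp add: inner_prod_combination)
  have l: "load (\<lambda>i. x * basis 2 i + y * basis 3 i) = of_real (sqrt (square_norm 3)) * y" for x y
    unfolding load_coefficient by (simp add: inner_prod_combination)
  have pos: "0 < \<phi> x 0" if "x \<noteq> 0" for x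
    using e[of x 0] l[of x 0] shear_stiff[OF that] by simp
  obtain v where v: "(\<Sum>i<4. \<Gamma> i * v i) = 0" "tension_form v < 4 * k * (cmod (moment v))\<^sup>2" using saddle_weights(1) by blast
  \<comment> \<open>The load sees only the coefficient of basis vector 3, so a single stiff load
    gives positivity for every \<open>x\<close>.\<close>
  define y0 where "y0 = moment v / of_real (sqrt (square_norm 3))"
  have pos': "0 < \<phi> x y0" for x
  proof -
    have "load (\<lambda>i. x * basis 2 i + y0 * basis 3 i) = moment v"
      unfolding l y0_def using square_norm_pos[of 3] by simp
    from stiff_direction[OF v this] show ?thesis using e[of x y0] by simp
  qed
  obtain w where w: "(\<Sum>i<4. \<Gamma> i * w i) = 0" "4 * k * (cmod (moment w))\<^sup>2 < tension_form w"
      "(\<Sum>i<4. \<Sum>j<4. (\<Gamma> i * a i) * (\<Gamma> j * a j) * ((cmod (z i - z j))\<^sup>2 * tension w i j)) = 0"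
    using saddle_weights(2) by blast
  obtain f where f: "rate_form f < k * (cmod (load f))\<^sup>2" using soft_direction[OF w] by blast
  have neg: "\<phi> (inner_prod (basis 2) f) (inner_prod (basis 3) f) < 0"
  proof -
    have "0 \<le> 2 * frequency * (Re (inner_prod (basis 1) f))\<^sup>2" using frequency_pos by simp
    then show ?thesis using energy_expansion[of f] f unfolding \<phi>_def by linarith
  qed
  show ?thesis using resolvent_negative[OF frequency_pos pos[unfolded \<phi>_def] neg[unfolded \<phi>_def] pos'[unfolded \<phi>_def]] .
qed

section \<open>Characteristic polynomials\<close>

lemma det_mat_2:
  fixes f :: "nat \<times> nat \<Rightarrow> 'a :: idom"
  shows "det (Matrix.mat 2 2 f) = f (0, 0) * f (1, 1) - f (0, 1) * f (1, 0)"
proof -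
  let ?m = "\<lambda>a. Matrix.mat 1 1 (\<lambda>_. a)"
  have "Matrix.mat 2 2 f = four_block_mat (?m (f (0, 0))) (?m (f (0, 1))) (?m (f (1, 0))) (?m (f (1, 1)))"
    by (rule eq_matI) (auto simp: numeral_2_eq_2 less_Suc_eq)
  moreover have "det (four_block_mat (?m (f (0, 0))) (?m (f (0, 1))) (?m (f (1, 0))) (?m (f (1, 1))))
    = det (?m (f (0, 0)) * ?m (f (1, 1)) - ?m (f (0, 1)) * ?m (f (1, 0)))"
    by (rule det_four_block_mat[of _ 1]) (auto intro!: eq_matI simp: scalar_prod_def mult.commute)
  moreover have "\<dots> = f (0, 0) * f (1, 1) - f (0, 1) * f (1, 0)"
    by (subst det_single) (auto simp: scalar_prod_def)
  ultimately show ?thesis by simp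
qed

text \<open>The flow v' = - \<i> (\<omega> v + cnj (S v)), written for v and its conjugate as
  independent variables.\<close>

definition rotating_matrix :: "nat \<Rightarrow> real \<Rightarrow> complex mat \<Rightarrow> complex mat" where
  "rotating_matrix n \<omega> S = four_block_mat ((- (\<i> * of_real \<omega>)) \<cdot>\<^sub>m 1\<^sub>m n) ((- \<i>) \<cdot>\<^sub>m map_mat cnj S) (\<i> \<cdot>\<^sub>m S) ((\<i> * of_real \<omega>) \<cdot>\<^sub>m 1\<^sub>m n)"

text \<open>The lower two blocks of x - R commute because one is scalar, so the determinant reduces
  to that of an n by n matrix in which x occurs only through x^2 + \<omega>^2.\<close>

lemma poly_char_poly_rotating:
  assumes S: "S \<in> carrier_mat n n"
  shows "poly (char_poly (rotating_matrix n \<omega> S)) x = poly (char_poly (map_mat cnj S * S)) (x\<^sup>2 + of_real (\<omega>\<^sup>2))"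
proof -
  let ?c = "map_mat cnj S" and ?w = "\<i> * complex_of_real \<omega>"
  have c: "?c \<in> carrier_mat n n" using S by simp
  have R: "rotating_matrix n \<omega> S \<in> carrier_mat (n + n) (n + n)" unfolding rotating_matrix_def using S by simp
  have eq: "- char_matrix (rotating_matrix n \<omega> S) x = four_block_mat ((x + ?w) \<cdot>\<^sub>m 1\<^sub>m n) (\<i> \<cdot>\<^sub>m ?c) ((- \<i>) \<cdot>\<^sub>m S) ((x - ?w) \<cdot>\<^sub>m 1\<^sub>m n)"
    by (rule eq_matI) (use S in \<open>auto simp: rotating_matrix_def char_matrix_def\<close>)
  have "det (- char_matrix (rotating_matrix n \<omega> S) x) = det (((x + ?w) \<cdot>\<^sub>m 1\<^sub>m n) * ((x - ?w) \<cdot>\<^sub>m 1\<^sub>m n) - (\<i> \<cdot>\<^sub>m ?c) * ((- \<i>) \<cdot>\<^sub>m S))"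
    unfolding eq using S c by (intro det_four_block_mat) auto
  also have "((x + ?w) \<cdot>\<^sub>m 1\<^sub>m n) * ((x - ?w) \<cdot>\<^sub>m 1\<^sub>m n) - (\<i> \<cdot>\<^sub>m ?c) * ((- \<i>) \<cdot>\<^sub>m S) = - char_matrix (?c * S) (x\<^sup>2 + of_real (\<omega>\<^sup>2))"
  proof (rule eq_matI)
    fix i j assume "i < dim_row (- char_matrix (?c * S) (x\<^sup>2 + of_real (\<omega>\<^sup>2)))" "j < dim_col (- char_matrix (?c * S) (x\<^sup>2 + of_real (\<omega>\<^sup>2)))"
    then have ij: "i < n" "j < n" using S by (auto simp: char_matrix_def)
    have p1: "((x + ?w) \<cdot>\<^sub>m 1\<^sub>m n) * ((x - ?w) \<cdot>\<^sub>m 1\<^sub>m n) = ((x + ?w) * (x - ?w)) \<cdot>\<^sub>m 1\<^sub>m n"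
      by (rule eq_matI) auto
    have p2: "(\<i> \<cdot>\<^sub>m ?c) * ((- \<i>) \<cdot>\<^sub>m S) = ?c * S"
      using S c by (intro eq_matI) (auto simp: scalar_prod_def algebra_simps intro!: sum.cong)
    have "(x + ?w) * (x - ?w) = x\<^sup>2 + of_real (\<omega>\<^sup>2)" by (simp add: power2_eq_square algebra_simps)
    then show "(((x + ?w) \<cdot>\<^sub>m 1\<^sub>m n) * ((x - ?w) \<cdot>\<^sub>m 1\<^sub>m n) - (\<i> \<cdot>\<^sub>m ?c) * ((- \<i>) \<cdot>\<^sub>m S)) $$ (i, j)
      = (- char_matrix (?c * S) (x\<^sup>2 + of_real (\<omega>\<^sup>2))) $$ (i, j)"
      unfolding p1 p2 using S c ij by (auto simp: char_matrix_def)
  qed (use S in \<open>auto simp: char_matrix_def\<close>)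
  finally show ?thesis using char_poly_matrix[OF R] char_poly_matrix[OF mult_carrier_mat[OF c S]] by simp
qed

lemma sum_lessThan_double: "(\<Sum>l<2 * n. g l) = (\<Sum>j<n. g (2 * j) + g (2 * j + 1))" for g :: "nat \<Rightarrow> 'a :: comm_monoid_add"
  by (induction n) (simp_all add: algebra_simps)

lemma sum_lessThan_add: "(\<Sum>l<n + m. g l) = (\<Sum>j<n. g j) + (\<Sum>j<m. g (n + j))" for g :: "nat \<Rightarrow> 'a :: comm_monoid_add"
  by (induction m) (simp_all add: algebra_simps)

text \<open>In the coordinates \<open>v = x + \<i> y\<close> and \<open>u = x - \<i> y\<close>, which become independent after
  complexification, the interleaved real matrix turns into \<^term>\<open>rotating_matrix\<close>.\<close>

lemma char_poly_interleaved:
  assumes B: "B \<in> carrier_mat (2 * n) (2 * n)" and S: "S \<in> carrier_mat n n"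
    and ent: "\<And>i j. i < n \<Longrightarrow> j < n \<Longrightarrow> B $$ (2 * i, 2 * j) = - Im (S $$ (i, j))"
      "\<And>i j. i < n \<Longrightarrow> j < n \<Longrightarrow> B $$ (2 * i, 2 * j + 1) = - Re (S $$ (i, j)) + (if i = j then \<omega> else 0)"
      "\<And>i j. i < n \<Longrightarrow> j < n \<Longrightarrow> B $$ (2 * i + 1, 2 * j) = - Re (S $$ (i, j)) - (if i = j then \<omega> else 0)"
      "\<And>i j. i < n \<Longrightarrow> j < n \<Longrightarrow> B $$ (2 * i + 1, 2 * j + 1) = Im (S $$ (i, j))"
  shows "char_poly (map_mat complex_of_real B) = char_poly (rotating_matrix n \<omega> S)"
proof -
  define C where "C = map_mat complex_of_real B"
  define N where "N = rotating_matrix n \<omega> S"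
  define P where "P = Matrix.mat (2 * n) (2 * n) (\<lambda>(l, q). if l div 2 = (if q < n then q else q - n)
     then (if even l then 1 else if q < n then - \<i> else \<i>) else 0)"
  define R where "R = Matrix.mat (2 * n) (2 * n) (\<lambda>(r, l). if l div 2 = (if r < n then r else r - n)
     then (if even l then 1 / 2 else if r < n then \<i> / 2 else - \<i> / 2) else 0)"
  have car: "C \<in> carrier_mat (2 * n) (2 * n)" "N \<in> carrier_mat (2 * n) (2 * n)" "P \<in> carrier_mat (2 * n) (2 * n)" "R \<in> carrier_mat (2 * n) (2 * n)"
    using B S by (auto simp: C_def N_def P_def R_def rotating_matrix_def)
  have mult: "(X * Y) $$ (k, q) = (\<Sum>l<2 * n. X $$ (k, l) * Y $$ (l, q))"
    if "X \<in> carrier_mat (2 * n) (2 * n)" "Y \<in> carrier_mat (2 * n) (2 * n)" "k < 2 * n" "q < 2 * n" for X Y :: "complex mat" and k q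
    using that by (simp add: scalar_prod_def lessThan_atLeast0)
  have col: "(\<Sum>l<2 * n. g l * P $$ (l, q)) = (if q < n then g (2 * q) - \<i> * g (2 * q + 1) else g (2 * (q - n)) + \<i> * g (2 * (q - n) + 1))"
    if "q < 2 * n" for g q
  proof -
    have "(\<Sum>l<2 * n. g l * P $$ (l, q)) = (\<Sum>j<n. if j = (if q < n then q else q - n)
       then g (2 * j) + (if q < n then - \<i> else \<i>) * g (2 * j + 1) else 0)"
      unfolding sum_lessThan_double using that by (intro sum.cong refl) (auto simp: P_def)
    also have "\<dots> = (if q < n then g (2 * q) - \<i> * g (2 * q + 1) else g (2 * (q - n)) + \<i> * g (2 * (q - n) + 1))"
      using that by (auto simp: sum.delta)
    finally show ?thesis .
  qed
  have RP: "R * P = 1\<^sub>m (2 * n)"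
  proof (rule eq_matI)
    fix r q assume "r < dim_row (1\<^sub>m (2 * n) :: complex mat)" "q < dim_col (1\<^sub>m (2 * n) :: complex mat)"
    then have rq: "r < 2 * n" "q < 2 * n" by auto
    show "(R * P) $$ (r, q) = 1\<^sub>m (2 * n) $$ (r, q)"
      unfolding mult[OF car(4,3) rq] col[OF rq(2)] using rq by (auto simp: R_def)
  qed (use car in auto)
  then have PR: "P * R = 1\<^sub>m (2 * n)" using mat_mult_left_right_inverse[OF car(4,3)] by simp
  have CP: "C * P = P * N"
  proof (rule eq_matI)
    fix k q assume "k < dim_row (P * N)" "q < dim_col (P * N)"
    then have kq: "k < 2 * n" "q < 2 * n" using car by auto
    define i where "i = k div 2"
    have i: "i < n" using kq i_def by auto
    have k: "k = 2 * i \<or> k = 2 * i + 1" unfolding i_def by presburger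
    have row: "(\<Sum>r<2 * n. P $$ (k, r) * N $$ (r, q)) = (if even k then N $$ (i, q) + N $$ (n + i, q) else \<i> * (N $$ (n + i, q) - N $$ (i, q)))"
    proof -
      have "(\<Sum>r<2 * n. P $$ (k, r) * N $$ (r, q)) = (\<Sum>j<n. P $$ (k, j) * N $$ (j, q)) + (\<Sum>j<n. P $$ (k, n + j) * N $$ (n + j, q))"
        unfolding mult_2 sum_lessThan_add ..
      also have "(\<Sum>j<n. P $$ (k, j) * N $$ (j, q)) = (\<Sum>j<n. if j = i then (if even k then 1 else - \<i>) * N $$ (j, q) else 0)"
        using kq by (intro sum.cong refl) (auto simp: P_def i_def)
      also have "(\<Sum>j<n. P $$ (k, n + j) * N $$ (n + j, q)) = (\<Sum>j<n. if j = i then (if even k then 1 else \<i>) * N $$ (n + j, q) else 0)"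
        using kq by (intro sum.cong refl) (auto simp: P_def i_def)
      finally show ?thesis using i by (auto simp: sum.delta algebra_simps)
    qed
    define j where "j = (if q < n then q else q - n)"
    have j: "j < n" using kq j_def by auto
    have Ce: "C $$ (2 * i, 2 * j) = - of_real (Im (S $$ (i, j)))"
      "C $$ (2 * i, 2 * j + 1) = - of_real (Re (S $$ (i, j))) + (if i = j then of_real \<omega> else 0)"
      "C $$ (2 * i + 1, 2 * j) = - of_real (Re (S $$ (i, j))) - (if i = j then of_real \<omega> else 0)"
      "C $$ (2 * i + 1, 2 * j + 1) = of_real (Im (S $$ (i, j)))"
      using ent[OF i j] B i j by (auto simp: C_def)
    have Ne: "N $$ (i, q) = (if q < n then if i = j then - (\<i> * of_real \<omega>) else 0 else - \<i> * cnj (S $$ (i, j)))"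
      "N $$ (n + i, q) = (if q < n then \<i> * S $$ (i, j) else if i = j then \<i> * of_real \<omega> else 0)"
      using S i j kq by (auto simp: N_def rotating_matrix_def j_def)
    have colC: "(\<Sum>l<2 * n. C $$ (k, l) * P $$ (l, q)) = C $$ (k, 2 * j) + (if q < n then - \<i> else \<i>) * C $$ (k, 2 * j + 1)"
      unfolding col[OF kq(2)] j_def by auto
    show "(C * P) $$ (k, q) = (P * N) $$ (k, q)"
      unfolding mult[OF car(1,3) kq] mult[OF car(3,2) kq] row colC
    proof (cases "even k")
      case True
      then have ke: "k = 2 * i" using k by auto
      show "C $$ (k, 2 * j) + (if q < n then - \<i> else \<i>) * C $$ (k, 2 * j + 1) = (if even k then N $$ (i, q) + N $$ (n + i, q) else \<i> * (N $$ (n + i, q) - N $$ (i, q)))"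
        unfolding ke Ce Ne by (auto simp: complex_eq_iff)
    next
      case False
      then have ke: "k = 2 * i + 1" using k by auto
      show "C $$ (k, 2 * j) + (if q < n then - \<i> else \<i>) * C $$ (k, 2 * j + 1) = (if even k then N $$ (i, q) + N $$ (n + i, q) else \<i> * (N $$ (n + i, q) - N $$ (i, q)))"
        unfolding ke Ce Ne by (auto simp: complex_eq_iff)
    qed
  qed (use car in auto)
  have "C = C * (P * R)" unfolding PR using car by simp
  also have "\<dots> = P * N * R" using car CP by (metis assoc_mult_mat)
  finally have "similar_mat C N" using car RP PR by (intro similar_matI[of _ _ P R "2 * n"]) auto
  then show ?thesis unfolding C_def N_def by (rule char_poly_similar)
qed

lemma uminus_char_matrix_index:
  assumes "A \<in> carrier_mat n n" "i < n" "j < n"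
  shows "(- char_matrix A u) $$ (i, j) = (if i = j then u else 0) - A $$ (i, j)"
  using assms by (auto simp: char_matrix_def)

lemma poly_char_poly_block:
  assumes h: "h 0 0 = 0" "h 0 1 = 0" "h 0 2 = 0" "h 0 3 = 0" "h 1 0 = 0" "h 2 0 = 0" "h 3 0 = 0"
    "h 1 1 = complex_of_real \<omega>" "h 1 2 = 0" "h 1 3 = 0" "h 2 1 = 0" "h 3 1 = 0" "h 3 2 = h 2 3"
    and Y: "Y = Matrix.mat 4 4 (\<lambda>(p, q). h p q)"
  shows "poly (char_poly (map_mat cnj Y * Y)) u = u * (u - of_real (\<omega>\<^sup>2)) *
    (u\<^sup>2 - of_real ((cmod (h 2 2))\<^sup>2 + 2 * (cmod (h 2 3))\<^sup>2 + (cmod (h 3 3))\<^sup>2) * u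
      + of_real ((cmod (h 2 2 * h 3 3 - (h 2 3)\<^sup>2))\<^sup>2))"
proof -
  let ?W = "map_mat cnj Y * Y"
  have W: "?W \<in> carrier_mat 4 4" by (rule mult_carrier_mat[of _ 4 4]) (simp_all add: Y)
  have ent: "?W $$ (p, q) = (cnj (h p 0) * h 0 q + cnj (h p 1) * h 1 q + cnj (h p 2) * h 2 q + cnj (h p 3) * h 3 q)"
    if "p < 4" "q < 4" for p q
    using that by (simp add: Y scalar_prod_def numeral_eq_Suc)
  define A1 where "A1 = Matrix.mat 2 2 (\<lambda>(p, q). if p = q then (if p = 0 then u else u - of_real (\<omega>\<^sup>2)) else 0)"
  define A4 where "A4 = Matrix.mat 2 2 (\<lambda>(p, q). (if p = q then u else 0) - (cnj (h (p + 2) 2) * h 2 (q + 2) + cnj (h (p + 2) 3) * h 3 (q + 2)))"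
  have "- char_matrix ?W u = four_block_mat A1 (0\<^sub>m 2 2) (0\<^sub>m 2 2) A4"
  proof (rule eq_matI)
    fix p q assume "p < dim_row (four_block_mat A1 (0\<^sub>m 2 2) (0\<^sub>m 2 2) A4)" "q < dim_col (four_block_mat A1 (0\<^sub>m 2 2) (0\<^sub>m 2 2) A4)"
    then have pq: "p < 4" "q < 4" by (auto simp: A1_def A4_def)
    have l: "(- char_matrix ?W u) $$ (p, q) = (if p = q then u else 0) - (cnj (h p 0) * h 0 q + cnj (h p 1) * h 1 q + cnj (h p 2) * h 2 q + cnj (h p 3) * h 3 q)"
      unfolding uminus_char_matrix_index[OF W pq] ent[OF pq] ..
    have c: "p = 0 \<or> p = 1 \<or> p = 2 \<or> p = 3" "q = 0 \<or> q = 1 \<or> q = 2 \<or> q = 3" using pq by arith+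
    show "(- char_matrix ?W u) $$ (p, q) = four_block_mat A1 (0\<^sub>m 2 2) (0\<^sub>m 2 2) A4 $$ (p, q)"
      unfolding l using c by (elim disjE) (simp_all add: A1_def A4_def h h(1-13)[unfolded One_nat_def] power2_eq_square numeral_2_eq_2[symmetric] numeral_3_eq_3[symmetric])
  qed (use W in \<open>auto simp: A1_def A4_def char_matrix_def\<close>)
  then have "poly (char_poly ?W) u = det A1 * det A4"
    unfolding char_poly_matrix[OF W] by (simp add: det_four_block_mat_lower_left_zero[of _ 2 _ 2] A1_def A4_def)
  also have "det A1 = u * (u - of_real (\<omega>\<^sup>2))" unfolding A1_def det_mat_2 by simp
  also have "det A4 = u\<^sup>2 - of_real ((cmod (h 2 2))\<^sup>2 + 2 * (cmod (h 2 3))\<^sup>2 + (cmod (h 3 3))\<^sup>2) * u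
      + of_real ((cmod (h 2 2 * h 3 3 - (h 2 3)\<^sup>2))\<^sup>2)"
  proof -
    have "det A4 = (u - (cnj (h 2 2) * h 2 2 + cnj (h 2 3) * h 2 3)) * (u - (cnj (h 2 3) * h 2 3 + cnj (h 3 3) * h 3 3))
       - (cnj (h 2 2) * h 2 3 + cnj (h 2 3) * h 3 3) * (cnj (h 2 3) * h 2 2 + cnj (h 3 3) * h 2 3)"
      unfolding A4_def det_mat_2 by (simp add: h(13) numeral_2_eq_2[symmetric] numeral_3_eq_3[symmetric]) (simp add: algebra_simps)
    then show ?thesis unfolding of_real_add of_real_mult complex_norm_square by (simp add: power2_eq_square algebra_simps)
  qed
  finally show ?thesis .
qed

section \<open>The coupling matrix and the complete spectrum\<close>

context balanced_configuration
begin

definition unit_vec_fun :: "nat \<Rightarrow> nat \<Rightarrow> complex" where "unit_vec_fun j i = (if i = j then 1 else 0)"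

text \<open>The matrix S of the overview: the inverse circulations times the Hessian, in complex
  notation.\<close>

definition coupling :: "complex mat" where
  "coupling = Matrix.mat 4 4 (\<lambda>(i, j). bilin (unit_vec_fun i) (unit_vec_fun j) / of_real (\<Gamma> i))"

lemma bilin_unit_expansion:
  "bilin f g = (\<Sum>i<4. \<Sum>j<4. f i * g j * bilin (unit_vec_fun i) (unit_vec_fun j))"
proof -
  have e: "h i = (\<Sum>j<4. h j * unit_vec_fun j i)" if "i < 4" for h :: "nat \<Rightarrow> complex" and i
    using that by (simp add: unit_vec_fun_def if_distrib cong: if_cong)
  have "bilin f g = bilin (\<lambda>i. \<Sum>j<4. f j * unit_vec_fun j i) (\<lambda>i. \<Sum>j<4. g j * unit_vec_fun j i)"
    by (rule bilin_cong) (rule e, assumption)+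
  then show ?thesis unfolding bilin_sum .
qed

text \<open>An antilinear map changes basis by S Z = cnj Z Y instead of a similarity, hence the
  conjugate on the right.\<close>

lemma coupling_basis:
  assumes i: "i < 4"
  shows "(\<Sum>j<4. coupling $$ (i, j) * basis q j) = (\<Sum>p<4. hess p q * cnj (basis p i))"
proof -
  define g where "g i = (\<Sum>j<4. coupling $$ (i, j) * basis q j)" for i
  have ip: "inner_prod (basis p) (\<lambda>i. cnj (g i)) = cnj (hess p q)" for p
  proof -
    have "inner_prod (basis p) (\<lambda>i. cnj (g i)) = cnj (\<Sum>i<4. of_real (\<Gamma> i) * (basis p i * g i))"
      by (simp add: inner_prod_def)
    also have "(\<Sum>i<4. of_real (\<Gamma> i) * (basis p i * g i)) = (\<Sum>i<4. \<Sum>j<4. basis p i * basis q j * bilin (unit_vec_fun i) (unit_vec_fun j))"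
      unfolding g_def sum_distrib_left
      by (intro sum.cong refl) (use \<Gamma>_pos in \<open>force simp: coupling_def\<close>)
    also have "\<dots> = hess p q" unfolding hess_def bilin_unit_expansion[of "basis p"] ..
    finally show ?thesis .
  qed
  have "cnj (g i) = (\<Sum>p<4. inner_prod (basis p) (\<lambda>i. cnj (g i)) * basis p i)"
    by (rule basis_expansion[OF i])
  then have "g i = cnj (\<Sum>p<4. cnj (hess p q) * basis p i)" unfolding ip by (metis complex_cnj_cnj)
  then show ?thesis unfolding g_def by simp
qed

lemma poly_char_poly_coupling:
  "poly (char_poly (map_mat cnj coupling * coupling)) u = u * (u - of_real (frequency\<^sup>2)) *
    (u\<^sup>2 - of_real ((cmod (hess 2 2))\<^sup>2 + 2 * (cmod (hess 2 3))\<^sup>2 + (cmod (hess 3 3))\<^sup>2) * u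
      + of_real ((cmod (hess 2 2 * hess 3 3 - (hess 2 3)\<^sup>2))\<^sup>2))"
proof -
  define Z where "Z = Matrix.mat 4 4 (\<lambda>(i, p). basis p i)"
  define W where "W = Matrix.mat 4 4 (\<lambda>(p, i). of_real (\<Gamma> i) * cnj (basis p i))"
  define Y where "Y = Matrix.mat 4 4 (\<lambda>(p, q). hess p q)"
  let ?c = "map_mat cnj"
  have car: "Z \<in> carrier_mat 4 4" "W \<in> carrier_mat 4 4" "Y \<in> carrier_mat 4 4" "coupling \<in> carrier_mat 4 4"
    by (simp_all add: Z_def W_def Y_def coupling_def)
  have ZW: "Z * W = 1\<^sub>m 4"
  proof (rule eq_matI)
    fix i j assume "i < dim_row (1\<^sub>m 4 :: complex mat)" "j < dim_col (1\<^sub>m 4 :: complex mat)"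
    then have ij: "i < 4" "j < 4" by auto
    then have "(Z * W) $$ (i, j) = (\<Sum>p<4. basis p i * (of_real (\<Gamma> j) * cnj (basis p j)))"
      by (simp add: W_def Z_def scalar_prod_def lessThan_atLeast0)
    then show "(Z * W) $$ (i, j) = 1\<^sub>m 4 $$ (i, j)" using basis_complete ij by simp
  qed (simp_all add: Z_def W_def)
  have WZ: "W * Z = 1\<^sub>m 4" by (rule mat_mult_left_right_inverse[OF car(1,2) ZW])
  have SZ: "coupling * Z = ?c Z * Y"
  proof (rule eq_matI)
    fix i q assume "i < dim_row (?c Z * Y)" "q < dim_col (?c Z * Y)"
    then have iq: "i < 4" "q < 4" by (auto simp: Z_def Y_def)
    have "(coupling * Z) $$ (i, q) = (\<Sum>j<4. coupling $$ (i, j) * basis q j)"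
      using iq car(4) by (simp add: Z_def scalar_prod_def lessThan_atLeast0)
    also have "\<dots> = (\<Sum>p<4. hess p q * cnj (basis p i))" by (rule coupling_basis[OF iq(1)])
    also have "\<dots> = (?c Z * Y) $$ (i, q)"
      using iq by (simp add: Z_def Y_def scalar_prod_def lessThan_atLeast0 mult.commute)
    finally show "(coupling * Z) $$ (i, q) = (?c Z * Y) $$ (i, q)" .
  qed (auto simp: Z_def Y_def coupling_def)
  have cm: "?c (A * B) = ?c A * ?c B" if "A \<in> carrier_mat 4 4" "B \<in> carrier_mat 4 4" for A B :: "complex mat"
    using that by (intro eq_matI) (auto simp: scalar_prod_def)
  have cc: "?c (?c A) = A" for A :: "complex mat" by (intro eq_matI) auto
  have car': "?c Z \<in> carrier_mat 4 4" "?c Y \<in> carrier_mat 4 4" "?c coupling \<in> carrier_mat 4 4"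
    using car by auto
  have cSZ: "?c coupling * ?c Z = Z * ?c Y"
    using arg_cong[OF SZ, of ?c] cm[OF car(4,1)] cm[OF car'(1) car(3)] cc by simp
  \<comment> \<open>In the product the two conjugations compensate, so this is a genuine
    similarity.\<close>
  have "?c coupling * coupling * Z = ?c coupling * (?c Z * Y)"
    unfolding SZ[symmetric] using car car' by (simp add: assoc_mult_mat[of _ 4 4 _ 4 _ 4])
  also have "\<dots> = (?c coupling * ?c Z) * Y" using car car' by (simp add: assoc_mult_mat[of _ 4 4 _ 4 _ 4])
  also have "\<dots> = Z * (?c Y * Y)" unfolding cSZ using car car' by (simp add: assoc_mult_mat[of _ 4 4 _ 4 _ 4])
  finally have key: "?c coupling * coupling * Z = Z * (?c Y * Y)" .
  have "?c coupling * coupling = (?c coupling * coupling) * (Z * W)" unfolding ZW using car car' by simp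
  also have "\<dots> = (?c coupling * coupling * Z) * W" using car car' by (simp add: assoc_mult_mat[of _ 4 4 _ 4 _ 4])
  finally have "?c coupling * coupling = Z * (?c Y * Y) * W" unfolding key .
  then have "similar_mat (?c coupling * coupling) (?c Y * Y)"
    using car car' ZW WZ by (intro similar_matI[of _ _ Z W 4]) auto
  then have "char_poly (?c coupling * coupling) = char_poly (?c Y * Y)" by (rule char_poly_similar)
  moreover have "hess 3 2 = hess 2 3" unfolding hess_def by (rule bilin_sym)
  moreover have "poly (char_poly (?c Y * Y)) u = u * (u - of_real (frequency\<^sup>2)) *
    (u\<^sup>2 - of_real ((cmod (hess 2 2))\<^sup>2 + 2 * (cmod (hess 2 3))\<^sup>2 + (cmod (hess 3 3))\<^sup>2) * u
      + of_real ((cmod (hess 2 2 * hess 3 3 - (hess 2 3)\<^sup>2))\<^sup>2))"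
    by (rule poly_char_poly_block[where h = hess])
       (use calculation in \<open>simp_all add: Y_def hess_0 hess_1[of 1, simplified] hess_1[of 2, simplified] hess_1[of 3, simplified]\<close>)
  ultimately show ?thesis by simp
qed

end

text \<open>The quadratic factor is negative at \<omega>^2, so its roots satisfy u1 < \<omega>^2 <
  u2. Solving x^2 = u - \<omega>^2 gives a real pair from u2 and an imaginary pair from u1;
  \<open>0 \<le> d\<close> gives u1 \<ge> 0, which is the bound on \<beta>.\<close>

lemma proots_saddle:
  fixes p :: "complex poly" and t d \<omega> :: real
  assumes \<omega>: "0 < \<omega>" and d: "0 \<le> d" and neg: "\<omega>^4 - \<omega>\<^sup>2 * t + d < 0"
    and p: "\<And>x. poly p x = (x\<^sup>2 + of_real (\<omega>\<^sup>2)) * (x\<^sup>2 + of_real (\<omega>\<^sup>2) - of_real (\<omega>\<^sup>2)) *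
     ((x\<^sup>2 + of_real (\<omega>\<^sup>2))\<^sup>2 - of_real t * (x\<^sup>2 + of_real (\<omega>\<^sup>2)) + of_real d)"
  shows "\<exists>\<sigma> \<beta> :: real. \<sigma> \<noteq> 0 \<and> \<beta> \<noteq> 0 \<and> \<bar>\<beta>\<bar> \<le> \<omega> \<and> proots p =
    {# 0, 0, \<i> * of_real \<omega>, - (\<i> * of_real \<omega>) #} +
    {# of_real \<sigma>, - of_real \<sigma>, \<i> * of_real \<beta>, - (\<i> * of_real \<beta>) #}"
proof -
  have "0 < (t - 2 * \<omega>\<^sup>2)\<^sup>2 - 4 * (\<omega>^4 - \<omega>\<^sup>2 * t + d)" using neg by (smt (verit) zero_le_power2)
  also have "\<dots> = t\<^sup>2 - 4 * d" by (simp add: power2_eq_square power4_eq_xxxx algebra_simps)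
  finally have disc: "0 < t\<^sup>2 - 4 * d" .
  define D where "D = sqrt (t\<^sup>2 - 4 * d)"
  have D: "D\<^sup>2 = t\<^sup>2 - 4 * d" "0 < D" using disc by (simp_all add: D_def)
  define u1 where "u1 = (t - D) / 2"
  define u2 where "u2 = (t + D) / 2"
  have su: "u1 + u2 = t" and pu: "u1 * u2 = d"
    using D(1) by (simp_all add: u1_def u2_def field_simps power2_eq_square)
  have "(\<omega>\<^sup>2 - u1) * (\<omega>\<^sup>2 - u2) = \<omega>^4 - \<omega>\<^sup>2 * t + d"
    unfolding su[symmetric] pu[symmetric] by (simp add: power2_eq_square power4_eq_xxxx algebra_simps)
  then have "(\<omega>\<^sup>2 - u1) * (\<omega>\<^sup>2 - u2) < 0" using neg by simp
  moreover have "u1 < u2" using D(2) by (simp add: u1_def u2_def)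
  ultimately have u: "u1 < \<omega>\<^sup>2" "\<omega>\<^sup>2 < u2" by (auto simp: mult_less_0_iff)
  have u10: "0 \<le> u1"
  proof -
    have "0 < u2" using u(2) by (rule le_less_trans[OF zero_le_power2])
    then show ?thesis using pu d by (metis zero_le_mult_iff not_less order_less_le)
  qed
  define \<beta> where "\<beta> = sqrt (\<omega>\<^sup>2 - u1)"
  define \<sigma> where "\<sigma> = sqrt (u2 - \<omega>\<^sup>2)"
  have \<beta>2: "\<beta>\<^sup>2 = \<omega>\<^sup>2 - u1" and \<sigma>2: "\<sigma>\<^sup>2 = u2 - \<omega>\<^sup>2" using u by (simp_all add: \<beta>_def \<sigma>_def)
  have "\<bar>\<beta>\<bar> \<le> \<omega>" using u10 \<omega> unfolding \<beta>_def
    by (simp add: real_sqrt_le_iff real_le_lsqrt u less_imp_le)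
  define L where "L = [0, 0, \<i> * complex_of_real \<omega>, - (\<i> * of_real \<omega>), of_real \<sigma>, - of_real \<sigma>, \<i> * of_real \<beta>, - (\<i> * of_real \<beta>)]"
  have "p = (\<Prod>r\<leftarrow>L. [:- r, 1:])"
  proof (rule poly_eq_poly_eq_iff[THEN iffD1], rule ext)
    fix x
    have i1: "(x - \<i> * of_real \<omega>) * (x + \<i> * of_real \<omega>) = x\<^sup>2 + of_real (\<omega>\<^sup>2)"
      "(x - \<i> * of_real \<beta>) * (x + \<i> * of_real \<beta>) = x\<^sup>2 + of_real (\<omega>\<^sup>2) - of_real u1"
      "(x - of_real \<sigma>) * (x + of_real \<sigma>) = x\<^sup>2 + of_real (\<omega>\<^sup>2) - of_real u2"
      unfolding diff_conv_add_uminus of_real_minus[symmetric] add.assoc of_real_add[symmetric]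
      using arg_cong[OF \<beta>2, of complex_of_real] arg_cong[OF \<sigma>2, of complex_of_real]
      by (simp_all add: power2_eq_square algebra_simps)
    have "poly (\<Prod>r\<leftarrow>L. [:- r, 1:]) x = (x * x) * ((x - \<i> * of_real \<omega>) * (x + \<i> * of_real \<omega>)) * ((x - of_real \<sigma>) * (x + of_real \<sigma>)) * ((x - \<i> * of_real \<beta>) * (x + \<i> * of_real \<beta>))"
      by (simp add: L_def algebra_simps)
    also have "\<dots> = poly p x" unfolding i1 p su[symmetric] pu[symmetric]
      by (simp add: power2_eq_square algebra_simps)
    finally show "poly p x = poly (\<Prod>r\<leftarrow>L. [:- r, 1:]) x" ..
  qed
  moreover have "proots (\<Prod>r\<leftarrow>L. [:- r, 1:]) = mset L" for L :: "complex list"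
  proof (induction L)
    case (Cons r L)
    have "(\<Prod>r\<leftarrow>L. [:- r, 1:]) \<noteq> 0" by (auto simp: prod_list_zero_iff)
    then have "proots (\<Prod>r\<leftarrow>r # L. [:- r, 1:]) = proots [:- r, 1:] + proots (\<Prod>r\<leftarrow>L. [:- r, 1:])"
      unfolding list.map prod_list.Cons by (intro proots_mult) auto
    then show ?case using Cons by simp
  qed simp
  ultimately have "proots p = mset L" by simp
  moreover have "mset L = {# 0, 0, \<i> * of_real \<omega>, - (\<i> * of_real \<omega>) #} +
    {# of_real \<sigma>, - of_real \<sigma>, \<i> * of_real \<beta>, - (\<i> * of_real \<beta>) #}"
    by (simp add: L_def)
  moreover have "\<sigma> \<noteq> 0" "\<beta> \<noteq> 0" using u by (auto simp: \<sigma>_def \<beta>_def)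
  ultimately show ?thesis using \<open>\<bar>\<beta>\<bar> \<le> \<omega>\<close> by metis
qed

lemma (in two_pair_configuration) nontrivial_spectrum:
  assumes B: "B \<in> carrier_mat 8 8"
    and ent: "\<And>i j. i < 4 \<Longrightarrow> j < 4 \<Longrightarrow> B $$ (2 * i, 2 * j) = - Im (coupling $$ (i, j))"
      "\<And>i j. i < 4 \<Longrightarrow> j < 4 \<Longrightarrow> B $$ (2 * i, 2 * j + 1) = - Re (coupling $$ (i, j)) + (if i = j then frequency else 0)"
      "\<And>i j. i < 4 \<Longrightarrow> j < 4 \<Longrightarrow> B $$ (2 * i + 1, 2 * j) = - Re (coupling $$ (i, j)) - (if i = j then frequency else 0)"
      "\<And>i j. i < 4 \<Longrightarrow> j < 4 \<Longrightarrow> B $$ (2 * i + 1, 2 * j + 1) = Im (coupling $$ (i, j))"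
  shows "\<exists>\<sigma> \<beta> :: real. \<sigma> \<noteq> 0 \<and> \<beta> \<noteq> 0 \<and> \<bar>\<beta>\<bar> \<le> frequency \<and> proots (char_poly (map_mat complex_of_real B)) =
    {# 0, 0, \<i> * of_real frequency, - (\<i> * of_real frequency) #} +
    {# of_real \<sigma>, - of_real \<sigma>, \<i> * of_real \<beta>, - (\<i> * of_real \<beta>) #}"
proof (rule proots_saddle[OF frequency_pos _ resolvent_inequality])
  have S: "coupling \<in> carrier_mat 4 4" by (simp add: coupling_def)
  fix x
  have "char_poly (map_mat complex_of_real B) = char_poly (rotating_matrix 4 frequency coupling)"
    using B by (intro char_poly_interleaved S ent) simp_all
  then show "poly (char_poly (map_mat complex_of_real B)) x = (x\<^sup>2 + of_real (frequency\<^sup>2)) * (x\<^sup>2 + of_real (frequency\<^sup>2) - of_real (frequency\<^sup>2)) *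
     ((x\<^sup>2 + of_real (frequency\<^sup>2))\<^sup>2 - of_real ((cmod (hess 2 2))\<^sup>2 + 2 * (cmod (hess 2 3))\<^sup>2 + (cmod (hess 3 3))\<^sup>2) * (x\<^sup>2 + of_real (frequency\<^sup>2))
      + of_real ((cmod (hess 2 2 * hess 3 3 - (hess 2 3)\<^sup>2))\<^sup>2))"
    using poly_char_poly_rotating[OF S] poly_char_poly_coupling by simp
qed simp

section \<open>Concave configurations\<close>

lemma concave_relation:
  assumes "concave z"
  obtains p \<alpha> where "p \<in> set z" "\<not> collinear (set z - {p})" "\<alpha> p < 0" "\<And>v. v \<in> set z - {p} \<Longrightarrow> 0 < \<alpha> v"
    "sum \<alpha> (set z) = (0 :: real)" "(\<Sum>v\<in>set z. \<alpha> v *\<^sub>R v) = 0"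
    "\<And>c. sum c (set z) = 0 \<Longrightarrow> (\<Sum>v\<in>set z. c v *\<^sub>R v) = 0 \<Longrightarrow> \<exists>t. \<forall>v\<in>set z. c v = t * \<alpha> v"
proof -
  from assms obtain p where p: "p \<in> set z" "p \<in> interior (convex hull (set z - {p}))" and z: "length z = 4" "distinct z"
    unfolding concave_def by blast
  define T where "T = set z - {p}"
  have "card T = 3" using z p distinct_card[of z] by (simp add: T_def)
  then obtain a b c where abc: "T = {a, b, c}" "a \<noteq> b" "a \<noteq> c" "b \<noteq> c" by (auto simp: card_3_iff)
  have nc: "\<not> collinear T"
  proof
    assume "collinear T"
    then have "aff_dim (convex hull T) \<le> 1" by (simp add: collinear_aff_dim aff_dim_convex_hull)
    moreover have "aff_dim (convex hull T) = DIM(plane)"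
      using p(2) unfolding T_def[symmetric] by (intro aff_dim_nonempty_interior) auto
    ultimately show False by simp
  qed
  then have indep: "\<not> affine_dependent T" using abc collinear_3_eq_affine_dependent[of a b c] by auto
  have "DIM(plane) = 2" by simp
  from interior_convex_hull_3_minimal[OF nc[unfolded abc] this] p(2)[folded T_def, unfolded abc]
  obtain x y w where xyw: "0 < x" "0 < y" "0 < w" "x + y + w = 1" "x *\<^sub>R a + y *\<^sub>R b + w *\<^sub>R c = p" by auto
  define \<alpha> where "\<alpha> v = (if v = a then x else if v = b then y else if v = c then w else - 1)" for v
  have pT: "p \<notin> T" "finite T" "set z = insert p T" using p by (auto simp: T_def)
  have sT: "sum \<alpha> T = 1" "(\<Sum>v\<in>T. \<alpha> v *\<^sub>R v) = p" and \<alpha>p: "\<alpha> p = - 1"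
    using abc xyw pT(1) by (auto simp: \<alpha>_def)
  have s0: "sum \<alpha> (set z) = 0" "(\<Sum>v\<in>set z. \<alpha> v *\<^sub>R v) = 0"
    using pT sT \<alpha>p by auto
  show thesis
  proof (rule that[OF p(1) nc[unfolded T_def] _ _ s0])
    show "\<alpha> p < 0" using \<alpha>p by simp
    show "0 < \<alpha> v" if "v \<in> set z - {p}" for v
      using that xyw abc unfolding T_def[symmetric] by (auto simp: \<alpha>_def)
    fix d :: "plane \<Rightarrow> real" assume d: "sum d (set z) = 0" "(\<Sum>v\<in>set z. d v *\<^sub>R v) = 0"
    \<comment> \<open>Adding \<open>d p\<close> times the relation clears the coefficient at
      \<open>p\<close>, where \<alpha> is -1; affine independence of the triangle does the
      rest.\<close>
    define U where "U v = d v + d p * \<alpha> v" for v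
    have "sum U T = 0" using d(1) pT sT unfolding U_def by (simp add: sum.distrib flip: sum_distrib_left)
    moreover have "(\<Sum>v\<in>T. U v *\<^sub>R v) = 0"
    proof -
      have "(\<Sum>v\<in>T. U v *\<^sub>R v) = (\<Sum>v\<in>T. d v *\<^sub>R v) + d p *\<^sub>R (\<Sum>v\<in>T. \<alpha> v *\<^sub>R v)"
        unfolding U_def by (simp add: scaleR_left_distrib sum.distrib scaleR_sum_right)
      then show ?thesis using d(2) pT sT by (simp add: add.commute)
    qed
    ultimately have "U v = 0" if "v \<in> T" for v
      using indep that affine_dependent_explicit_finite[OF pT(2)] by blast
    then have "d v = (- d p) * \<alpha> v" if "v \<in> set z" for v
    proof (cases "v = p")
      case True then show ?thesis using \<alpha>p by simp
    next
      case False
      then have "U v = 0" using that pT(3) \<open>\<And>v. v \<in> T \<Longrightarrow> U v = 0\<close> by blast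
      then show ?thesis unfolding U_def by simp
    qed
    then have "\<forall>v\<in>set z. d v = (- d p) * \<alpha> v" by blast
    then show "\<exists>t. \<forall>v\<in>set z. d v = t * \<alpha> v" ..
  qed
qed

lemma reflection_fixed_iff:
  assumes "norm u = 1"
  shows "reflection a u p = p \<longleftrightarrow> p \<in> {a + t *\<^sub>R u |t. True}"
proof
  assume "reflection a u p = p"
  then have "2 *\<^sub>R (p - a) = 2 *\<^sub>R (((p - a) \<bullet> u) *\<^sub>R u)"
    unfolding reflection_def by (simp add: algebra_simps scaleR_2)
  then have "p = a + ((p - a) \<bullet> u) *\<^sub>R u" by (metis (no_types) add_diff_cancel_left' diff_add_cancel scaleR_cancel_left zero_neq_numeral add.commute)
  then show "p \<in> {a + t *\<^sub>R u |t. True}" by blast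
next
  assume "p \<in> {a + t *\<^sub>R u |t. True}"
  then obtain t where p: "p = a + t *\<^sub>R u" by blast
  have "u \<bullet> u = 1" using assms by (simp add: norm_eq_1)
  then show "reflection a u p = p" unfolding reflection_def p by (simp add: algebra_simps scaleR_2[symmetric])
qed

lemma reflection_reflection:
  assumes "norm u = 1"
  shows "reflection a u (reflection a u p) = p"
proof -
  have "u \<bullet> u = 1" using assms by (simp add: norm_eq_1)
  then show ?thesis unfolding reflection_def by (simp add: inner_diff_left inner_add_left algebra_simps)
qed

text \<open>Reflections are affine maps, so they carry affine relations to affine relations.\<close>

lemma reflection_weighted_sum:
  assumes "sum c S = 0" "(\<Sum>v\<in>S. c v *\<^sub>R v) = 0"
  shows "(\<Sum>v\<in>S. c v *\<^sub>R reflection a u v) = 0"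
proof -
  have "c v *\<^sub>R reflection a u v = c v *\<^sub>R (2 *\<^sub>R a - (2 * (a \<bullet> u)) *\<^sub>R u) + (2 * ((c v *\<^sub>R v) \<bullet> u)) *\<^sub>R u - c v *\<^sub>R v" for v
    unfolding reflection_def by (simp add: algebra_simps scaleR_2)
  then have "(\<Sum>v\<in>S. c v *\<^sub>R reflection a u v) = sum c S *\<^sub>R (2 *\<^sub>R a - (2 * (a \<bullet> u)) *\<^sub>R u)
     + (2 * ((\<Sum>v\<in>S. c v *\<^sub>R v) \<bullet> u)) *\<^sub>R u - (\<Sum>v\<in>S. c v *\<^sub>R v)"
    by (simp only: sum.distrib sum_subtractf scaleR_sum_left inner_sum_left sum_distrib_left)
  then show ?thesis unfolding assms by simp
qed

text \<open>A symmetry permutes the points and preserves the signs of the barycentric relation, so it fixes the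
  interior point; as an involution of the triangle it then fixes exactly one vertex.\<close>

lemma concave_kite_or_asymmetric:
  assumes "concave z"
  shows "kite z \<or> asymmetric z"
proof -
  obtain p \<alpha> where p: "p \<in> set z" and nc: "\<not> collinear (set z - {p})" and \<alpha>p: "\<alpha> p < 0"
    and \<alpha>pos: "\<And>v. v \<in> set z - {p} \<Longrightarrow> 0 < \<alpha> v"
    and \<alpha>0: "sum \<alpha> (set z) = (0 :: real)" "(\<Sum>v\<in>set z. \<alpha> v *\<^sub>R v) = 0"
    and uniq: "\<And>c. sum c (set z) = 0 \<Longrightarrow> (\<Sum>v\<in>set z. c v *\<^sub>R v) = 0 \<Longrightarrow> \<exists>t. \<forall>v\<in>set z. c v = t * \<alpha> v"
    using concave_relation[OF assms] by blast
  have z: "length z = 4" "distinct z" using assms by (auto simp: concave_def)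
  have "card (set z - {p}) = 3" using z p distinct_card[of z] by simp
  then obtain a b c where abc: "set z - {p} = {a, b, c}" "a \<noteq> b" "a \<noteq> c" "b \<noteq> c" by (auto simp: card_3_iff)
  have ncz: "\<not> collinear (set z)" using nc collinear_subset[of "set z" "set z - {p}"] by blast
  show ?thesis
  proof (cases "\<exists>L. axis_of_symmetry L z")
    case False
    then show ?thesis using ncz by (simp add: asymmetric_def)
  next
    case True
    then obtain L o' u where L: "L = {o' + t *\<^sub>R u |t. True}" and u: "norm u = 1" and im: "reflection o' u ` set z = set z"
      and ax: "axis_of_symmetry L z"
      unfolding axis_of_symmetry_def by blast
    define r where "r = reflection o' u"
    have rr: "r (r v) = v" for v using reflection_reflection[OF u] by (simp add: r_def)
    have rS: "r v \<in> set z" if "v \<in> set z" for v using im that by (auto simp: r_def)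
    have inj: "inj_on r (set z)" by (rule inj_onI) (metis rr)
    have im': "r ` set z = set z" using im r_def by simp
    have fixL: "r v = v \<longleftrightarrow> v \<in> L" for v unfolding r_def L by (rule reflection_fixed_iff[OF u])
    have "(\<Sum>v\<in>set z. \<alpha> (r v)) = 0" using \<alpha>0(1) sum.reindex[OF inj, of \<alpha>] im' by simp
    moreover have "(\<Sum>v\<in>set z. \<alpha> (r v) *\<^sub>R v) = 0"
    proof -
      have "(\<Sum>v\<in>set z. \<alpha> v *\<^sub>R r v) = 0" unfolding r_def by (rule reflection_weighted_sum[OF \<alpha>0])
      then have "(\<Sum>v\<in>r ` set z. \<alpha> v *\<^sub>R r v) = 0" unfolding im' .
      then show ?thesis unfolding sum.reindex[OF inj] by (simp add: rr)
    qed
    \<comment> \<open>The relation transported by the symmetry is again an affine relation, hence a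
      multiple of \<alpha>.\<close>
    ultimately obtain t where t: "\<And>v. v \<in> set z \<Longrightarrow> \<alpha> (r v) = t * \<alpha> v" using uniq[of "\<lambda>v. \<alpha> (r v)"] by blast
    have in_z: "a \<in> set z" "b \<in> set z" "c \<in> set z" using abc by auto
    have pos: "0 < \<alpha> a" "0 < \<alpha> b" "0 < \<alpha> c" using \<alpha>pos abc by auto
    \<comment> \<open>A nonpositive factor would send two vertices of the triangle to the interior
      point.\<close>
    have "0 < t"
    proof (rule ccontr)
      assume "\<not> 0 < t"
      then have "\<alpha> (r a) \<le> 0" "\<alpha> (r b) \<le> 0" using t[OF in_z(1)] t[OF in_z(2)] pos
        by (simp_all add: mult_nonpos_nonneg)
      then have "r a = p" "r b = p" using rS in_z \<alpha>pos by (meson DiffI empty_iff insert_iff not_less)+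
      then show False using rr[of a] rr[of b] abc(2) by simp
    qed
    then have "\<alpha> (r p) < 0" using t[OF p] \<alpha>p by (simp add: mult_pos_neg)
    then have rp: "r p = p" using rS[OF p] \<alpha>pos by (metis DiffI insert_iff empty_iff not_less_iff_gr_or_eq)
    have rT: "r v \<in> {a, b, c}" if "v \<in> {a, b, c}" for v
    proof -
      have "v \<in> set z" "v \<noteq> p" using that abc by auto
      then have "r v \<in> set z" "r v \<noteq> p" using rS rr rp by metis+
      then show ?thesis using abc(1) by blast
    qed
    have notall: "\<not> (a \<in> L \<and> b \<in> L \<and> c \<in> L)"
    proof
      assume "a \<in> L \<and> b \<in> L \<and> c \<in> L"
      then have "\<forall>v\<in>set z - {p}. \<exists>s. v = o' + s *\<^sub>R u" unfolding abc(1) L by auto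
      then show False using nc unfolding collinear_alt by blast
    qed
    have "r a = a \<and> r b \<noteq> b \<and> r c \<noteq> c \<or> r a \<noteq> a \<and> r b = b \<and> r c \<noteq> c \<or> r a \<noteq> a \<and> r b \<noteq> b \<and> r c = c"
      using rT[of a] rT[of b] rT[of c] rr[of a] rr[of b] rr[of c] notall abc(2-4) unfolding fixL[symmetric]
      by (smt (verit) insert_iff empty_iff)
    then have "L \<inter> {a, b, c} = {a} \<or> L \<inter> {a, b, c} = {b} \<or> L \<inter> {a, b, c} = {c}"
      unfolding fixL by auto
    then have "\<exists>v. L \<inter> {a, b, c} = {v}" by blast
    then obtain v where v: "L \<inter> {a, b, c} = {v}" ..
    have "set z = insert p {a, b, c}" using abc(1) p by blast
    then have "L \<inter> set z = {p, v}" using v rp fixL[of p] by blast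
    moreover have "v \<noteq> p" using v abc(1) by blast
    ultimately have "card (L \<inter> set z) = 2" by simp
    then show ?thesis using ax unfolding kite_def by blast
  qed
qed

section \<open>The Hessian and the stability matrix\<close>

definition cx :: "plane \<Rightarrow> complex" where "cx p = Complex (fst p) (snd p)"

lemma cx_simps [simp]: "Re (cx p) = fst p" "Im (cx p) = snd p"
  by (simp_all add: cx_def)

lemma cx_linear: "cx (p + q) = cx p + cx q" "cx (p - q) = cx p - cx q" "cx (t *\<^sub>R p) = of_real t * cx p" "cx 0 = 0"
  by (simp_all add: complex_eq_iff)

lemma cx_sum: "cx (sum f A) = (\<Sum>i\<in>A. cx (f i))"
  by (induction A rule: infinite_finite_induct) (simp_all add: cx_linear)

lemma cx_eq_iff: "cx p = cx q \<longleftrightarrow> p = q"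
  by (simp add: complex_eq_iff prod_eq_iff)

lemma cmod_cx: "cmod (cx p) = norm p"
  by (simp add: cmod_def norm_prod_def)

section \<open>Derivatives of the logarithmic distance\<close>

lemma DERIV_ln_norm:
  fixes u d :: "'a :: real_inner"
  assumes "u \<noteq> 0"
  shows "((\<lambda>h. ln (norm (u + h *\<^sub>R d))) has_real_derivative (u \<bullet> d) / (norm u)\<^sup>2) (at 0)"
proof -
  have e: "norm (u + h *\<^sub>R d) = sqrt (u \<bullet> u + 2 * h * (u \<bullet> d) + h\<^sup>2 * (d \<bullet> d))" for h
    by (simp add: norm_eq_sqrt_inner inner_add_left inner_add_right inner_commute power2_eq_square algebra_simps)
  have p: "0 < u \<bullet> u" using assms by simp
  have "((\<lambda>h. ln (sqrt (c + 2 * h * a + h\<^sup>2 * b))) has_real_derivative a / c) (at 0)" if "0 < c" for a b c :: real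
    using that by (auto intro!: derivative_eq_intros simp: field_simps)
  from this[OF p] have "((\<lambda>h. ln (sqrt (u \<bullet> u + 2 * h * (u \<bullet> d) + h\<^sup>2 * (d \<bullet> d)))) has_real_derivative (u \<bullet> d) / (u \<bullet> u)) (at 0)" .
  then show ?thesis unfolding e by (simp add: power2_norm_eq_inner)
qed

lemma DERIV_inner_divide_norm:
  fixes u p q :: "'a :: real_inner"
  assumes "u \<noteq> 0"
  shows "((\<lambda>h. ((u + h *\<^sub>R p) \<bullet> q) / (norm (u + h *\<^sub>R p))\<^sup>2) has_real_derivative
    (p \<bullet> q) / (norm u)\<^sup>2 - 2 * (u \<bullet> p) * (u \<bullet> q) / (norm u)^4) (at 0)"
proof -
  have e: "((u + h *\<^sub>R p) \<bullet> q) / (norm (u + h *\<^sub>R p))\<^sup>2 = (u \<bullet> q + h * (p \<bullet> q)) / (u \<bullet> u + 2 * h * (u \<bullet> p) + h\<^sup>2 * (p \<bullet> p))" for h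
    unfolding power2_norm_eq_inner by (simp add: inner_add_left inner_add_right inner_commute power2_eq_square algebra_simps)
  have p: "u \<bullet> u \<noteq> 0" using assms by simp
  have "((\<lambda>h. (u \<bullet> q + h * (p \<bullet> q)) / (u \<bullet> u + 2 * h * (u \<bullet> p) + h\<^sup>2 * (p \<bullet> p))) has_real_derivative
     ((p \<bullet> q) * (u \<bullet> u) - (u \<bullet> q) * (2 * (u \<bullet> p))) / ((u \<bullet> u) * (u \<bullet> u))) (at 0)"
    using p by (auto intro!: derivative_eq_intros)
  moreover have "((p \<bullet> q) * (u \<bullet> u) - (u \<bullet> q) * (2 * (u \<bullet> p))) / ((u \<bullet> u) * (u \<bullet> u)) = (p \<bullet> q) / (norm u)\<^sup>2 - 2 * (u \<bullet> p) * (u \<bullet> q) / (norm u)^4"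
  proof -
    have "(norm u)^4 = (u \<bullet> u) * (u \<bullet> u)" by (simp add: power4_eq_xxxx power2_norm_eq_inner[symmetric] power2_eq_square)
    then show ?thesis using p by (simp add: power2_norm_eq_inner field_simps)
  qed
  ultimately show ?thesis unfolding e by simp
qed

definition direction :: "nat \<Rightarrow> nat \<Rightarrow> plane" where
  "direction k i = (if i = k div 2 then (if even k then (1, 0) else (0, 1)) else 0)"

lemma shift_coordinate_nth:
  assumes "i < length z"
  shows "shift_coordinate k h z ! i = z ! i + h *\<^sub>R direction k i"
  using assms by (cases "i = k div 2") (auto simp: shift_coordinate_def direction_def nth_list_update)

lemma length_shift_coordinate [simp]: "length (shift_coordinate k h z) = length z"
  by (simp add: shift_coordinate_def)

lemma partial_deriv_hamiltonian:
  assumes len: "length z = length \<Gamma>" and "distinct z"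
  shows "partial_deriv l (hamiltonian \<Gamma>) z = - (\<Sum>j<length \<Gamma>. \<Sum>i<j. \<Gamma> ! i * \<Gamma> ! j *
    (((z ! i - z ! j) \<bullet> (direction l i - direction l j)) / (norm (z ! i - z ! j))\<^sup>2))"
proof -
  have ne: "z ! i - z ! j \<noteq> 0" if "i < j" "j < length \<Gamma>" for i j
    using that assms by (simp add: nth_eq_iff_index_eq)
  have eq: "hamiltonian \<Gamma> (shift_coordinate l h z) = - (\<Sum>j<length \<Gamma>. \<Sum>i<j. \<Gamma> ! i * \<Gamma> ! j *
      ln (norm ((z ! i - z ! j) + h *\<^sub>R (direction l i - direction l j))))" for h
    unfolding hamiltonian_def
    by (intro arg_cong[of _ _ uminus] sum.cong refl)
       (simp add: shift_coordinate_nth len dist_norm scaleR_diff_right add_diff_add)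
  show ?thesis
    unfolding partial_deriv_def eq
    by (intro DERIV_imp_deriv DERIV_minus DERIV_sum DERIV_cmult DERIV_ln_norm ne) auto
qed

text \<open>The formula for the first partial derivatives holds at distinct points; differentiating
  it again requires it on a whole neighbourhood.\<close>

lemma eventually_distinct_shift:
  assumes "distinct z"
  shows "\<forall>\<^sub>F h in nhds 0. distinct (shift_coordinate k h z)"
proof -
  have "\<forall>\<^sub>F h in nhds 0. z ! i + h *\<^sub>R direction k i \<noteq> z ! j + h *\<^sub>R direction k j" if "i < length z" "j < length z" "i \<noteq> j" for i j
  proof -
    have "((\<lambda>h. (z ! i + h *\<^sub>R direction k i) - (z ! j + h *\<^sub>R direction k j)) \<longlongrightarrow> (z ! i + 0 *\<^sub>R direction k i) - (z ! j + 0 *\<^sub>R direction k j)) (nhds (0::real))"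
      by (intro tendsto_intros filterlim_ident)
    moreover have "(z ! i + 0 *\<^sub>R direction k i) - (z ! j + 0 *\<^sub>R direction k j) \<noteq> 0"
      using assms that by (simp add: nth_eq_iff_index_eq)
    ultimately have "\<forall>\<^sub>F h in nhds (0::real). (z ! i + h *\<^sub>R direction k i) - (z ! j + h *\<^sub>R direction k j) \<noteq> 0"
      by (rule tendsto_imp_eventually_ne)
    then show ?thesis by simp
  qed
  then have "\<forall>\<^sub>F h in nhds 0. \<forall>i\<in>{..<length z}. \<forall>j\<in>{..<length z}. i \<noteq> j \<longrightarrow> z ! i + h *\<^sub>R direction k i \<noteq> z ! j + h *\<^sub>R direction k j"
    by (intro eventually_ball_finite ballI) auto
  then show ?thesis
    by eventually_elim (auto simp: distinct_conv_nth shift_coordinate_nth)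
qed

definition direction_cx :: "nat \<Rightarrow> nat \<Rightarrow> complex" where
  "direction_cx k i = (if i = k div 2 then (if even k then 1 else \<i>) else 0)"

lemma cx_direction: "cx (direction k i) = direction_cx k i"
  by (simp add: direction_def direction_cx_def complex_eq_iff)

text \<open>ln |u| is locally the real part of the complex logarithm, whose second derivative is - 1
  / u^2.\<close>

lemma second_derivative_complex:
  assumes "u \<noteq> 0"
  shows "(p \<bullet> q) / (norm u)\<^sup>2 - 2 * (u \<bullet> p) * (u \<bullet> q) / (norm u)^4 = - Re (cx p * cx q / (cx u)\<^sup>2)"
proof -
  define n where "n = (norm u)\<^sup>2"
  have "n = fst u * fst u + snd u * snd u" by (simp add: n_def power2_norm_eq_inner inner_prod_def)
  moreover have "n \<noteq> 0" using assms by (simp add: n_def)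
  ultimately have n: "n \<noteq> 0" "n = fst u * fst u + snd u * snd u" by auto
  have n4: "(norm u)^4 = n * n" by (simp add: n_def power4_eq_xxxx power2_eq_square)
  have u: "cx u \<noteq> 0" using assms cx_eq_iff[of u 0] by (simp add: cx_linear)
  have "complex_of_real n = cx u * cnj (cx u)" unfolding n_def cmod_cx[symmetric] complex_norm_square ..
  then have "cx p * cx q / (cx u)\<^sup>2 = cx p * cx q * (cnj (cx u))\<^sup>2 / of_real (n * n)"
    using u by (simp add: power2_eq_square)
  then have "Re (cx p * cx q / (cx u)\<^sup>2) = Re (cx p * cx q * (cnj (cx u))\<^sup>2) / (n * n)"
    by (simp only: Re_divide_of_real)
  also have "Re (cx p * cx q * (cnj (cx u))\<^sup>2) = 2 * (u \<bullet> p) * (u \<bullet> q) - (p \<bullet> q) * n"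
    unfolding n(2) by (simp add: inner_prod_def power2_eq_square algebra_simps)
  finally show ?thesis unfolding n4 n_def[symmetric] using n(1) by (simp add: field_simps)
qed

lemma hessian_complex:
  assumes len: "length z = length \<Gamma>" and d: "distinct z" and kl: "k < 2 * length \<Gamma>" "l < 2 * length \<Gamma>"
  shows "hessian \<Gamma> z $$ (k, l) = (\<Sum>j<length \<Gamma>. \<Sum>i<j. \<Gamma> ! i * \<Gamma> ! j *
    Re ((direction_cx k i - direction_cx k j) * (direction_cx l i - direction_cx l j) / (cx (z ! i) - cx (z ! j))\<^sup>2))"
proof -
  have ne: "z ! i - z ! j \<noteq> 0" if "i < j" "j < length \<Gamma>" for i j
    using that assms by (simp add: nth_eq_iff_index_eq)
  let ?g = "\<lambda>h. - (\<Sum>j<length \<Gamma>. \<Sum>i<j. \<Gamma> ! i * \<Gamma> ! j *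
    ((((z ! i - z ! j) + h *\<^sub>R (direction k i - direction k j)) \<bullet> (direction l i - direction l j)) / (norm ((z ! i - z ! j) + h *\<^sub>R (direction k i - direction k j)))\<^sup>2))"
  have "\<forall>\<^sub>F h in nhds 0. partial_deriv l (hamiltonian \<Gamma>) (shift_coordinate k h z) = ?g h"
    using eventually_distinct_shift[OF d, of k]
  proof eventually_elim
    case (elim h)
    have "partial_deriv l (hamiltonian \<Gamma>) (shift_coordinate k h z) = - (\<Sum>j<length \<Gamma>. \<Sum>i<j. \<Gamma> ! i * \<Gamma> ! j *
      (((shift_coordinate k h z ! i - shift_coordinate k h z ! j) \<bullet> (direction l i - direction l j)) / (norm (shift_coordinate k h z ! i - shift_coordinate k h z ! j))\<^sup>2))"
      using len elim by (intro partial_deriv_hamiltonian) simp_all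
    also have "\<dots> = ?g h"
      by (intro arg_cong[of _ _ uminus] sum.cong refl)
         (simp add: shift_coordinate_nth len scaleR_diff_right add_diff_add)
    finally show ?case .
  qed
  then have "deriv (\<lambda>h. partial_deriv l (hamiltonian \<Gamma>) (shift_coordinate k h z)) 0 = deriv ?g 0"
    by (intro deriv_cong_ev) simp_all
  also have "\<dots> = - (\<Sum>j<length \<Gamma>. \<Sum>i<j. \<Gamma> ! i * \<Gamma> ! j * (((direction k i - direction k j) \<bullet> (direction l i - direction l j)) / (norm (z ! i - z ! j))\<^sup>2
       - 2 * ((z ! i - z ! j) \<bullet> (direction k i - direction k j)) * ((z ! i - z ! j) \<bullet> (direction l i - direction l j)) / (norm (z ! i - z ! j))^4))"
    by (intro DERIV_imp_deriv DERIV_minus DERIV_sum DERIV_cmult DERIV_inner_divide_norm ne) auto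
  also have "\<dots> = (\<Sum>j<length \<Gamma>. \<Sum>i<j. \<Gamma> ! i * \<Gamma> ! j *
    Re ((direction_cx k i - direction_cx k j) * (direction_cx l i - direction_cx l j) / (cx (z ! i) - cx (z ! j))\<^sup>2))"
    unfolding sum_negf[symmetric]
    by (intro sum.cong refl) (subst second_derivative_complex, rule ne, auto simp: cx_linear cx_direction)
  finally show ?thesis using kl by (simp add: hessian_def partial_deriv_def)
qed

section \<open>Entries of the stability matrix\<close>

lemma mat_inverse_eqI:
  fixes A :: "'a :: field mat"
  assumes A: "A \<in> carrier_mat n n" and B: "B \<in> carrier_mat n n" and AB: "A * B = 1\<^sub>m n"
  shows "mat_inverse A = Some B"
proof (cases "mat_inverse A")
  case None
  have "B * A = 1\<^sub>m n" using mat_mult_left_right_inverse[OF A B AB] .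
  then have "A \<in> Units (ring_mat TYPE('a) n ())"
    using A B AB unfolding Units_def by (auto simp: ring_mat_simps)
  then show ?thesis using mat_inverse(1)[OF A None, of "()"] by simp
next
  case (Some C)
  then have C: "A * C = 1\<^sub>m n" "C * A = 1\<^sub>m n" "C \<in> carrier_mat n n" using mat_inverse(2)[OF A] by auto
  have "C = C * (A * B)" unfolding AB using C by simp
  also have "\<dots> = B" using C A B by (simp add: assoc_mult_mat[symmetric])
  finally show ?thesis using Some by simp
qed

lemma K_matrix_carrier: "K_matrix n \<in> carrier_mat (2 * n) (2 * n)"
  by (induction n) (auto simp: K_matrix_def Let_def J_matrix_def mat_of_rows_list_def)

lemma K_matrix_index:
  "k < 2 * n \<Longrightarrow> l < 2 * n \<Longrightarrow> K_matrix n $$ (k, l) = (if k div 2 = l div 2 \<and> k \<noteq> l then (if even k then 1 else - 1) else 0)"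
proof (induction n arbitrary: k l)
  case (Suc n)
  have J: "J_matrix \<in> carrier_mat 2 2" by (intro carrier_matI) (simp_all add: J_matrix_def mat_of_rows_list_def)
  have Jc: "J_matrix $$ (0, 0) = 0" "J_matrix $$ (0, 1) = 1" "J_matrix $$ (1, 0) = - 1" "J_matrix $$ (1, 1) = 0"
    by (simp_all add: J_matrix_def mat_of_rows_list_def)
  have K: "K_matrix (Suc n) = four_block_mat J_matrix (0\<^sub>m 2 (2 * n)) (0\<^sub>m (2 * n) 2) (K_matrix n)"
    using K_matrix_carrier[of n] J by (simp add: K_matrix_def Let_def)
  have b: "K_matrix (Suc n) $$ (k, l) = (if k < 2 then if l < 2 then J_matrix $$ (k, l) else 0
     else if l < 2 then 0 else K_matrix n $$ (k - 2, l - 2))"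
    unfolding K using Suc.prems J K_matrix_carrier[of n] by (subst index_mat_four_block) auto
  show ?case
  proof (cases "k < 2 \<or> l < 2")
    case True
    have "k = 0 \<or> k = 1 \<or> 2 \<le> k" "l = 0 \<or> l = 1 \<or> 2 \<le> l" by linarith+
    then show ?thesis unfolding b using True Jc by auto
  next
    case False
    then obtain k' l' where kl: "k = k' + 2" "l = l' + 2" by (metis le_add_diff_inverse2 not_less)
    then show ?thesis unfolding b using Suc.IH[of k' l'] Suc.prems by auto
  qed
qed simp

lemma stability_matrix_index:
  assumes nz: "\<And>i. i < length \<Gamma> \<Longrightarrow> \<Gamma> ! i \<noteq> 0" and i: "i < length \<Gamma>" and l: "l < 2 * length \<Gamma>"
  shows "stability_matrix \<Gamma> \<omega> z \<in> carrier_mat (2 * length \<Gamma>) (2 * length \<Gamma>)"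
    and "stability_matrix \<Gamma> \<omega> z $$ (2 * i, l) = hessian \<Gamma> z $$ (2 * i + 1, l) / \<Gamma> ! i + (if l = 2 * i + 1 then \<omega> else 0)"
    and "stability_matrix \<Gamma> \<omega> z $$ (2 * i + 1, l) = - (hessian \<Gamma> z $$ (2 * i, l) / \<Gamma> ! i) - (if l = 2 * i then \<omega> else 0)"
proof -
  define n where "n = 2 * length \<Gamma>"
  define D where "D = mat_diag n (\<lambda>k. 1 / \<Gamma> ! (k div 2))"
  have D: "D \<in> carrier_mat n n" by (simp add: D_def mat_diag_def)
  have H: "hessian \<Gamma> z \<in> carrier_mat n n" by (simp add: hessian_def n_def)
  have K: "K_matrix (length \<Gamma>) \<in> carrier_mat n n" using K_matrix_carrier n_def by simp
  have "circulation_matrix \<Gamma> * D = mat_diag n (\<lambda>k. \<Gamma> ! (k div 2) * (1 / \<Gamma> ! (k div 2)))"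
    unfolding circulation_matrix_def D_def n_def[symmetric] by (rule mat_diag_diag)
  also have "\<dots> = 1\<^sub>m n" using nz by (intro eq_matI) (auto simp: mat_diag_def n_def)
  finally have "mat_inverse (circulation_matrix \<Gamma>) = Some D"
    using D by (intro mat_inverse_eqI) (auto simp: circulation_matrix_def n_def mat_diag_def)
  then have B: "stability_matrix \<Gamma> \<omega> z = K_matrix (length \<Gamma>) * (D * hessian \<Gamma> z + \<omega> \<cdot>\<^sub>m 1\<^sub>m n)"
    by (simp add: stability_matrix_def n_def)
  define X where "X = D * hessian \<Gamma> z + \<omega> \<cdot>\<^sub>m 1\<^sub>m n"
  have X: "X \<in> carrier_mat n n" using D H by (simp add: X_def)
  then show "stability_matrix \<Gamma> \<omega> z \<in> carrier_mat (2 * length \<Gamma>) (2 * length \<Gamma>)" unfolding B X_def[symmetric] using K n_def by auto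
  have Xe: "X $$ (k, l) = hessian \<Gamma> z $$ (k, l) / \<Gamma> ! (k div 2) + (if l = k then \<omega> else 0)" if "k < n" for k
  proof -
    have "(D * hessian \<Gamma> z) $$ (k, l) = hessian \<Gamma> z $$ (k, l) / \<Gamma> ! (k div 2)"
      unfolding D_def mat_diag_mult_left[OF H] using that l n_def by simp
    then show ?thesis using that l n_def D H by (auto simp: X_def)
  qed
  have BX: "stability_matrix \<Gamma> \<omega> z $$ (k, l) = (\<Sum>r<n. K_matrix (length \<Gamma>) $$ (k, r) * X $$ (r, l))" if "k < n" for k
    unfolding B X_def[symmetric] using K X that l n_def by (simp add: scalar_prod_def lessThan_atLeast0)
  have lt: "2 * i < n" "2 * i + 1 < n" using i n_def by auto
  have "stability_matrix \<Gamma> \<omega> z $$ (2 * i, l) = (\<Sum>r<n. if r = 2 * i + 1 then X $$ (r, l) else 0)"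
    unfolding BX[OF lt(1)] by (intro sum.cong refl) (use lt in \<open>auto simp: K_matrix_index n_def\<close>)
  also have "\<dots> = X $$ (2 * i + 1, l)" using lt by simp
  finally show "stability_matrix \<Gamma> \<omega> z $$ (2 * i, l) = hessian \<Gamma> z $$ (2 * i + 1, l) / \<Gamma> ! i + (if l = 2 * i + 1 then \<omega> else 0)"
    unfolding Xe[OF lt(2)] by simp
  have "stability_matrix \<Gamma> \<omega> z $$ (2 * i + 1, l) = (\<Sum>r<n. if r = 2 * i then - X $$ (r, l) else 0)"
    unfolding BX[OF lt(2)] by (intro sum.cong refl) (use lt in \<open>auto simp: K_matrix_index n_def\<close>)
  also have "\<dots> = - X $$ (2 * i, l)" using lt by simp
  finally show "stability_matrix \<Gamma> \<omega> z $$ (2 * i + 1, l) = - (hessian \<Gamma> z $$ (2 * i, l) / \<Gamma> ! i) - (if l = 2 * i then \<omega> else 0)"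
    unfolding Xe[OF lt(1)] by simp
qed

section \<open>Concave relative equilibria\<close>

lemma nth_sum_set: "distinct z \<Longrightarrow> length z = n \<Longrightarrow> (\<Sum>i<n. f (z ! i)) = sum f (set z)"
  using sum.reindex_bij_betw[OF bij_betw_nth[of z "{..<n}" "set z"], of f] by simp

text \<open>Averaging the vectors z_j - z_i with the circulations gives c - z_i, so the rotation
  term merges into the sum as the constant - \<omega> / \<Gamma>.\<close>

lemma relative_equilibrium_edge_relation:
  fixes \<Gamma> :: "real list" and z :: "plane list"
  assumes re: "relative_equilibrium \<Gamma> \<omega> z" and pos: "\<And>i. i < length \<Gamma> \<Longrightarrow> 0 < \<Gamma> ! i" and i: "i < length \<Gamma>"
  shows "(\<Sum>j\<in>{..<length \<Gamma>} - {i}. of_real (\<Gamma> ! j * (1 / (cmod (cx (z ! i) - cx (z ! j)))\<^sup>2 - \<omega> / sum_list \<Gamma>)) * (cx (z ! j) - cx (z ! i))) = 0"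
proof -
  define n where "n = length \<Gamma>"
  define T where "T = sum_list \<Gamma>"
  define \<zeta> where "\<zeta> j = cx (z ! j)" for j
  define G where "G j = \<Gamma> ! j" for j
  have T: "T = (\<Sum>j<n. G j)" unfolding T_def n_def G_def by (simp add: sum_list_sum_nth lessThan_atLeast0)
  have G: "0 < G j" if "j < n" for j using pos that n_def G_def by simp
  have Tpos: "0 < T" unfolding T using i G n_def by (intro sum_pos) auto
  define N where "N = {..<n} - {i}"
  have eq: "(\<Sum>j\<in>N. of_real (G i * G j / (cmod (\<zeta> i - \<zeta> j))\<^sup>2) * (\<zeta> j - \<zeta> i))
     + of_real (\<omega> * G i) * (\<zeta> i - of_real (1 / T) * (\<Sum>j<n. of_real (G j) * \<zeta> j)) = 0"
  proof -
    have "(\<Sum>j\<in>N. (\<Gamma> ! i * \<Gamma> ! j / (dist (z ! i) (z ! j))\<^sup>2) *\<^sub>R (z ! j - z ! i))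
        + (\<omega> * \<Gamma> ! i) *\<^sub>R (z ! i - center_of_vorticity \<Gamma> z) = 0"
      using re i unfolding relative_equilibrium_def N_def n_def by blast
    then have "cx ((\<Sum>j\<in>N. (\<Gamma> ! i * \<Gamma> ! j / (dist (z ! i) (z ! j))\<^sup>2) *\<^sub>R (z ! j - z ! i))
        + (\<omega> * \<Gamma> ! i) *\<^sub>R (z ! i - center_of_vorticity \<Gamma> z)) = 0" by (simp add: cx_linear)
    then show ?thesis
      unfolding center_of_vorticity_def cx_linear cx_sum dist_norm cmod_cx[symmetric] T_def \<zeta>_def n_def G_def .
  qed
  have c: "\<zeta> i - of_real (1 / T) * (\<Sum>j<n. of_real (G j) * \<zeta> j) = - (\<Sum>j\<in>N. of_real (G j / T) * (\<zeta> j - \<zeta> i))"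
  proof -
    have "(\<Sum>j<n. of_real (G j) * (\<zeta> j - \<zeta> i)) = (\<Sum>j<n. of_real (G j) * \<zeta> j) - of_real T * \<zeta> i"
      unfolding T by (simp add: algebra_simps sum_subtractf sum_distrib_left)
    moreover have "(\<Sum>j<n. of_real (G j) * (\<zeta> j - \<zeta> i)) = (\<Sum>j\<in>N. of_real (G j) * (\<zeta> j - \<zeta> i))"
      unfolding N_def by (intro sum.mono_neutral_right) auto
    moreover have "(\<Sum>j\<in>N. of_real (G j / T) * (\<zeta> j - \<zeta> i)) = of_real (1 / T) * (\<Sum>j\<in>N. of_real (G j) * (\<zeta> j - \<zeta> i))"
      unfolding sum_distrib_left by (intro sum.cong refl) simp
    ultimately show ?thesis using Tpos by (simp add: field_simps)
  qed
  have "of_real (G i) * (\<Sum>j\<in>N. of_real (G j * (1 / (cmod (\<zeta> i - \<zeta> j))\<^sup>2 - \<omega> / T)) * (\<zeta> j - \<zeta> i)) =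
     (\<Sum>j\<in>N. of_real (G i * G j / (cmod (\<zeta> i - \<zeta> j))\<^sup>2) * (\<zeta> j - \<zeta> i))
     - of_real (\<omega> * G i) * (\<Sum>j\<in>N. of_real (G j / T) * (\<zeta> j - \<zeta> i))"
    unfolding sum_distrib_left sum_subtractf[symmetric]
    by (intro sum.cong refl) (simp add: algebra_simps)
  also have "\<dots> = 0" using eq unfolding c by simp
  finally show ?thesis using G[of i] i unfolding N_def n_def \<zeta>_def G_def T_def by simp
qed

text \<open>Take the inner product of the relation with \<open>u a\<close>: the term of
  \<open>a\<close> itself is positive, so another one must be negative.\<close>

lemma obtuse_pair:
  fixes u :: "'i \<Rightarrow> complex"
  assumes "finite I" "\<And>i. i \<in> I \<Longrightarrow> 0 < A i" "(\<Sum>i\<in>I. of_real (A i) * u i) = 0" "a \<in> I" "u a \<noteq> 0"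
  shows "\<exists>j\<in>I. Re (u j * cnj (u a)) < 0"
proof (rule ccontr)
  assume "\<not> ?thesis"
  then have nn: "0 \<le> A j * Re (u j * cnj (u a))" if "j \<in> I" for j using assms(2)[OF that] that by (simp add: not_less less_imp_le)
  have "0 < A a * Re (u a * cnj (u a))"
  proof -
    have "Re (u a * cnj (u a)) = (cmod (u a))\<^sup>2" unfolding complex_norm_square[symmetric] by simp
    then show ?thesis using assms(2,4,5) by simp
  qed
  then have "0 < (\<Sum>j\<in>I. A j * Re (u j * cnj (u a)))" using nn assms(1,4) by (intro sum_pos2[of _ a]) auto
  also have "\<dots> = Re ((\<Sum>j\<in>I. of_real (A j) * u j) * cnj (u a))"
    unfolding sum_distrib_right Re_sum by (intro sum.cong refl) (simp add: algebra_simps)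
  finally show False unfolding assms(3) by simp
qed

lemma concave_balanced_configuration:
  fixes \<Gamma> :: "real list" and z :: "plane list"
  assumes len: "length \<Gamma> = 4" and pos: "\<And>i. i < 4 \<Longrightarrow> 0 < \<Gamma> ! i"
    and re: "relative_equilibrium \<Gamma> \<omega> z" and cc: "concave z"
  obtains a q where "balanced_configuration (\<lambda>i. \<Gamma> ! i) a (\<lambda>i. cx (z ! i)) (\<omega> / sum_list \<Gamma>)"
    "q < 4" "a q < 0" "\<And>i. i < 4 \<Longrightarrow> i \<noteq> q \<Longrightarrow> 0 < a i"
proof -
  have z: "length z = 4" "distinct z" using cc by (auto simp: concave_def)
  obtain p \<alpha> where p: "p \<in> set z" and "\<not> collinear (set z - {p})" and \<alpha>p: "\<alpha> p < 0"
    and \<alpha>pos: "\<And>v. v \<in> set z - {p} \<Longrightarrow> 0 < \<alpha> v"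
    and \<alpha>0: "sum \<alpha> (set z) = (0 :: real)" "(\<Sum>v\<in>set z. \<alpha> v *\<^sub>R v) = 0"
    and uniq: "\<And>c. sum c (set z) = 0 \<Longrightarrow> (\<Sum>v\<in>set z. c v *\<^sub>R v) = 0 \<Longrightarrow> \<exists>t. \<forall>v\<in>set z. c v = t * \<alpha> v"
    using concave_relation[OF cc] by blast
  define \<zeta> where "\<zeta> i = cx (z ! i)" for i
  define G where "G i = \<Gamma> ! i" for i
  define A where "A i = \<alpha> (z ! i)" for i
  define k where "k = \<omega> / sum_list \<Gamma>"
  have G: "0 < G i" if "i < 4" for i using pos that G_def by simp
  have \<zeta>eq: "\<zeta> i = \<zeta> j \<longleftrightarrow> i = j" if "i < 4" "j < 4" for i j
    unfolding \<zeta>_def cx_eq_iff using that z by (simp add: nth_eq_iff_index_eq)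
  obtain q where q: "q < 4" "z ! q = p" using p z by (metis in_set_conv_nth)
  have Aq: "A q < 0" using \<alpha>p q A_def by simp
  have Apos: "0 < A i" if "i < 4" "i \<noteq> q" for i
    unfolding A_def using that q z by (intro \<alpha>pos) (auto simp: nth_eq_iff_index_eq)
  have Anz: "A i \<noteq> 0" if "i < 4" for i using Aq Apos that by (cases "i = q") force+
  have A0: "(\<Sum>i<4. A i) = 0" unfolding A_def nth_sum_set[OF z(2,1)] by (rule \<alpha>0)
  have Az: "(\<Sum>i<4. of_real (A i) * \<zeta> i) = 0"
  proof -
    have "(\<Sum>i<4. of_real (A i) * \<zeta> i) = (\<Sum>v\<in>set z. cx (\<alpha> v *\<^sub>R v))"
      unfolding A_def \<zeta>_def cx_linear by (rule nth_sum_set[OF z(2,1)])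
    also have "\<dots> = 0" unfolding cx_sum[symmetric] \<alpha>0 by (simp add: cx_linear)
    finally show ?thesis .
  qed
  have uniq': "\<exists>t. \<forall>i<4. c i = t * A i" if c: "(\<Sum>i<4. c i) = 0" "(\<Sum>i<4. of_real (c i) * \<zeta> i) = 0" for c :: "nat \<Rightarrow> real"
  proof -
    define d where "d v = c (inv_into {..<4} ((!) z) v)" for v
    have "inj_on ((!) z) {..<4}" using z by (simp add: inj_on_nth)
    then have d: "d (z ! i) = c i" if "i < 4" for i using that unfolding d_def by simp
    have "sum d (set z) = (\<Sum>i<4. c i)" unfolding nth_sum_set[OF z(2,1), symmetric] using d by simp
    moreover have "cx (\<Sum>v\<in>set z. d v *\<^sub>R v) = (\<Sum>i<4. of_real (c i) * \<zeta> i)"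
      unfolding cx_sum cx_linear nth_sum_set[OF z(2,1), symmetric] \<zeta>_def using d by simp
    then have "cx (\<Sum>v\<in>set z. d v *\<^sub>R v) = cx 0" unfolding c by (simp add: cx_linear)
    ultimately obtain t where t: "\<forall>v\<in>set z. d v = t * \<alpha> v" using uniq[of d] c unfolding cx_eq_iff by auto
    then have "c i = t * A i" if "i < 4" for i using d[OF that] that z unfolding A_def by (metis nth_mem)
    then show ?thesis by blast
  qed
  define s where "s i j = 1 / (cmod (\<zeta> i - \<zeta> j))\<^sup>2 - k" for i j
  have ssym: "s i j = s j i" for i j by (simp add: s_def norm_minus_commute)
  have "\<exists>t. \<forall>j<4. j \<noteq> i \<longrightarrow> G j * s i j = t * A j" if i: "i < 4" for i
  proof -
    \<comment> \<open>The free entry at \<open>i\<close> makes the total zero; the equilibrium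
      equation at \<open>i\<close> then says that \<open>c\<close> is an affine relation.\<close>
    define c where "c j = (if j = i then - (\<Sum>l\<in>{..<4} - {i}. G l * s i l) else G j * s i j)" for j
    have split: "(\<Sum>j<4. f j) = f i + (\<Sum>j\<in>{..<4} - {i}. f j)" for f :: "nat \<Rightarrow> 'b :: comm_monoid_add"
      using i by (intro sum.remove) auto
    have ci: "c i = - (\<Sum>l\<in>{..<4} - {i}. G l * s i l)" by (simp add: c_def)
    have cN: "(\<Sum>j\<in>{..<4} - {i}. h (c j) j) = (\<Sum>j\<in>{..<4} - {i}. h (G j * s i j) j)" for h :: "real \<Rightarrow> nat \<Rightarrow> 'b :: comm_monoid_add"
      by (intro sum.cong refl) (auto simp: c_def)
    have "(\<Sum>j<4. c j) = 0" unfolding split ci cN[of "\<lambda>x j. x"] by simp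
    moreover have "(\<Sum>j<4. of_real (c j) * \<zeta> j) = (\<Sum>j\<in>{..<4} - {i}. of_real (G j * s i j) * (\<zeta> j - \<zeta> i))"
      unfolding split ci cN[of "\<lambda>x j. of_real x * \<zeta> j"] right_diff_distrib sum_subtractf
      by (simp add: sum_distrib_right)
    moreover have "(\<Sum>j\<in>{..<4} - {i}. of_real (G j * s i j) * (\<zeta> j - \<zeta> i)) = 0"
      using relative_equilibrium_edge_relation[OF re, of i] pos i len unfolding G_def s_def \<zeta>_def k_def by simp
    ultimately obtain t where "\<forall>j<4. c j = t * A j" using uniq'[of c] by metis
    then show ?thesis unfolding c_def by (metis (full_types))
  qed
  then obtain t where t: "\<And>i j. i < 4 \<Longrightarrow> j < 4 \<Longrightarrow> j \<noteq> i \<Longrightarrow> G j * s i j = t i * A j" by metis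
  \<comment> \<open>By symmetry of \<open>s\<close> the quotient t i * G i / A i does not depend on
    i; \<tau> is minus its value.\<close>
  define \<tau> where "\<tau> = - (t 0 * G 0 / A 0)"
  have tt: "t i * G i * A j = t j * G j * A i" if "i < 4" "j < 4" for i j
  proof (cases "i = j")
    case False
    have "G i * (G j * s i j) = G j * (G i * s j i)" by (simp add: ssym[of i j])
    then show ?thesis unfolding t[OF that False[symmetric]] t[OF that(2,1) False] by (simp add: mult_ac)
  qed simp
  have tG: "t i * G i = - \<tau> * A i" if "i < 4" for i
    using tt[OF that, of 0] Anz[of 0] by (simp add: \<tau>_def field_simps)
  have s\<tau>: "s i j = - \<tau> * (A i / G i) * (A j / G j)" if "i < 4" "j < 4" "i \<noteq> j" for i j
  proof -
    have "G i * (G j * s i j) = (t i * G i) * A j" unfolding t[OF that(1,2) that(3)[symmetric]] by simp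
    then show ?thesis unfolding tG[OF that(1)] using G[OF that(1)] G[OF that(2)] by (simp add: field_simps)
  qed
  \<comment> \<open>Next the signs of \<tau> and \<open>k\<close>. Seen from the interior vortex
    \<open>q\<close>, some vertex \<open>j\<close> makes an obtuse angle with \<open>b\<close>, so
    the side from \<open>j\<close> to \<open>b\<close> is longer than the segment from
    \<open>q\<close> to \<open>b\<close>. Comparing the two values of \<open>s\<close> gives \<tau>
    > 0.\<close>
  obtain b where b: "b < 4" "b \<noteq> q" by (metis zero_less_numeral one_less_numeral_iff semiring_norm(76) zero_neq_one)
  define u where "u j = \<zeta> j - \<zeta> q" for j
  have "(\<Sum>j\<in>{..<4} - {q}. of_real (A j) * u j) = (\<Sum>j<4. of_real (A j) * u j)"
    unfolding u_def by (intro sum.mono_neutral_left) auto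
  also have "\<dots> = (\<Sum>j<4. of_real (A j) * \<zeta> j) - of_real (\<Sum>j<4. A j) * \<zeta> q"
    unfolding u_def by (simp add: algebra_simps sum_subtractf sum_distrib_left)
  also have "\<dots> = 0" unfolding Az A0 by simp
  finally have "(\<Sum>j\<in>{..<4} - {q}. of_real (A j) * u j) = 0" .
  from obtuse_pair[OF _ _ this, of b] obtain j where j: "j < 4" "j \<noteq> q" "Re (u j * cnj (u b)) < 0"
    using Apos b \<zeta>eq[OF b(1) q(1)] by (auto simp: u_def)
  have jb: "j \<noteq> b"
  proof
    assume "j = b"
    then have "Re (u j * cnj (u b)) = (cmod (u b))\<^sup>2" unfolding cmod_power2 by (simp add: power2_eq_square)
    then show False using j(3) by simp
  qed
  have ub: "0 < (cmod (u b))\<^sup>2" using \<zeta>eq[OF b(1) q(1)] b by (simp add: u_def)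
  have "(cmod (u b))\<^sup>2 < (cmod (\<zeta> j - \<zeta> b))\<^sup>2"
  proof -
    have jb': "\<zeta> j - \<zeta> b = u j - u b" by (simp add: u_def)
    have "(cmod (u j - u b))\<^sup>2 = (cmod (u j))\<^sup>2 - 2 * Re (u j * cnj (u b)) + (cmod (u b))\<^sup>2"
      unfolding cmod_power2 by (simp add: algebra_simps power2_eq_square)
    moreover have "0 \<le> (cmod (u j))\<^sup>2" by simp
    ultimately show ?thesis using j(3) unfolding jb' by linarith
  qed
  then have "s j b < s q b" using ub unfolding s_def u_def norm_minus_commute[of "\<zeta> q"]
    by (simp add: frac_less2)
  then have "0 < \<tau> * ((A j / G j) * (A b / G b) - (A q / G q) * (A b / G b))"
    unfolding s\<tau>[OF j(1) b(1) jb] s\<tau>[OF q(1) b(1) b(2)[symmetric]] by (simp add: algebra_simps)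
  moreover have Ab: "0 < A b / G b" "0 < A j / G j" "A q / G q < 0"
    using Apos b j G q Aq by (simp_all add: divide_neg_pos)
  have "0 < (A j / G j) * (A b / G b) - (A q / G q) * (A b / G b)"
    using mult_neg_pos[OF Ab(3,1)] mult_pos_pos[OF Ab(2,1)] by linarith
  ultimately have \<tau>: "0 < \<tau>" by (metis zero_less_mult_iff not_less_iff_gr_or_eq)
  \<comment> \<open>Two vertices of positive weight satisfy 1/r^2 < k, hence k > 0.\<close>
  have "s j b < 0" unfolding s\<tau>[OF j(1) b(1) jb] using mult_pos_pos[OF mult_pos_pos[OF \<tau> Ab(2)] Ab(1)] by linarith
  moreover have "0 \<le> 1 / (cmod (\<zeta> j - \<zeta> b))\<^sup>2" by simp
  ultimately have k: "0 < k" unfolding s_def by linarith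
  \<comment> \<open>This scaling turns 1/r_ij^2 = k + s_ij into k (1 - a_i a_j).\<close>
  define a where "a i = A i / G i * sqrt (\<tau> / k)" for i
  have sq: "0 < sqrt (\<tau> / k)" "sqrt (\<tau> / k) * sqrt (\<tau> / k) = \<tau> / k" using \<tau> k by simp_all
  have Ga: "G i * a i = A i * sqrt (\<tau> / k)" if "i < 4" for i using G[OF that] by (simp add: a_def)
  have "balanced_configuration G a \<zeta> k"
  proof
    show "(\<Sum>i<4. G i * a i) = 0" using Ga A0 by (simp flip: sum_distrib_right)
    have "(\<Sum>i<4. of_real (G i * a i) * \<zeta> i) = of_real (sqrt (\<tau> / k)) * (\<Sum>i<4. of_real (A i) * \<zeta> i)"
      unfolding sum_distrib_left by (intro sum.cong refl) (simp only: Ga lessThan_iff of_real_mult mult_ac)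
    then show "(\<Sum>i<4. of_real (G i * a i) * \<zeta> i) = 0" unfolding Az by simp
    show "a i \<noteq> 0" if "i < 4" for i using Anz[OF that] G[OF that] sq(1)
      unfolding a_def by (metis mult_eq_0_iff divide_eq_0_iff less_irrefl)
    show "\<exists>t. \<forall>i<4. c i = t * (G i * a i)" if c: "(\<Sum>i<4. c i) = 0" "(\<Sum>i<4. of_real (c i) * \<zeta> i) = 0" for c :: "nat \<Rightarrow> real"
    proof -
      obtain t where "\<forall>i<4. c i = t * A i" using uniq'[OF c] by blast
      then have "\<forall>i<4. c i = (t / sqrt (\<tau> / k)) * (G i * a i)" using \<tau> k Ga by simp
      then show ?thesis ..
    qed
    show "k * (cmod (\<zeta> i - \<zeta> j))\<^sup>2 * (1 - a i * a j) = 1" if ij: "i < 4" "j < 4" "i \<noteq> j" for i j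
    proof -
      have "a i * a j = (A i / G i) * (A j / G j) * (sqrt (\<tau> / k) * sqrt (\<tau> / k))"
        unfolding a_def by (simp only: mult_ac)
      also have "\<dots> = - s i j / k" unfolding sq(2) s\<tau>[OF ij] by simp
      finally have aa: "a i * a j = - s i j / k" .
      have R: "(cmod (\<zeta> i - \<zeta> j))\<^sup>2 \<noteq> 0" using \<zeta>eq[OF ij(1,2)] ij(3) by simp
      show ?thesis unfolding aa s_def using R k by (simp add: field_simps)
    qed
  qed (use G k in auto)
  moreover have "a q < 0" using Aq G[OF q(1)] sq(1) unfolding a_def by (intro mult_neg_pos divide_neg_pos)
  moreover have "0 < a i" if "i < 4" "i \<noteq> q" for i
    using Apos[OF that] G[OF that(1)] sq(1) unfolding a_def by (intro mult_pos_pos divide_pos_pos)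
  ultimately show thesis using that[of a q] q(1) unfolding G_def[abs_def] \<zeta>_def[abs_def] k_def by blast
qed

lemma double_sum_upper_half:
  fixes F :: "nat \<Rightarrow> nat \<Rightarrow> real"
  assumes "\<And>i j. F i j = F j i" "\<And>i. F i i = 0"
  shows "(\<Sum>j<n. \<Sum>i<j. F i j) = (\<Sum>i<n. \<Sum>j<n. F i j) / 2"
proof (induction n)
  case (Suc n)
  have "(\<Sum>i<Suc n. \<Sum>j<Suc n. F i j) = (\<Sum>i<n. \<Sum>j<n. F i j) + (\<Sum>i<n. F i n) + (\<Sum>j<n. F n j)"
    using assms(2) by (simp add: sum.distrib)
  also have "(\<Sum>j<n. F n j) = (\<Sum>i<n. F i n)" using assms(1) by (intro sum.cong refl)
  finally show ?case using Suc by simp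
qed simp

section \<open>Real Hessian entries from the complex bilinear form\<close>

context balanced_configuration
begin

lemma hessian_bilin:
  assumes \<Gamma>: "length gs = 4" "\<Gamma> = (\<lambda>i. gs ! i)" and z: "length zs = 4" "distinct zs" "z = (\<lambda>i. cx (zs ! i))"
    and pq: "p < 8" "q < 8"
  shows "hessian gs zs $$ (p, q) = Re ((if even p then 1 else \<i>) * (if even q then 1 else \<i>)
    * bilin (unit_vec_fun (p div 2)) (unit_vec_fun (q div 2)))"
proof -
  define F where "F i j = \<Gamma> i * \<Gamma> j * Re ((direction_cx p i - direction_cx p j) * (direction_cx q i - direction_cx q j) / (z i - z j)\<^sup>2)" for i j
  define \<iota> :: "nat \<Rightarrow> complex" where "\<iota> p = (if even p then 1 else \<i>)" for p
  have d: "direction_cx p i = \<iota> p * unit_vec_fun (p div 2) i" for p i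
    by (auto simp: direction_cx_def \<iota>_def unit_vec_fun_def)
  have F1: "F i j = F j i" for i j
  proof -
    have "(direction_cx p i - direction_cx p j) * (direction_cx q i - direction_cx q j) / (z i - z j)\<^sup>2
      = (direction_cx p j - direction_cx p i) * (direction_cx q j - direction_cx q i) / (z j - z i)\<^sup>2"
      by (simp add: power2_commute) (simp add: algebra_simps)
    then show ?thesis unfolding F_def by simp
  qed
  have F2: "F i i = 0" for i by (simp add: F_def)
  have "hessian gs zs $$ (p, q) = (\<Sum>j<4. \<Sum>i<j. F i j)"
    using hessian_complex[of zs gs p q] \<Gamma> z pq unfolding F_def by simp
  also have "\<dots> = (\<Sum>i<4. \<Sum>j<4. F i j) / 2" by (rule double_sum_upper_half[OF F1 F2])
  also have "\<dots> = Re (\<iota> p * \<iota> q * bilin (unit_vec_fun (p div 2)) (unit_vec_fun (q div 2)))"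
  proof -
    have "F i j = Re (\<iota> p * \<iota> q * (of_real (\<Gamma> i * \<Gamma> j) * ((unit_vec_fun (p div 2) i - unit_vec_fun (p div 2) j) / (z i - z j)
       * ((unit_vec_fun (q div 2) i - unit_vec_fun (q div 2) j) / (z i - z j)))))" for i j
    proof -
      have r: "c * Re w = Re (of_real c * w)" for c w by simp
      show ?thesis unfolding F_def d r by (rule arg_cong[of _ _ Re]) (simp add: power2_eq_square algebra_simps)
    qed
    then have "(\<Sum>i<4. \<Sum>j<4. F i j) = Re (\<iota> p * \<iota> q * (2 * bilin (unit_vec_fun (p div 2)) (unit_vec_fun (q div 2))))"
      unfolding bilin_def by (simp only: Re_sum[symmetric] sum_distrib_left[symmetric]) simp
    also have "\<dots> = 2 * Re (\<iota> p * \<iota> q * bilin (unit_vec_fun (p div 2)) (unit_vec_fun (q div 2)))"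
    proof -
      have "Re (x * (2 * y)) = 2 * Re (x * y)" for x y by simp
      then show ?thesis .
    qed
    finally show ?thesis by simp
  qed
  finally show ?thesis unfolding \<iota>_def .
qed

end

theorem theorem4p9:
  fixes m \<omega> :: real and z :: "plane list"
  assumes "0 < m" and "m < 1"
    and "relative_equilibrium [1, 1, m, m] \<omega> z"
    and "concave z"
  shows "(kite z \<or> asymmetric z) \<and>
    linearly_unstable [1, 1, m, m] \<omega> z \<and>
    (\<exists>\<sigma> \<beta> :: real. \<sigma> \<noteq> 0 \<and> \<beta> \<noteq> 0 \<and> \<bar>\<beta>\<bar> \<le> \<omega> \<and>
      nontrivial_eigenvalues [1, 1, m, m] \<omega> z
        {# complex_of_real \<sigma>, - complex_of_real \<sigma>,
           \<i> * complex_of_real \<beta>, - (\<i> * complex_of_real \<beta>) #})"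
proof -
  let ?\<Gamma> = "[1, 1, m, m]"
  let ?B = "stability_matrix ?\<Gamma> \<omega> z"
  have idx: "i = 0 \<or> i = 1 \<or> i = 2 \<or> i = 3" if "i < 4" for i :: nat using that by arith
  have pos: "0 < ?\<Gamma> ! i" if "i < 4" for i using idx[OF that] assms(1) by auto
  have z: "length z = 4" "distinct z" using assms(4) by (auto simp: concave_def)
  obtain a q where conf: "balanced_configuration (\<lambda>i. ?\<Gamma> ! i) a (\<lambda>i. cx (z ! i)) (\<omega> / sum_list ?\<Gamma>)"
    and q: "q < 4" "a q < 0" "\<And>i. i < 4 \<Longrightarrow> i \<noteq> q \<Longrightarrow> 0 < a i"
    using concave_balanced_configuration[OF _ pos assms(3,4)] by auto
  have "two_pair_configuration (\<lambda>i. ?\<Gamma> ! i) a (\<lambda>i. cx (z ! i)) (\<omega> / sum_list ?\<Gamma>)"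
  proof (intro two_pair_configuration.intro two_pair_configuration_axioms.intro conf)
    have "q = 0 \<or> q = 1 \<or> q = 2 \<or> q = 3" by (rule idx[OF q(1)])
    then show "0 < a 0 \<and> 0 < a 1 \<and> a 2 * a 3 < 0 \<or> 0 < a 2 \<and> 0 < a 3 \<and> a 0 * a 1 < 0"
      using q(2) q(3)[of 0] q(3)[of 1] q(3)[of 2] q(3)[of 3] by (elim disjE) (simp_all add: mult_neg_pos mult_pos_neg)
  qed (use assms(2) in simp_all)
  then interpret C: two_pair_configuration "\<lambda>i. ?\<Gamma> ! i" a "\<lambda>i. cx (z ! i)" "\<omega> / sum_list ?\<Gamma>" .
  have freq: "C.frequency = \<omega>"
    unfolding C.frequency_def C.total_def sum_lessThan_4 using assms(1) by (simp add: field_simps)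
  have B: "?B \<in> carrier_mat 8 8"
    using stability_matrix_index(1)[of ?\<Gamma> 0 0 \<omega> z] pos by (simp add: less_imp_neq[symmetric])
  have Be: "?B $$ (2 * i, l) = hessian ?\<Gamma> z $$ (2 * i + 1, l) / ?\<Gamma> ! i + (if l = 2 * i + 1 then \<omega> else 0)"
    "?B $$ (2 * i + 1, l) = - (hessian ?\<Gamma> z $$ (2 * i, l) / ?\<Gamma> ! i) - (if l = 2 * i then \<omega> else 0)"
    if "i < 4" "l < 8" for i l
  proof -
    have nz: "?\<Gamma> ! j \<noteq> 0" if "j < length ?\<Gamma>" for j using pos[of j] that by simp
    have il: "i < length ?\<Gamma>" "l < 2 * length ?\<Gamma>" using that by simp_all
    show "?B $$ (2 * i, l) = hessian ?\<Gamma> z $$ (2 * i + 1, l) / ?\<Gamma> ! i + (if l = 2 * i + 1 then \<omega> else 0)"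
      by (rule stability_matrix_index(2)[OF nz il])
    show "?B $$ (2 * i + 1, l) = - (hessian ?\<Gamma> z $$ (2 * i, l) / ?\<Gamma> ! i) - (if l = 2 * i then \<omega> else 0)"
      by (rule stability_matrix_index(3)[OF nz il])
  qed
  have co: "C.bilin (C.unit_vec_fun i) (C.unit_vec_fun j) = of_real (?\<Gamma> ! i) * C.coupling $$ (i, j)" if "i < 4" "j < 4" for i j
    using that pos[of i] by (simp add: C.coupling_def)
  have hb: "hessian ?\<Gamma> z $$ (k, l) = Re ((if even k then 1 else \<i>) * (if even l then 1 else \<i>)
    * C.bilin (C.unit_vec_fun (k div 2)) (C.unit_vec_fun (l div 2)))" if "k < 8" "l < 8" for k l
    by (rule C.hessian_bilin[OF _ refl z refl that]) simp
  have ent: "hessian ?\<Gamma> z $$ (2 * i, 2 * j) = ?\<Gamma> ! i * Re (C.coupling $$ (i, j))"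
    "hessian ?\<Gamma> z $$ (2 * i, 2 * j + 1) = - ?\<Gamma> ! i * Im (C.coupling $$ (i, j))"
    "hessian ?\<Gamma> z $$ (2 * i + 1, 2 * j) = - ?\<Gamma> ! i * Im (C.coupling $$ (i, j))"
    "hessian ?\<Gamma> z $$ (2 * i + 1, 2 * j + 1) = - ?\<Gamma> ! i * Re (C.coupling $$ (i, j))" if "i < 4" "j < 4" for i j
  proof -
    have lt: "2 * i < 8" "2 * i + 1 < 8" "2 * j < 8" "2 * j + 1 < 8" using that by auto
    have dv: "2 * i div 2 = i" "(2 * i + 1) div 2 = i" "2 * j div 2 = j" "(2 * j + 1) div 2 = j" by simp_all
    show "hessian ?\<Gamma> z $$ (2 * i, 2 * j) = ?\<Gamma> ! i * Re (C.coupling $$ (i, j))"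
      unfolding hb[OF lt(1,3)] dv co[OF that] by simp
    show "hessian ?\<Gamma> z $$ (2 * i, 2 * j + 1) = - ?\<Gamma> ! i * Im (C.coupling $$ (i, j))"
      unfolding hb[OF lt(1,4)] dv co[OF that] by simp
    show "hessian ?\<Gamma> z $$ (2 * i + 1, 2 * j) = - ?\<Gamma> ! i * Im (C.coupling $$ (i, j))"
      unfolding hb[OF lt(2,3)] dv co[OF that] by simp
    show "hessian ?\<Gamma> z $$ (2 * i + 1, 2 * j + 1) = - ?\<Gamma> ! i * Re (C.coupling $$ (i, j))"
      unfolding hb[OF lt(2,4)] dv co[OF that] by simp
  qed
  have "\<exists>\<sigma> \<beta> :: real. \<sigma> \<noteq> 0 \<and> \<beta> \<noteq> 0 \<and> \<bar>\<beta>\<bar> \<le> C.frequency \<and> proots (char_poly (map_mat complex_of_real ?B)) =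
    {# 0, 0, \<i> * of_real C.frequency, - (\<i> * of_real C.frequency) #} +
    {# of_real \<sigma>, - of_real \<sigma>, \<i> * of_real \<beta>, - (\<i> * of_real \<beta>) #}"
  proof (rule C.nontrivial_spectrum[OF B])
    fix i j :: nat assume ij: "i < 4" "j < 4"
    have lt: "2 * j < 8" "2 * j + 1 < 8" using ij by auto
    have g: "?\<Gamma> ! i \<noteq> 0" using pos[OF ij(1)] by simp
    have par: "2 * j \<noteq> 2 * i + 1" "2 * j + 1 \<noteq> 2 * i" by presburger+
    show "?B $$ (2 * i, 2 * j) = - Im (C.coupling $$ (i, j))"
      unfolding Be(1)[OF ij(1) lt(1)] ent[OF ij] using g par by simp
    show "?B $$ (2 * i, 2 * j + 1) = - Re (C.coupling $$ (i, j)) + (if i = j then C.frequency else 0)"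
      unfolding Be(1)[OF ij(1) lt(2)] ent[OF ij] freq using g by auto
    show "?B $$ (2 * i + 1, 2 * j) = - Re (C.coupling $$ (i, j)) - (if i = j then C.frequency else 0)"
      unfolding Be(2)[OF ij(1) lt(1)] ent[OF ij] freq using g by auto
    show "?B $$ (2 * i + 1, 2 * j + 1) = Im (C.coupling $$ (i, j))"
      unfolding Be(2)[OF ij(1) lt(2)] ent[OF ij] using g par by simp
  qed
  then obtain \<sigma> \<beta> :: real where sb: "\<sigma> \<noteq> 0" "\<beta> \<noteq> 0" "\<bar>\<beta>\<bar> \<le> \<omega>"
    and pr: "proots (char_poly (complex_stability_matrix ?\<Gamma> \<omega> z)) =
    {# 0, 0, \<i> * of_real \<omega>, - (\<i> * of_real \<omega>) #} +
    {# of_real \<sigma>, - of_real \<sigma>, \<i> * of_real \<beta>, - (\<i> * of_real \<beta>) #}"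
    unfolding freq by blast
  have CB: "complex_stability_matrix ?\<Gamma> \<omega> z \<in> carrier_mat 8 8" using B by simp
  have "of_real \<sigma> \<in># proots (char_poly (complex_stability_matrix ?\<Gamma> \<omega> z))" unfolding pr by simp
  then have "poly (char_poly (complex_stability_matrix ?\<Gamma> \<omega> z)) (of_real \<sigma>) = 0"
    by (metis count_eq_zero_iff count_proots order_root order_0I proots_0 set_mset_empty empty_iff)
  then have "eigenvalue (complex_stability_matrix ?\<Gamma> \<omega> z) (of_real \<sigma>)"
    using eigenvalue_root_char_poly[OF CB] by simp
  then have "linearly_unstable ?\<Gamma> \<omega> z" using sb(1) unfolding linearly_unstable_def by (metis Re_complex_of_real)
  then show ?thesis
    using concave_kite_or_asymmetric[OF assms(4)] sb pr unfolding nontrivial_eigenvalues_def by metis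
qed

end
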